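(* Let $(X,d,\mu)$ be a space of homogeneous type and $m\ge1$ an integer. Let $p_i(\cdot)\in LH\cap\mathscr P$, $i=1,\dots,m$, with $\frac1{p(\cdot)}=\sum_{i=1}^m\frac1{p_i(\cdot)}$, let $q(\cdot)\in\mathscr P_0$ and let $\eta\in[0,m)$ be a constant with $\frac1{p(\cdot)}-\frac1{q(\cdot)}=\eta$. Let $\vec\omega=(\omega_1,\dots,\omega_m,\omega)$ be a multiple weight with $\omega=\prod_{i=1}^m\omega_i$. Then $\mathscr M_\eta$ is bounded from $L^{p_1(\cdot)}(X,\omega_1)\times\cdots\times L^{p_m(\cdot)}(X,\omega_m)$ to $WL^{q(\cdot)}(X,\omega)$ if and only if $\vec\omega\in A_{\vec p(\cdot),q(\cdot)}(X)$. Moreover, $$C^{-1}[\vec\omega]_{A_{\vec p(\cdot),q(\cdot)}(X)}\le\|\mathscr M_\eta\|_{\prod_{i=1}^m L^{p_i(\cdot)}(X,\omega_i)\to WL^{q(\cdot)}(X,\omega)}\le C_{\vec\omega,\eta,m,\mu,X,\vec p(\cdot)},$$ where $C>0$ is independent of $\vec\omega$ and (when $\vec\omega\in A_{\vec p(\cdot),q(\cdot)}(X)$) $C_{\vec\omega,\eta,m,\mu,X,\vec p(\cdot)}$ is a finite constant depending on the indicated quantities, with $\vec p(\cdot)=(p_1(\cdot),\dots,p_m(\cdot))$.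
   Context: Space of homogeneous type: a nonempty set $X$ with a quasi-metric $d:X\times X\to[0,\infty)$ (i.e. $d(x,y)=0$ when $x=y$, $d(x,y)=d(y,x)$, and $d(x,y)\le A_0(d(x,z)+d(z,y))$ for some constant $A_0\ge1$) and a regular measure $\mu$ on the $\sigma$-algebra generated by open sets and quasi-metric balls $B(x,r)$, which is doubling: $0<\mu(B(x,2r))\le C_\mu\,\mu(B(x,r))<\infty$ for all $x\in X$, $r>0$. Exponents: for measurable $p(\cdot)$ on $X$, $p_-=\operatorname{ess\,inf}_X p$, $p_+=\operatorname{ess\,sup}_X p$. $\mathscr P$ is the set of measurable $p(\cdot):X\to[1,\infty)$ with $1<p_-\le p_+<\infty$; $\mathscr P_0$ is the set of measurable $p(\cdot):X\to(0,\infty)$ with $0<p_-\le p_+<\infty$. The conjugate exponent is $p'(\cdot)=p(\cdot)/(p(\cdot)-1)$. $LH$ is the class of $p(\cdot)$ for which there are a constant $C$ and a number $p_\infty\in\mathbb R$ with $|p(x)-p(y)|\le C/\log(e+1/d(x,y))$ whenever $d(x,y)<\frac12$, and $|p(x)-p_\infty|\le C/\log(e+d(x,x_0))$ for all $x\in X$, where $x_0\in X$ is a fixed point (the choice of $x_0$ is immaterial). Norms: for $p(\cdot)\in\mathscr P_0$, $\|f\|_{L^{p(\cdot)}}=\|f\|_{p(\cdot)}=\inf\{\lambda>0:\int_X|f(x)/\lambda|^{p(x)}d\mu\le1\}$, $\|f\|_{L^{p(\cdot)}(X,\omega)}=\|\omega f\|_{p(\cdot)}$, and $\|f\|_{WL^{q(\cdot)}(X,\omega)}=\sup_{t>0}\|t\,\omega\,\chi_{\{x\in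 X:|f(x)|>t\}}\|_{q(\cdot)}$. Weights: a weight is a locally integrable $\omega:X\to[0,\infty]$ with $0<\omega<\infty$ a.e.; a multiple weight $\vec\omega=(\omega_1,\dots,\omega_m,\omega)$ is a tuple of weights. $\vec\omega\in A_{\vec p(\cdot),q(\cdot)}(X)$ means $$[\vec\omega]_{A_{\vec p(\cdot),q(\cdot)}(X)}:=\sup_{B\subseteq X}\mu(B)^{\eta-m}\|\omega\chi_B\|_{q(\cdot)}\prod_{i=1}^m\|\omega_i^{-1}\chi_B\|_{p_i'(\cdot)}<\infty,$$ the supremum being over all balls $B$. Operator: the multilinear fractional maximal operator is $\mathscr M_\eta(\vec f)(x)=\sup_{B\subseteq X}\mu(B)^\eta\Big(\prod_{i=1}^m\frac1{\mu(B)}\int_B|f_i|\,d\mu\Big)\chi_B(x)$, the supremum being over all balls $B$. Its operator norm is the least $C\ge0$ (possibly $\infty$) with $\|\mathscr M_\eta(\vec f)\|_{WL^{q(\cdot)}(X,\omega)}\le C\prod_i\|f_i\|_{L^{p_i(\cdot)}(X,\omega_i)}$. *)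

theory Defs
  imports "HOL-Probability.Essential_Supremum"
begin

section \<open>Spaces of homogeneous type\<close>

definition qball :: "'a set \<Rightarrow> ('a \<Rightarrow> 'a \<Rightarrow> real) \<Rightarrow> 'a \<Rightarrow> real \<Rightarrow> 'a set" where
  "qball X d x r = {y \<in> X. d x y < r}"

definition qballs :: "'a set \<Rightarrow> ('a \<Rightarrow> 'a \<Rightarrow> real) \<Rightarrow> 'a set set" where
  "qballs X d = {qball X d x r | x r. x \<in> X \<and> 0 < r}"

definition qtopology :: "'a set \<Rightarrow> ('a \<Rightarrow> 'a \<Rightarrow> real) \<Rightarrow> 'a topology" where
  "qtopology X d = topology (\<lambda>U. U \<subseteq> X \<and> (\<forall>x\<in>U. \<exists>r>0. qball X d x r \<subseteq> U))"

lemma openin_qtopology: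
  "openin (qtopology X d) U \<longleftrightarrow> U \<subseteq> X \<and> (\<forall>x\<in>U. \<exists>r>0. qball X d x r \<subseteq> U)"
proof -
  have "istopology (\<lambda>U. U \<subseteq> X \<and> (\<forall>x\<in>U. \<exists>r>0. qball X d x r \<subseteq> U))"
    unfolding istopology_def
  proof (intro conjI allI impI)
    fix S T
    assume S: "S \<subseteq> X \<and> (\<forall>x\<in>S. \<exists>r>0. qball X d x r \<subseteq> S)"
      and T: "T \<subseteq> X \<and> (\<forall>x\<in>T. \<exists>r>0. qball X d x r \<subseteq> T)"
    show "S \<inter> T \<subseteq> X" using S by blast
    show "\<forall>x\<in>S \<inter> T. \<exists>r>0. qball X d x r \<subseteq> S \<inter> T"
    proof
      fix x assume "x \<in> S \<inter> T"
      then obtain r s where "r > 0" "qball X d x r \<subseteq> S" "s > 0" "qball X d x s \<subseteq> T"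
        using S T by blast
      then show "\<exists>r>0. qball X d x r \<subseteq> S \<inter> T"
        by (intro exI[of _ "min r s"]) (auto simp: qball_def)
    qed
  next
    fix K :: "'a set set"
    assume K: "\<forall>S\<in>K. S \<subseteq> X \<and> (\<forall>x\<in>S. \<exists>r>0. qball X d x r \<subseteq> S)"
    then show "\<Union>K \<subseteq> X" by blast
    show "\<forall>x\<in>\<Union>K. \<exists>r>0. qball X d x r \<subseteq> \<Union>K"
    proof
      fix x assume "x \<in> \<Union>K"
      then obtain S where "S \<in> K" "x \<in> S" by blast
      then obtain r where "r > 0" "qball X d x r \<subseteq> S" using K by blast
      then show "\<exists>r>0. qball X d x r \<subseteq> \<Union>K" using \<open>S \<in> K\<close> by blast
    qed
  qed
  then show ?thesis by (simp add: qtopology_def topology_inverse')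
qed

definition regular_measure :: "'a topology \<Rightarrow> 'a measure \<Rightarrow> bool" where
  "regular_measure T M \<longleftrightarrow> (\<forall>A \<in> sets M.
     emeasure M A = (INF U \<in> {U \<in> sets M. openin T U \<and> A \<subseteq> U}. emeasure M U) \<and>
     emeasure M A = (SUP K \<in> {K \<in> sets M. compactin T K \<and> K \<subseteq> A}. emeasure M K))"

text \<open>The underlying set is \<^term>\<open>space M\<close>. Quasi-metric balls need not be open, which is
  why the \<open>\<sigma>\<close>-algebra is generated by balls and open sets together.\<close>

locale homogeneous_type =
  fixes M :: "'a measure" and d :: "'a \<Rightarrow> 'a \<Rightarrow> real"
  assumes nonempty: "space M \<noteq> {}"
    and nonneg: "\<And>x y. x \<in> space M \<Longrightarrow> y \<in> space M \<Longrightarrow> 0 \<le> d x y"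
    and refl: "\<And>x. x \<in> space M \<Longrightarrow> d x x = 0"
    and sym: "\<And>x y. x \<in> space M \<Longrightarrow> y \<in> space M \<Longrightarrow> d x y = d y x"
    and quasi_triangle: "\<exists>A0\<ge>1. \<forall>x\<in>space M. \<forall>y\<in>space M. \<forall>z\<in>space M.
      d x y \<le> A0 * (d x z + d z y)"
    and sets_eq: "sets M =
      sigma_sets (space M) ({U. openin (qtopology (space M) d) U} \<union> qballs (space M) d)"
    and regular: "regular_measure (qtopology (space M) d) M"
    and doubling: "\<exists>C::real. \<forall>x\<in>space M. \<forall>r>0.
      0 < emeasure M (qball (space M) d x (2 * r)) \<and>
      emeasure M (qball (space M) d x (2 * r)) \<le> ennreal C * emeasure M (qball (space M) d x r) \<and>
      ennreal C * emeasure M (qball (space M) d x r) < \<infinity>"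

section \<open>Variable exponents\<close>

definition exp_minus :: "'a measure \<Rightarrow> ('a \<Rightarrow> real) \<Rightarrow> ereal" where
  "exp_minus M p = - esssup M (\<lambda>x. - ereal (p x))"

definition exp_plus :: "'a measure \<Rightarrow> ('a \<Rightarrow> real) \<Rightarrow> ereal" where
  "exp_plus M p = esssup M (\<lambda>x. ereal (p x))"

definition exponents :: "'a measure \<Rightarrow> ('a \<Rightarrow> real) set" where
  "exponents M = {p \<in> borel_measurable M. (\<forall>x\<in>space M. 1 \<le> p x) \<and>
     1 < exp_minus M p \<and> exp_minus M p \<le> exp_plus M p \<and> exp_plus M p < \<infinity>}"

definition exponents0 :: "'a measure \<Rightarrow> ('a \<Rightarrow> real) set" where
  "exponents0 M = {p \<in> borel_measurable M. (\<forall>x\<in>space M. 0 < p x) \<and>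
     0 < exp_minus M p \<and> exp_minus M p \<le> exp_plus M p \<and> exp_plus M p < \<infinity>}"

definition conj_exp :: "('a \<Rightarrow> real) \<Rightarrow> 'a \<Rightarrow> real" where
  "conj_exp p x = p x / (p x - 1)"

text \<open>At \<open>d x y = 0\<close> the modulus \<open>C / log (e + 1 / d x y)\<close> is read as \<open>C / \<infinity> = 0\<close>; HOL's
  \<open>1 / 0 = 0\<close> would give \<open>C\<close> instead.\<close>

definition LH :: "'a set \<Rightarrow> ('a \<Rightarrow> 'a \<Rightarrow> real) \<Rightarrow> 'a \<Rightarrow> ('a \<Rightarrow> real) set" where
  "LH X d x0 = {p. \<exists>C p_inf :: real.
     (\<forall>x\<in>X. \<forall>y\<in>X. d x y < 1 / 2 \<longrightarrow>
        \<bar>p x - p y\<bar> \<le> (if d x y = 0 then 0 else C / ln (exp 1 + 1 / d x y))) \<and>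
     (\<forall>x\<in>X. \<bar>p x - p_inf\<bar> \<le> C / ln (exp 1 + d x x0))}"

section \<open>Norms\<close>

definition ennpowr :: "ennreal \<Rightarrow> real \<Rightarrow> ennreal" where
  "ennpowr u a = (if u = \<infinity> then \<infinity> else ennreal (enn2real u powr a))"

text \<open>The norms depend on a function only through its modulus, so they are defined for
  \<open>[0,\<infinity>]\<close>-valued functions. All exponents occurring below are positive almost everywhere.\<close>

definition Lp_norm :: "'a measure \<Rightarrow> ('a \<Rightarrow> real) \<Rightarrow> ('a \<Rightarrow> ennreal) \<Rightarrow> ennreal" where
  "Lp_norm M p f =
     Inf {ennreal l | l. 0 < l \<and> (\<integral>\<^sup>+x. ennpowr (f x / ennreal l) (p x) \<partial>M) \<le> 1}"

definition Lp_wnorm ::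
  "'a measure \<Rightarrow> ('a \<Rightarrow> real) \<Rightarrow> ('a \<Rightarrow> ennreal) \<Rightarrow> ('a \<Rightarrow> ennreal) \<Rightarrow> ennreal" where
  "Lp_wnorm M p w f = Lp_norm M p (\<lambda>x. w x * f x)"

definition WL_wnorm ::
  "'a measure \<Rightarrow> ('a \<Rightarrow> real) \<Rightarrow> ('a \<Rightarrow> ennreal) \<Rightarrow> ('a \<Rightarrow> ennreal) \<Rightarrow> ennreal" where
  "WL_wnorm M q w f =
     (SUP t \<in> {0::real<..}. Lp_norm M q
        (\<lambda>x. ennreal t * w x * indicator {y \<in> space M. ennreal t < f y} x))"

definition Lp_space ::
  "'a measure \<Rightarrow> ('a \<Rightarrow> real) \<Rightarrow> ('a \<Rightarrow> ennreal) \<Rightarrow> ('a \<Rightarrow> real) set" where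
  "Lp_space M p w = {f \<in> borel_measurable M. Lp_wnorm M p w (\<lambda>x. ennreal \<bar>f x\<bar>) < \<infinity>}"

section \<open>Weights\<close>

text \<open>Locally integrable means integrable on every ball.\<close>

definition weight :: "'a measure \<Rightarrow> ('a \<Rightarrow> 'a \<Rightarrow> real) \<Rightarrow> ('a \<Rightarrow> ennreal) \<Rightarrow> bool" where
  "weight M d w \<longleftrightarrow> w \<in> borel_measurable M \<and>
     (\<forall>B \<in> qballs (space M) d. (\<integral>\<^sup>+x\<in>B. w x \<partial>M) < \<infinity>) \<and>
     (AE x in M. 0 < w x \<and> w x < \<infinity>)"

definition multiple_weight ::
  "'a measure \<Rightarrow> ('a \<Rightarrow> 'a \<Rightarrow> real) \<Rightarrow> nat \<Rightarrow> (nat \<Rightarrow> 'a \<Rightarrow> ennreal) \<Rightarrow> ('a \<Rightarrow> ennreal) \<Rightarrow> bool"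
  where "multiple_weight M d m W w \<longleftrightarrow> (\<forall>i\<in>{1..m}. weight M d (W i)) \<and> weight M d w"

definition A_const ::
  "'a measure \<Rightarrow> ('a \<Rightarrow> 'a \<Rightarrow> real) \<Rightarrow> nat \<Rightarrow> real \<Rightarrow> (nat \<Rightarrow> 'a \<Rightarrow> real) \<Rightarrow> ('a \<Rightarrow> real) \<Rightarrow>
   (nat \<Rightarrow> 'a \<Rightarrow> ennreal) \<Rightarrow> ('a \<Rightarrow> ennreal) \<Rightarrow> ennreal" where
  "A_const M d m \<eta> P q W w =
     (SUP B \<in> qballs (space M) d.
        ennreal (measure M B powr (\<eta> - real m)) *
        Lp_norm M q (\<lambda>x. w x * indicator B x) *
        (\<Prod>i=1..m. Lp_norm M (conj_exp (P i)) (\<lambda>x. inverse (W i x) * indicator B x)))"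

definition A_class ::
  "'a measure \<Rightarrow> ('a \<Rightarrow> 'a \<Rightarrow> real) \<Rightarrow> nat \<Rightarrow> real \<Rightarrow> (nat \<Rightarrow> 'a \<Rightarrow> real) \<Rightarrow> ('a \<Rightarrow> real) \<Rightarrow>
   (nat \<Rightarrow> 'a \<Rightarrow> ennreal) \<Rightarrow> ('a \<Rightarrow> ennreal) \<Rightarrow> bool" where
  "A_class M d m \<eta> P q W w \<longleftrightarrow> A_const M d m \<eta> P q W w < \<infinity>"

section \<open>The multilinear fractional maximal operator\<close>

definition frac_max ::
  "'a measure \<Rightarrow> ('a \<Rightarrow> 'a \<Rightarrow> real) \<Rightarrow> nat \<Rightarrow> real \<Rightarrow> (nat \<Rightarrow> 'a \<Rightarrow> real) \<Rightarrow> 'a \<Rightarrow> ennreal" where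
  "frac_max M d m \<eta> f x =
     (SUP B \<in> qballs (space M) d.
        ennreal (measure M B powr \<eta>) *
        (\<Prod>i=1..m. (\<integral>\<^sup>+y\<in>B. ennreal \<bar>f i y\<bar> \<partial>M) / emeasure M B) * indicator B x)"

text \<open>Balls need not be open, so a union of balls, and hence a level set of the maximal function,
  need not be measurable; for such a set the integral in the weak norm is the lower integral, as
  \<^const>\<open>nn_integral\<close> is a supremum over simple minorants.\<close>

definition weak_type_bound ::
  "'a measure \<Rightarrow> ('a \<Rightarrow> 'a \<Rightarrow> real) \<Rightarrow> nat \<Rightarrow> real \<Rightarrow> (nat \<Rightarrow> 'a \<Rightarrow> real) \<Rightarrow> ('a \<Rightarrow> real) \<Rightarrow>
   (nat \<Rightarrow> 'a \<Rightarrow> ennreal) \<Rightarrow> ('a \<Rightarrow> ennreal) \<Rightarrow> ennreal \<Rightarrow> bool" where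
  "weak_type_bound M d m \<eta> P q W w C \<longleftrightarrow>
     (\<forall>f. (\<forall>i\<in>{1..m}. f i \<in> Lp_space M (P i) (W i)) \<longrightarrow>
        WL_wnorm M q w (frac_max M d m \<eta> f) \<le>
          C * (\<Prod>i=1..m. Lp_wnorm M (P i) (W i) (\<lambda>x. ennreal \<bar>f i x\<bar>)))"

definition weak_type_bounded ::
  "'a measure \<Rightarrow> ('a \<Rightarrow> 'a \<Rightarrow> real) \<Rightarrow> nat \<Rightarrow> real \<Rightarrow> (nat \<Rightarrow> 'a \<Rightarrow> real) \<Rightarrow> ('a \<Rightarrow> real) \<Rightarrow>
   (nat \<Rightarrow> 'a \<Rightarrow> ennreal) \<Rightarrow> ('a \<Rightarrow> ennreal) \<Rightarrow> bool" where
  "weak_type_bounded M d m \<eta> P q W w \<longleftrightarrow>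
     (\<exists>C::real. 0 \<le> C \<and> weak_type_bound M d m \<eta> P q W w (ennreal C))"

definition weak_op_norm ::
  "'a measure \<Rightarrow> ('a \<Rightarrow> 'a \<Rightarrow> real) \<Rightarrow> nat \<Rightarrow> real \<Rightarrow> (nat \<Rightarrow> 'a \<Rightarrow> real) \<Rightarrow> ('a \<Rightarrow> real) \<Rightarrow>
   (nat \<Rightarrow> 'a \<Rightarrow> ennreal) \<Rightarrow> ('a \<Rightarrow> ennreal) \<Rightarrow> ennreal" where
  "weak_op_norm M d m \<eta> P q W w = Inf {C. weak_type_bound M d m \<eta> P q W w C}"

end

theory Submission
  imports Defs
begin

text \<open>
  Both directions compare a single ball with the weight condition; the constant in the lower bound for the
  operator norm is one.

  \<^bold>\<open>Necessity.\<close> Fix a ball \<open>B\<close> and numbers \<open>N i\<close> below the norms of \<open>1 / W i\<close> on \<open>B\<close> in the conjugate spaces. By duality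
  there are functions \<open>f i\<close> of weighted norm at most one whose integrals over \<open>B\<close> are at least \<open>N i\<close>
  (\<open>dual_extremizer\<close>). On \<open>B\<close> their maximal function is at least \<open>\<mu>(B)\<^sup>\<eta>\<^sup>-\<^sup>m \<Prod> N i\<close>, and the weak-type inequality turns
  this into a bound for the product that defines the weight constant (\<open>A_const_le_weak_bound\<close>).

  \<^bold>\<open>Sufficiency.\<close> Normalize the functions so that the modulars of \<open>W i * F i\<close> are at most one, and let \<open>B\<close> be a ball on which
  the product of averages exceeds \<open>t\<close>. Let \<open>a i \<le> 1\<close> bound the modular of \<open>W i * F i\<close> on \<open>B\<close>, and \<open>b i\<close> the exponent. The
  Hoelder inequality and the weight condition on a dilate of \<open>B\<close> show that \<open>t w / (K \<Lambda>)\<close> with \<open>\<Lambda> = \<Prod> (a i)\<^sup>1\<^sup>/\<^sup>b\<^sup>i\<close> has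
  modular at most one on the dilate (\<open>modular_on_dilated_ball\<close>). For constant exponents the proof is then complete up to
  a Vitali covering: \<open>\<Sum> q / P i = 1 + \<eta> q \<ge> 1\<close> gives \<open>\<Lambda>\<^sup>q \<le> \<Sum> a i\<close>, and the modulars on disjoint balls add up to at
  most one each.

  For variable exponents the powers of \<open>a i\<close> are perturbed by the oscillation \<open>\<delta>\<close> of the exponents on the dilate, which
  costs powers \<open>(a i)\<^sup>-\<^sup>c\<^sup>\<delta>\<close>. Log-Hoelder continuity gives \<open>\<delta> \<le> C / ln (1 / \<rho>)\<close> with \<open>\<rho>\<close> the minimum of the radius and
  \<open>1 / (e + d x x0)\<close>, provided that the ball is far from \<open>x0\<close> compared with its radius. Hence the cost is bounded once \<open>a i\<close>
  is replaced by its maximum with \<open>\<rho>\<^sup>N\<close>, and for large \<open>N\<close> the powers \<open>\<rho>\<^sup>N\<close> are summable over disjoint balls, being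
  dominated by integrals of one integrable function (\<open>modular_on_far_ball\<close>). The remaining balls are near \<open>x0\<close>, and if
  the radii are bounded they all lie in a dilate of just one of them, so that no summation is needed
  (\<open>modular_on_union_of_hulls\<close>).

  Level sets of the maximal function need not be measurable, and inner measure is not continuous along
  increasing unions of such sets. So every ball is first enlarged to an open set that is still contained in a dilate
  (\<open>open_hull\<close>); unions of these sets are measurable, and monotone convergence removes the bound on the radii.
\<close>

section \<open>Modulars and norms with variable exponent\<close>

lemma ennpowr_ennreal: "0 \<le> r \<Longrightarrow> ennpowr (ennreal r) a = ennreal (r powr a)"
  by (simp add: ennpowr_def)

lemma ennpowr_mono: "0 \<le> a \<Longrightarrow> u \<le> v \<Longrightarrow> ennpowr u a \<le> ennpowr v a"
  by (auto simp: ennpowr_def top_unique less_top[symmetric]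
      intro!: ennreal_leI powr_mono2 enn2real_mono)

lemma ennpowr_zero [simp]: "ennpowr 0 a = 0"
  by (simp add: ennpowr_def)

lemma ennpowr_mult_real:
  assumes "0 < c"
  shows "ennpowr (ennreal c * u) a = ennreal (c powr a) * ennpowr u a"
  using assms
  by (cases u) (auto simp: ennpowr_def ennreal_mult_top powr_mult
      ennreal_mult_eq_top_iff enn2real_mult ennreal_mult)

lemma measurable_ennpowr [measurable (raw)]:
  assumes [measurable]: "f \<in> borel_measurable M" "p \<in> borel_measurable M"
  shows "(\<lambda>x. ennpowr (f x) (p x)) \<in> borel_measurable M"
  unfolding ennpowr_def by measurable

lemma Lp_norm_le:
  assumes "0 < l" "(\<integral>\<^sup>+x. ennpowr (f x / ennreal l) (p x) \<partial>M) \<le> 1"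
  shows "Lp_norm M p f \<le> ennreal l"
  unfolding Lp_norm_def using assms by (intro Inf_lower) auto

lemma ennreal_divide_le_mono: "a \<le> b \<Longrightarrow> 0 < l \<Longrightarrow> l \<le> l' \<Longrightarrow> a / ennreal l' \<le> b / ennreal l"
  unfolding divide_ennreal_def
  by (intro mult_mono) (auto simp: inverse_ennreal intro!: ennreal_leI)

text \<open>The norm is an infimum over levels and the modular, also as a lower integral, decreases in the level.\<close>

lemma modular_le_1:
  assumes "AE x in M. 0 \<le> p x" "0 < l" "Lp_norm M p f < ennreal l"
  shows "(\<integral>\<^sup>+x. ennpowr (f x / ennreal l) (p x) \<partial>M) \<le> 1"
proof -
  obtain l' where l': "0 < l'" "(\<integral>\<^sup>+x. ennpowr (f x / ennreal l') (p x) \<partial>M) \<le> 1"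
    "ennreal l' < ennreal l"
    using assms(3) unfolding Lp_norm_def Inf_less_iff by auto
  then have "l' \<le> l" using ennreal_less_iff[of l' l] by simp
  have "(\<integral>\<^sup>+x. ennpowr (f x / ennreal l) (p x) \<partial>M)
      \<le> (\<integral>\<^sup>+x. ennpowr (f x / ennreal l') (p x) \<partial>M)"
    using assms(1)
    by (intro nn_integral_mono_AE, eventually_elim)
      (use l' \<open>l' \<le> l\<close> in \<open>auto intro!: ennpowr_mono ennreal_divide_le_mono\<close>)
  with l'(2) show ?thesis by order
qed

lemma Lp_norm_mono:
  assumes "AE x in M. 0 \<le> p x" "AE x in M. f x \<le> g x"
  shows "Lp_norm M p f \<le> Lp_norm M p g"
  unfolding Lp_norm_def
proof (rule Inf_superset_mono, safe)
  fix l :: real assume l: "0 < l" "(\<integral>\<^sup>+x. ennpowr (g x / ennreal l) (p x) \<partial>M) \<le> 1"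
  have "(\<integral>\<^sup>+x. ennpowr (f x / ennreal l) (p x) \<partial>M) \<le> (\<integral>\<^sup>+x. ennpowr (g x / ennreal l) (p x) \<partial>M)"
    using assms
    by (intro nn_integral_mono_AE, eventually_elim)
      (use l in \<open>auto intro!: ennpowr_mono ennreal_divide_le_mono\<close>)
  with l show "\<exists>l'. ennreal l = ennreal l' \<and> 0 < l' \<and>
      (\<integral>\<^sup>+x. ennpowr (f x / ennreal l') (p x) \<partial>M) \<le> 1"
    by (intro exI[of _ l]) auto
qed

text \<open>One half of homogeneity, by rescaling the admissible levels.\<close>

lemma Lp_norm_cmult_le:
  assumes "0 < c"
  shows "ennreal c * Lp_norm M p f \<le> Lp_norm M p (\<lambda>x. ennreal c * f x)"
  unfolding Lp_norm_def[of _ _ "\<lambda>x. ennreal c * f x"]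
proof (rule Inf_greatest, safe)
  fix l :: real
  assume l: "0 < l" "(\<integral>\<^sup>+x. ennpowr (ennreal c * f x / ennreal l) (p x) \<partial>M) \<le> 1"
  have "ennreal c * f x / ennreal l = f x / ennreal (l / c)" for x
  proof -
    have "ennreal c * f x / ennreal l = f x * (ennreal c * ennreal (inverse l))"
      using l(1) by (simp add: divide_ennreal_def inverse_ennreal ac_simps)
    also have "ennreal c * ennreal (inverse l) = inverse (ennreal (l / c))"
      using assms l(1) by (simp add: inverse_ennreal divide_inverse flip: ennreal_mult)
    finally show ?thesis by (simp add: divide_ennreal_def)
  qed
  with l assms have "Lp_norm M p f \<le> ennreal (l / c)"
    by (intro Lp_norm_le) auto
  then have "ennreal c * Lp_norm M p f \<le> ennreal c * ennreal (l / c)"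
    by (rule mult_left_mono) simp
  also have "\<dots> = ennreal l" using assms l by (simp flip: ennreal_mult)
  finally show "ennreal c * Lp_norm M p f \<le> ennreal l" .
qed

text \<open>If the norm vanished, all multiples \<open>k f\<close> would have modular at most one; on \<open>A\<close> these multiples increase
  to \<open>\<infinity>\<close>, against monotone convergence.\<close>

lemma Lp_norm_pos:
  assumes [measurable]: "f \<in> borel_measurable M" "p \<in> borel_measurable M" "A \<in> sets M"
    and p: "AE x in M. 0 < p x"
    and A: "emeasure M A > 0" "AE x in M. x \<in> A \<longrightarrow> 0 < f x"
  shows "0 < Lp_norm M p f"
proof (rule ccontr)
  assume "\<not> 0 < Lp_norm M p f"
  then have zero: "Lp_norm M p f = 0" by (simp add: not_gr_zero)
  let ?g = "\<lambda>k x. ennpowr (ennreal (Suc k) * f x) (max 0 (p x))"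
  have eq: "f x / ennreal (1 / Suc k) = ennreal (Suc k) * f x" for x k
    by (simp add: divide_ennreal_def inverse_ennreal mult.commute)
  have le: "(\<integral>\<^sup>+x. ?g k x \<partial>M) \<le> 1" for k
  proof -
    have "(\<integral>\<^sup>+x. ?g k x \<partial>M) = (\<integral>\<^sup>+x. ennpowr (ennreal (Suc k) * f x) (p x) \<partial>M)"
      by (rule nn_integral_cong_AE) (use p in eventually_elim, simp add: max_def)
    also have "\<dots> \<le> 1"
    proof -
      have "AE x in M. 0 \<le> p x" using p by eventually_elim simp
      from modular_le_1[OF this, of "1 / Suc k" f] show ?thesis
        using zero unfolding eq by simp
    qed
    finally show ?thesis .
  qed
  have inc: "incseq ?g"
    by (intro incseq_SucI le_funI ennpowr_mono mult_right_mono ennreal_leI) auto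
  have "(\<integral>\<^sup>+x. (SUP k. ?g k x) \<partial>M) = (SUP k. \<integral>\<^sup>+x. ?g k x \<partial>M)"
    by (rule nn_integral_monotone_convergence_SUP[OF inc]) measurable
  also have "\<dots> \<le> 1" using le by (intro SUP_least) auto
  finally have SUP_le: "(\<integral>\<^sup>+x. (SUP k. ?g k x) \<partial>M) \<le> 1" .
  have top: "(SUP k. ?g k x) = top" if "0 < p x" "0 < f x" for x
  proof (cases "f x")
    case (real r)
    with that have r: "0 < r" by simp
    show ?thesis
    proof (rule ennreal_SUP_eq_top)
      fix n :: nat
      obtain k :: nat where k: "real n powr (1 / p x) / r \<le> real k"
        using real_arch_simple by blast
      have "real n = (real n powr (1 / p x)) powr p x"
        using that(1) by (simp add: powr_powr)
      also have "\<dots> \<le> (real (Suc k) * r) powr p x"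
        using k r that(1) by (intro powr_mono2) (auto simp: field_simps)
      finally have "of_nat n \<le> ennreal ((real (Suc k) * r) powr p x)"
        by (simp add: ennreal_leI flip: ennreal_of_nat_eq_real_of_nat)
      also have "\<dots> = ?g k x"
        using real r that(1) by (simp add: ennpowr_ennreal max_def del: of_nat_Suc flip: ennreal_mult)
      finally show "\<exists>i\<in>UNIV. of_nat n \<le> ?g i x" by blast
    qed
  next
    case top
    then show ?thesis by (auto simp: ennpowr_def ennreal_mult_top)
  qed
  have "\<infinity> * emeasure M A = (\<integral>\<^sup>+x. \<infinity> * indicator A x \<partial>M)"
    by (simp add: nn_integral_cmult_indicator)
  also have "\<dots> \<le> (\<integral>\<^sup>+x. (SUP k. ?g k x) \<partial>M)"
  proof (rule nn_integral_mono_AE)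
    show "AE x in M. \<infinity> * indicator A x \<le> (SUP k. ?g k x)"
      using p A(2)
    proof eventually_elim
      case (elim x)
      then show ?case by (cases "x \<in> A") (simp_all only: top, simp_all)
    qed
  qed
  finally have "\<infinity> * emeasure M A \<le> 1" using SUP_le by order
  with A(1) show False by (auto simp: ennreal_top_mult top_unique split: if_splits)
qed

text \<open>The inequality of Young with the weights \<open>1/p\<close> and \<open>1/p'\<close> bounded by one, integrated.\<close>

lemma Hoelder_modular:
  assumes [measurable]: "f \<in> borel_measurable M" "g \<in> borel_measurable M" "p \<in> borel_measurable M"
    and p: "AE x in M. 1 < p x"
    and f: "(\<integral>\<^sup>+x. ennpowr (f x) (p x) \<partial>M) \<le> 1"
    and g: "(\<integral>\<^sup>+x. ennpowr (g x) (conj_exp p x) \<partial>M) \<le> 1"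
  shows "(\<integral>\<^sup>+x. f x * g x \<partial>M) \<le> 2"
proof -
  have Young: "f x * g x \<le> ennpowr (f x) (p x) + ennpowr (g x) (conj_exp p x)" if "1 < p x" for x
  proof (cases "f x = top \<or> g x = top")
    case True
    then show ?thesis by (auto simp: ennpowr_def)
  next
    case False
    then obtain a b where ab: "f x = ennreal a" "g x = ennreal b" "0 \<le> a" "0 \<le> b"
      by (meson ennreal_cases)
    have q: "1 < conj_exp p x" "1 / p x + 1 / conj_exp p x = 1"
      using that by (auto simp: conj_exp_def field_simps)
    have "a * b \<le> a powr p x / p x + b powr conj_exp p x / conj_exp p x"
      using that q ab by (intro Youngs_inequality) auto
    also have "\<dots> \<le> a powr p x + b powr conj_exp p x"
      using that q by (intro add_mono mult_imp_div_pos_le) (auto simp: mult_le_cancel_left1)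
    finally show ?thesis using ab
      by (simp add: ennpowr_ennreal ennreal_leI flip: ennreal_mult ennreal_plus)
  qed
  have [measurable]: "conj_exp p \<in> borel_measurable M"
    unfolding conj_exp_def[abs_def] by measurable
  have "(\<integral>\<^sup>+x. f x * g x \<partial>M) \<le> (\<integral>\<^sup>+x. ennpowr (f x) (p x) + ennpowr (g x) (conj_exp p x) \<partial>M)"
    using p by (intro nn_integral_mono_AE, eventually_elim) (rule Young)
  also have "\<dots> = (\<integral>\<^sup>+x. ennpowr (f x) (p x) \<partial>M) + (\<integral>\<^sup>+x. ennpowr (g x) (conj_exp p x) \<partial>M)"
    by (rule nn_integral_add) measurable
  also have "\<dots> \<le> 1 + 1" using f g by (rule add_mono)
  finally show ?thesis by (simp add: one_add_one[symmetric] del: one_add_one)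
qed

text \<open>The norm in \<open>L\<^sup>p\<^sup>'\<close> is attained in the limit by duality: with \<open>u = (W\<^sup>-\<^sup>1/N)\<^sup>p\<^sup>'\<close> the function \<open>f = (W\<^sup>-\<^sup>1/N)\<^sup>p\<^sup>'\<^sup>-\<^sup>1 W\<^sup>-\<^sup>1\<close>
  satisfies \<open>(W f)\<^sup>p = u\<close> and \<open>f = N u\<close>. Let \<open>I\<close> be the integral of \<open>u\<close>, which exceeds one because \<open>N\<close> lies below
  the norm. Dividing \<open>f\<close> by \<open>I\<close> leaves a modular of at most \<open>I / I = 1\<close>, since \<open>I > 1\<close> and \<open>p \<ge> 1\<close>, and an
  integral of exactly \<open>N\<close>. The cut-off to a set where \<open>W\<close> is bounded below makes \<open>I\<close> finite.\<close>

lemma dual_extremizer: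
  assumes [measurable]: "W \<in> borel_measurable M" "p \<in> borel_measurable M" "B \<in> sets M"
    and fin: "emeasure M B < \<infinity>"
    and c: "1 < c" "AE x in M. c \<le> p x"
    and W: "AE x in M. 0 < W x \<and> W x < \<infinity>"
    and N: "0 < N" "ennreal N < Lp_norm M (conj_exp p) (\<lambda>x. inverse (W x) * indicator B x)"
  obtains f :: "'a \<Rightarrow> real" where "f \<in> borel_measurable M" "\<And>x. 0 \<le> f x"
    "(\<integral>\<^sup>+x. ennpowr (W x * ennreal (f x)) (p x) \<partial>M) \<le> 1"
    "ennreal N \<le> (\<integral>\<^sup>+x\<in>B. ennreal (f x) \<partial>M)"
proof -
  \<comment> \<open>The sets of the cut-off exhaust \<open>B\<close> up to a null set, so some \<open>A k\<close> still carries a modular above one.\<close>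
  define A where "A k = {x \<in> space M. x \<in> B \<and> ennreal (1 / Suc k) \<le> W x \<and> W x < \<infinity> \<and> c \<le> p x}" for k :: nat
  have [measurable]: "A k \<in> sets M" for k unfolding A_def by measurable
  have [measurable]: "conj_exp p \<in> borel_measurable M"
    unfolding conj_exp_def[abs_def] by measurable
  define v where "v x = enn2real (W x)" for x
  have [measurable]: "v \<in> borel_measurable M" unfolding v_def by measurable
  define u where "u x = ennpowr (inverse (W x) * indicator B x / ennreal N) (conj_exp p x)" for x
  have [measurable]: "u \<in> borel_measurable M" unfolding u_def by measurable
  have vA: "W x = ennreal (v x)" "1 / Suc k \<le> v x" "0 < v x" "x \<in> B" "c \<le> p x" if "x \<in> A k" for x k
  proof -
    show "x \<in> B" "c \<le> p x" using that by (auto simp: A_def)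
    show *: "W x = ennreal (v x)" using that by (auto simp: A_def v_def)
    have "ennreal (1 / Suc k) \<le> ennreal (v x)" using that * by (auto simp: A_def)
    then show **: "1 / Suc k \<le> v x"
      by (subst (asm) ennreal_le_iff) (simp_all add: v_def)
    have "0 < 1 / real (Suc k)" by simp
    also note **
    finally show "0 < v x" .
  qed
  have uA: "u x = ennreal ((1 / (v x * N)) powr conj_exp p x)" if "x \<in> A k" for x k
    using vA[OF that] N(1)
    by (simp add: u_def inverse_ennreal divide_ennreal ennpowr_ennreal field_simps)
  have "\<not> (\<integral>\<^sup>+x. u x \<partial>M) \<le> 1"
    using Lp_norm_le[of N M "\<lambda>x. inverse (W x) * indicator B x" "conj_exp p"] N
    unfolding u_def by (auto simp: not_less[symmetric])
  moreover have "(\<integral>\<^sup>+x. u x \<partial>M) \<le> (\<integral>\<^sup>+x. (SUP k. u x * indicator (A k) x) \<partial>M)"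
  proof (rule nn_integral_mono_AE)
    show "AE x in M. u x \<le> (SUP k. u x * indicator (A k) x)"
      using W c(2) AE_space
    proof eventually_elim
      case (elim x)
      show ?case
      proof (cases "x \<in> B")
        case False
        then show ?thesis by (simp add: u_def)
      next
        case True
        obtain k :: nat where k: "1 / v x \<le> real k" using real_arch_simple by blast
        have v: "0 < v x" "W x = ennreal (v x)" using elim by (auto simp: v_def enn2real_positive_iff)
        have "1 / Suc k \<le> v x" using k v by (simp add: field_simps)
        then have "x \<in> A k" using elim True v by (auto simp: A_def intro!: ennreal_leI)
        then show ?thesis by (intro SUP_upper2[of k]) auto
      qed
    qed
  qed
  moreover have "(\<integral>\<^sup>+x. (SUP k. u x * indicator (A k) x) \<partial>M) = (SUP k. \<integral>\<^sup>+x\<in>A k. u x \<partial>M)"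
  proof (rule nn_integral_monotone_convergence_SUP)
    have "A k \<subseteq> A (Suc k)" for k
    proof -
      have "ennreal (1 / Suc (Suc k)) \<le> ennreal (1 / Suc k)"
        by (intro ennreal_leI) (simp add: frac_le)
      then show ?thesis unfolding A_def by (blast intro: order_trans)
    qed
    then show "incseq (\<lambda>k x. u x * indicator (A k) x)"
      by (intro incseq_SucI le_funI mult_left_mono) (auto split: split_indicator)
  qed measurable
  ultimately have "1 < (SUP k. \<integral>\<^sup>+x\<in>A k. u x \<partial>M)" by (simp add: not_le)
  then obtain k where k: "1 < (\<integral>\<^sup>+x\<in>A k. u x \<partial>M)" by (auto simp: less_SUP_iff)
  define I where "I = enn2real (\<integral>\<^sup>+x\<in>A k. u x \<partial>M)"
  have "(\<integral>\<^sup>+x\<in>A k. u x \<partial>M) < \<infinity>"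
  proof -
    \<comment> \<open>On \<open>A k\<close> the base is at most \<open>(k + 1) / N\<close> and the exponent \<open>p'\<close> at most \<open>c / (c - 1)\<close>.\<close>
    let ?b = "max 1 (Suc k / N)" and ?s = "c / (c - 1)"
    have "(\<integral>\<^sup>+x\<in>A k. u x \<partial>M) \<le> (\<integral>\<^sup>+x. ennreal (?b powr ?s) * indicator B x \<partial>M)"
    proof (rule nn_integral_mono)
      fix x
      show "u x * indicator (A k) x \<le> ennreal (?b powr ?s) * indicator B x"
      proof (cases "x \<in> A k")
        case True
        note v = vA[OF True]
        have "conj_exp p x \<le> ?s" "0 \<le> conj_exp p x"
          using v(5) c(1) by (auto simp: conj_exp_def field_simps)
        moreover have "1 / (v x * N) \<le> ?b"
          using v(2,3) N(1) by (intro max.coboundedI2) (simp add: field_simps)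
        ultimately have "(1 / (v x * N)) powr conj_exp p x \<le> ?b powr ?s"
          using v N by (intro order_trans[OF powr_mono2 powr_mono]) auto
        then show ?thesis using uA[OF True] True v by (simp add: ennreal_leI)
      qed auto
    qed
    also have "\<dots> = ennreal (?b powr ?s) * emeasure M B" by (simp add: nn_integral_cmult_indicator)
    also have "\<dots> < \<infinity>" using fin by (simp add: ennreal_mult_less_top)
    finally show ?thesis .
  qed
  then have I: "(\<integral>\<^sup>+x\<in>A k. u x \<partial>M) = ennreal I" by (auto simp: I_def)
  with k have I1: "1 < I" by (metis ennreal_1 ennreal_less_iff zero_le_one)
  define f where "f x = (if x \<in> A k then (1 / (v x * N)) powr (conj_exp p x - 1) / v x / I else 0)" for x
  have f_meas: "f \<in> borel_measurable M" unfolding f_def by measurable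
  have f_nn: "0 \<le> f x" for x unfolding f_def using I1 by (simp add: v_def)
  have "(\<integral>\<^sup>+x. ennpowr (W x * ennreal (f x)) (p x) \<partial>M) \<le> (\<integral>\<^sup>+x. ennreal (1 / I) * (u x * indicator (A k) x) \<partial>M)"
  proof (rule nn_integral_mono)
    fix x
    show "ennpowr (W x * ennreal (f x)) (p x) \<le> ennreal (1 / I) * (u x * indicator (A k) x)"
    proof (cases "x \<in> A k")
      case True
      note v = vA[OF True]
      let ?z = "1 / (v x * N)"
      have px: "1 < p x" using v(5) c(1) by simp
      have "W x * ennreal (f x) = ennreal (?z powr (conj_exp p x - 1) / I)"
        using v True I1 by (simp add: f_def flip: ennreal_mult)
      then have "ennpowr (W x * ennreal (f x)) (p x) = ennreal ((?z powr (conj_exp p x - 1) / I) powr p x)"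
        using I1 by (simp add: ennpowr_ennreal)
      also have "(?z powr (conj_exp p x - 1) / I) powr p x = (1 / I) powr p x * ?z powr conj_exp p x"
      proof -
        have "(conj_exp p x - 1) * p x = conj_exp p x"
          using px by (simp add: conj_exp_def field_simps)
        moreover have "(z powr (conj_exp p x - 1) / I) powr p x
            = (1 / I) powr p x * z powr ((conj_exp p x - 1) * p x)" for z :: real
          using I1 by (simp add: powr_divide powr_powr)
        ultimately show ?thesis by metis
      qed
      also have "\<dots> \<le> (1 / I) powr 1 * ?z powr conj_exp p x"
        using I1 px by (intro mult_right_mono powr_mono') auto
      finally show ?thesis using I1 True uA[OF True] by (simp add: ennreal_leI flip: ennreal_mult)
    qed (simp add: f_def)
  qed
  also have "\<dots> = ennreal (1 / I) * ennreal I" by (subst nn_integral_cmult) (simp_all add: I)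
  also have "\<dots> = 1" using I1 by (simp flip: ennreal_mult)
  finally have mod: "(\<integral>\<^sup>+x. ennpowr (W x * ennreal (f x)) (p x) \<partial>M) \<le> 1" .
  have "ennreal N = ennreal (N / I) * ennreal I" using I1 N by (simp flip: ennreal_mult)
  also have "\<dots> = (\<integral>\<^sup>+x. ennreal (N / I) * (u x * indicator (A k) x) \<partial>M)"
    by (subst nn_integral_cmult) (simp_all add: I)
  also have "\<dots> \<le> (\<integral>\<^sup>+x\<in>B. ennreal (f x) \<partial>M)"
  proof (rule nn_integral_mono)
    fix x
    show "ennreal (N / I) * (u x * indicator (A k) x) \<le> ennreal (f x) * indicator B x"
    proof (cases "x \<in> A k")
      case True
      note v = vA[OF True]
      let ?z = "1 / (v x * N)"
      have "N / I * ?z powr conj_exp p x = N / I * (?z * ?z powr (conj_exp p x - 1))"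
        using v N powr_add[of ?z 1 "conj_exp p x - 1"] by simp
      also have "\<dots> = f x" using True v N I1 by (simp add: f_def field_simps)
      finally show ?thesis using True uA[OF True] v I1 N by (simp flip: ennreal_mult)
    qed simp
  qed
  finally show ?thesis using that f_meas f_nn mod by blast
qed

section \<open>Disjoint subfamilies\<close>

text \<open>The Vitali selection in abstract form. A maximal element among the disjoint subfamilies \<open>S\<close> for which every
  set that meets \<open>S\<close> meets a member of comparable size must meet all of \<open>F\<close>: otherwise a set of almost largest
  radius among those that miss \<open>S\<close> could be added.\<close>

lemma Vitali_selection:
  fixes rad :: "'i \<Rightarrow> real"
  assumes rad: "\<And>i. i \<in> F \<Longrightarrow> 0 < rad i \<and> rad i \<le> R"
    and self: "\<And>i. i \<in> F \<Longrightarrow> V i \<noteq> {}"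
  obtains S where "S \<subseteq> F" "disjoint_family_on V S"
    "\<And>i. i \<in> F \<Longrightarrow> \<exists>j\<in>S. V i \<inter> V j \<noteq> {} \<and> rad i \<le> 2 * rad j"
proof -
  define good where "good S \<longleftrightarrow> S \<subseteq> F \<and> disjoint_family_on V S \<and>
    (\<forall>i\<in>F. (\<exists>j\<in>S. V i \<inter> V j \<noteq> {}) \<longrightarrow> (\<exists>j\<in>S. V i \<inter> V j \<noteq> {} \<and> rad i \<le> 2 * rad j))" for S
  have "\<exists>S\<in>Collect good. \<forall>X\<in>Collect good. S \<subseteq> X \<longrightarrow> X = S"
  proof (rule subset_Zorn')
    fix C assume C: "subset.chain (Collect good) C"
    show "\<Union>C \<in> Collect good"
      unfolding mem_Collect_eq good_def
    proof (intro conjI ballI impI)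
      have "good S" if "S \<in> C" for S using C that by (auto simp: subset_chain_def)
      then show "\<Union>C \<subseteq> F" unfolding good_def by blast
      show "disjoint_family_on V (\<Union>C)"
        unfolding disjoint_family_on_def
      proof (intro ballI impI)
        fix i j assume ij: "i \<in> \<Union>C" "j \<in> \<Union>C" "i \<noteq> j"
        then obtain S T where ST: "S \<in> C" "T \<in> C" "i \<in> S" "j \<in> T" by blast
        then have "S \<subseteq> T \<or> T \<subseteq> S" "good S" "good T" using C by (auto simp: subset_chain_def)
        with ij ST show "V i \<inter> V j = {}"
          unfolding good_def disjoint_family_on_def by blast
      qed
      fix i assume i: "i \<in> F" "\<exists>j\<in>\<Union>C. V i \<inter> V j \<noteq> {}"
      then obtain S j where S: "S \<in> C" "j \<in> S" "V i \<inter> V j \<noteq> {}" by blast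
      then have "good S" using C by (auto simp: subset_chain_def)
      with S i show "\<exists>j\<in>\<Union>C. V i \<inter> V j \<noteq> {} \<and> rad i \<le> 2 * rad j"
        unfolding good_def by blast
    qed
  qed
  then obtain S where S: "good S" and max: "\<And>X. good X \<Longrightarrow> S \<subseteq> X \<Longrightarrow> X = S" by auto
  have "\<exists>j\<in>S. V i \<inter> V j \<noteq> {}" if i: "i \<in> F" for i
  proof (rule ccontr)
    assume no: "\<not> (\<exists>j\<in>S. V i \<inter> V j \<noteq> {})"
    define G where "G = {i \<in> F. \<forall>j\<in>S. V i \<inter> V j = {}}"
    have iG: "i \<in> G" using i no by (auto simp: G_def)
    have bdd: "bdd_above (rad ` G)" using rad by (auto simp: G_def intro!: bdd_aboveI2)
    have "0 < Sup (rad ` G)"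
      using cSup_upper[OF imageI[OF iG] bdd] rad[OF i] by linarith
    then have "Sup (rad ` G) / 2 < Sup (rad ` G)" by simp
    then obtain k where k: "k \<in> G" "Sup (rad ` G) / 2 < rad k"
      using less_cSup_iff[of "rad ` G"] iG bdd by blast
    have large: "rad l \<le> 2 * rad k" if "l \<in> G" for l
      using cSup_upper[OF imageI[OF that] bdd] k by linarith
    have "good (insert k S)"
      unfolding good_def
    proof (intro conjI ballI impI)
      show "insert k S \<subseteq> F" using S k by (auto simp: good_def G_def)
      show "disjoint_family_on V (insert k S)"
        using S k unfolding good_def G_def disjoint_family_on_def by blast
      fix l assume l: "l \<in> F" "\<exists>j\<in>insert k S. V l \<inter> V j \<noteq> {}"
      show "\<exists>j\<in>insert k S. V l \<inter> V j \<noteq> {} \<and> rad l \<le> 2 * rad j"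
      proof (cases "l \<in> G")
        case True
        then show ?thesis using l large[OF True] by (auto simp: G_def)
      next
        case False
        then show ?thesis using l S unfolding good_def G_def by blast
      qed
    qed
    then have "k \<in> S" using max[of "insert k S"] by blast
    moreover have "k \<in> F" "\<forall>j\<in>S. V k \<inter> V j = {}" using k by (auto simp: G_def)
    ultimately show False using self by blast
  qed
  with S show ?thesis by (intro that[of S]) (auto simp: good_def)
qed

text \<open>Only finitely many of the sets can have measure at least a given \<open>1 / (n + 1)\<close>.\<close>

lemma countable_disjoint_positive:
  assumes fin: "emeasure N (space N) < \<infinity>"
    and sets: "\<And>i. i \<in> S \<Longrightarrow> V i \<in> sets N" and disj: "disjoint_family_on V S"
    and pos: "\<And>i. i \<in> S \<Longrightarrow> 0 < emeasure N (V i)"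
  shows "countable S"
proof -
  define S' where "S' n = {i \<in> S. ennreal (1 / Suc n) \<le> emeasure N (V i)}" for n
  have "finite (S' n)" for n
  proof (rule conjunct1[OF finite_if_finite_subsets_card_bdd])
    fix T assume T: "T \<subseteq> S' n" "finite T"
    have "ennreal (card T * (1 / Suc n)) = (\<Sum>i\<in>T. ennreal (1 / Suc n))"
      by (simp add: ennreal_of_nat_eq_real_of_nat del: of_nat_Suc flip: ennreal_mult)
    also have "\<dots> \<le> (\<Sum>i\<in>T. emeasure N (V i))"
      using T by (intro sum_mono) (auto simp: S'_def)
    also have "\<dots> = emeasure N (\<Union>i\<in>T. V i)"
      using T sets disj
      by (intro sum_emeasure) (auto simp: S'_def disjoint_family_on_def subset_iff)
    also have "\<dots> \<le> emeasure N (space N)" by (rule emeasure_space)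
    also have "\<dots> = ennreal (enn2real (emeasure N (space N)))" using fin by simp
    finally have "card T * (1 / Suc n) \<le> enn2real (emeasure N (space N))"
      by (subst (asm) ennreal_le_iff) auto
    then have "card T \<le> enn2real (emeasure N (space N)) * Suc n" by (simp add: field_simps)
    then show "card T \<le> nat \<lceil>enn2real (emeasure N (space N)) * Suc n\<rceil>" by linarith
  qed
  moreover have "S = (\<Union>n. S' n)"
  proof (intro equalityI subsetI)
    fix i assume i: "i \<in> S"
    define e where "e = min 1 (emeasure N (V i))"
    have "0 < e" "e < \<infinity>" using pos[OF i] by (auto simp: e_def min_less_iff_disj)
    then obtain r where r: "e = ennreal r" "0 < r" by (cases e) auto
    obtain n :: nat where n: "1 / r \<le> real n" using real_arch_simple by blast
    then have "1 / Suc n \<le> r" using r by (simp add: field_simps)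
    then have "ennreal (1 / Suc n) \<le> e" unfolding r by (rule ennreal_leI)
    then have "ennreal (1 / Suc n) \<le> emeasure N (V i)" unfolding e_def by simp
    then show "i \<in> (\<Union>n. S' n)" using i by (auto simp: S'_def)
  qed (auto simp: S'_def)
  ultimately show ?thesis by (metis countable_UN countableI_type countable_finite)
qed

text \<open>Transfers a bound from disjoint sets \<open>V i\<close> to overlapping enlargements \<open>U i\<close>: subadditivity on the left,
  additivity on the right.\<close>

lemma emeasure_UN_le_disjoint:
  assumes S: "countable S"
    and V: "\<And>i. i \<in> S \<Longrightarrow> V i \<in> sets N'" "disjoint_family_on V S"
    and U: "\<And>i. i \<in> S \<Longrightarrow> U i \<in> sets N"
    and le: "\<And>i. i \<in> S \<Longrightarrow> emeasure N (U i) \<le> emeasure N' (V i)"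
  shows "emeasure N (\<Union>i\<in>S. U i) \<le> emeasure N' (space N')"
proof -
  have [measurable]: "(\<Union>i\<in>S. U i) \<in> sets N" using S U by (intro sets.countable_UN') auto
  have "emeasure N (\<Union>i\<in>S. U i) = (\<integral>\<^sup>+x. indicator (\<Union>i\<in>S. U i) x \<partial>N)" by simp
  also have "\<dots> \<le> (\<integral>\<^sup>+x. \<integral>\<^sup>+i. indicator (U i) x \<partial>count_space S \<partial>N)"
  proof (rule nn_integral_mono)
    fix x
    show "indicator (\<Union>i\<in>S. U i) x \<le> (\<integral>\<^sup>+i. indicator (U i) x \<partial>count_space S)"
    proof (cases "x \<in> (\<Union>i\<in>S. U i)")
      case True
      then obtain j where j: "j \<in> S" "x \<in> U j" by blast
      have "1 = (\<integral>\<^sup>+i. indicator {j} i \<partial>count_space S)" using j by simp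
      also have "\<dots> \<le> (\<integral>\<^sup>+i. indicator (U i) x \<partial>count_space S)"
        using j by (intro nn_integral_mono) (auto split: split_indicator)
      finally show ?thesis using True by simp
    qed simp
  qed
  also have "\<dots> = (\<integral>\<^sup>+i. \<integral>\<^sup>+x. indicator (U i) x \<partial>N \<partial>count_space S)"
    using S U by (intro nn_integral_count_space_nn_integral) auto
  also have "\<dots> = (\<integral>\<^sup>+i. emeasure N (U i) \<partial>count_space S)"
    using U by (intro nn_integral_cong) simp
  also have "\<dots> \<le> (\<integral>\<^sup>+i. emeasure N' (V i) \<partial>count_space S)"
    using le by (intro nn_integral_mono) simp
  also have "\<dots> = emeasure N' (\<Union>i\<in>S. V i)"
    using S V by (intro emeasure_UN_countable[symmetric]) auto
  also have "\<dots> \<le> emeasure N' (space N')" by (rule emeasure_space)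
  finally show ?thesis .
qed

section \<open>Geometry of spaces of homogeneous type\<close>

lemma power_of_two_between:
  fixes s :: real
  assumes "1 \<le> s"
  obtains k :: nat where "s \<le> 2 ^ k" "2 ^ k \<le> 2 * s"
proof -
  define k where "k = (LEAST k :: nat. s \<le> 2 ^ k)"
  have ex: "\<exists>k :: nat. s \<le> 2 ^ k" by (meson less_imp_le one_less_numeral_iff real_arch_pow semiring_norm(76))
  then have k: "s \<le> 2 ^ k" unfolding k_def by (rule LeastI_ex)
  have "2 ^ k \<le> 2 * s"
  proof (cases k)
    case 0
    with assms show ?thesis by simp
  next
    case (Suc j)
    then have "\<not> s \<le> 2 ^ j" unfolding k_def by (intro not_less_Least) simp
    with Suc show ?thesis by simp
  qed
  with k show ?thesis by (rule that)
qed

text \<open>A concave function that is nonnegative at zero decreases by at most the factor \<open>\<kappa>\<close> when \<open>s\<close> is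
  divided by \<open>\<kappa>\<close>. This is what makes log-Hoelder moduli insensitive to the constants of the geometry.\<close>

lemma ln_shrink:
  fixes s \<kappa> :: real
  assumes "0 \<le> s" "1 \<le> \<kappa>"
  shows "ln (exp 1 + s) \<le> \<kappa> * ln (exp 1 + s / \<kappa>)"
proof -
  have "ln (exp 1 + s) = 1 + ln (1 + s / exp 1)"
  proof -
    have "exp 1 + s = exp 1 * (1 + s / exp 1)" by (simp add: field_simps)
    moreover have "0 < 1 + s / exp 1" using assms by (simp add: add_pos_nonneg)
    ultimately show ?thesis by (simp add: ln_mult)
  qed
  also have "\<dots> \<le> 1 + \<kappa> * ln (1 + s / \<kappa> / exp 1)"
  proof -
    define u where "u = s / \<kappa> / exp 1"
    have u: "0 \<le> u" using assms by (simp add: u_def)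
    have "(1 + \<kappa> * u) powr (1 / \<kappa>) * 1 powr (1 - 1 / \<kappa>) \<le> 1 / \<kappa> * (1 + \<kappa> * u) + (1 - 1 / \<kappa>) * 1"
      using assms u by (intro Youngs_inequality_0) (auto simp: add_pos_nonneg)
    also have "\<dots> = 1 + u" using assms by (simp add: field_simps)
    finally have "(1 + \<kappa> * u) powr (1 / \<kappa>) \<le> 1 + u" by simp
    moreover have pos: "0 < 1 + \<kappa> * u" using assms u by (simp add: add_pos_nonneg)
    ultimately have "ln ((1 + \<kappa> * u) powr (1 / \<kappa>)) \<le> ln (1 + u)"
      using u by (subst ln_le_cancel_iff) auto
    then have "ln (1 + \<kappa> * u) \<le> \<kappa> * ln (1 + u)"
      using pos assms by (simp add: ln_powr field_simps)
    then show ?thesis using assms by (simp add: u_def)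
  qed
  also have "\<dots> \<le> \<kappa> * (1 + ln (1 + s / \<kappa> / exp 1))" using assms by (simp add: algebra_simps)
  also have "1 + ln (1 + s / \<kappa> / exp 1) = ln (exp 1 + s / \<kappa>)"
  proof -
    have "exp 1 + s / \<kappa> = exp 1 * (1 + s / \<kappa> / exp 1)" by (simp add: field_simps)
    moreover have "0 < 1 + s / \<kappa> / exp 1" using assms by (simp add: add_pos_nonneg)
    ultimately show ?thesis by (simp add: ln_mult)
  qed
  finally show ?thesis .
qed

lemma ln_exp1_ge_1: "0 \<le> (s::real) \<Longrightarrow> 1 \<le> ln (exp 1 + s)"
  by (simp add: ln_ge_iff add_pos_nonneg)

text \<open>Quasi-triangle constant and doubling exponent are named so that later constants can be written
  down; the power of two bounds the doubling constant.\<close>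

locale homogeneous_type_constants = homogeneous_type +
  fixes A :: real and D :: nat
  assumes A_ge_1: "1 \<le> A"
    and quasi: "\<And>x y z. x \<in> space M \<Longrightarrow> y \<in> space M \<Longrightarrow> z \<in> space M \<Longrightarrow> d x y \<le> A * (d x z + d z y)"
    and doub: "\<And>x r. x \<in> space M \<Longrightarrow> 0 < r \<Longrightarrow>
      measure M (qball (space M) d x (2 * r)) \<le> 2 ^ D * measure M (qball (space M) d x r)"
begin

abbreviation Q :: "'a \<Rightarrow> real \<Rightarrow> 'a set" where
  "Q x r \<equiv> qball (space M) d x r"

lemma Q_iff: "y \<in> Q x r \<longleftrightarrow> y \<in> space M \<and> d x y < r"
  by (simp add: qball_def)

lemma Q_subset_space: "Q x r \<subseteq> space M"
  by (auto simp: Q_iff)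

lemma Q_mono: "r \<le> s \<Longrightarrow> Q x r \<subseteq> Q x s"
  by (auto simp: Q_iff)

lemma centre_in_Q: "x \<in> space M \<Longrightarrow> 0 < r \<Longrightarrow> x \<in> Q x r"
  by (simp add: Q_iff refl)

lemma Q_sets [measurable]: "x \<in> space M \<Longrightarrow> 0 < r \<Longrightarrow> Q x r \<in> sets M"
  unfolding sets_eq by (intro sigma_sets.Basic) (auto simp: qballs_def)

lemma openin_sets: "openin (qtopology (space M) d) U \<Longrightarrow> U \<in> sets M"
  unfolding sets_eq by (intro sigma_sets.Basic) auto

lemma Q_pos: "x \<in> space M \<Longrightarrow> 0 < r \<Longrightarrow> 0 < emeasure M (Q x r)"
  using doubling by (elim exE ballE[of _ _ x] allE[of _ "r / 2"]) auto

lemma Q_finite: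
  assumes "x \<in> space M" "0 < r"
  shows "emeasure M (Q x r) < \<infinity>"
proof -
  obtain C :: real where C: "0 < emeasure M (Q x (2 * r))"
    "emeasure M (Q x (2 * r)) \<le> ennreal C * emeasure M (Q x r)"
    "ennreal C * emeasure M (Q x r) < \<infinity>"
    using doubling assms by blast
  then have "ennreal C \<noteq> 0" by auto
  with C(3) show ?thesis by (auto simp: ennreal_mult_less_top)
qed

lemma emeasure_Q: "x \<in> space M \<Longrightarrow> 0 < r \<Longrightarrow> emeasure M (Q x r) = ennreal (measure M (Q x r))"
  using Q_finite[of x r] by (simp add: emeasure_eq_ennreal_measure)

lemma measure_Q_pos: "x \<in> space M \<Longrightarrow> 0 < r \<Longrightarrow> 0 < measure M (Q x r)"
  using Q_pos[of x r] by (simp add: emeasure_Q)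

lemma measure_Q_mono:
  assumes "x \<in> space M" "0 < r" "y \<in> space M" "0 < s" "Q x r \<subseteq> Q y s"
  shows "measure M (Q x r) \<le> measure M (Q y s)"
  using emeasure_mono[OF assms(5), of M] assms by (simp add: emeasure_Q)

lemma measure_Q_dilate_pow:
  assumes x: "x \<in> space M" "0 < r"
  shows "measure M (Q x (2 ^ k * r)) \<le> (2 ^ k) ^ D * measure M (Q x r)"
proof (induction k)
  case (Suc k)
  have "measure M (Q x (2 ^ Suc k * r)) = measure M (Q x (2 * (2 ^ k * r)))" by (simp add: mult.assoc)
  also have "\<dots> \<le> 2 ^ D * measure M (Q x (2 ^ k * r))" using x by (intro doub) auto
  also have "\<dots> \<le> 2 ^ D * ((2 ^ k) ^ D * measure M (Q x r))" using Suc by (intro mult_left_mono) auto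
  also have "\<dots> = (2 ^ Suc k) ^ D * measure M (Q x r)" by (simp add: power_mult_distrib)
  finally show ?case .
qed simp

text \<open>An arbitrary dilation factor is rounded up to a power of two, at the cost of a factor two.\<close>

lemma measure_Q_dilate:
  assumes x: "x \<in> space M" "0 < r" and s: "1 \<le> s"
  shows "measure M (Q x (s * r)) \<le> (2 * s) ^ D * measure M (Q x r)"
proof -
  obtain k :: nat where k: "s \<le> 2 ^ k" "2 ^ k \<le> 2 * s" using power_of_two_between[OF s] .
  have "measure M (Q x (s * r)) \<le> measure M (Q x (2 ^ k * r))"
    using x s k by (intro measure_Q_mono Q_mono) (auto intro!: mult_right_mono)
  also have "\<dots> \<le> (2 ^ k) ^ D * measure M (Q x r)" by (rule measure_Q_dilate_pow[OF x])
  also have "\<dots> \<le> (2 * s) ^ D * measure M (Q x r)"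
    using k by (intro mult_right_mono power_mono) auto
  finally show ?thesis .
qed

subsection \<open>Open sets between a ball and its dilate\<close>

text \<open>Balls of a quasi-metric need not be open. Points reached from \<open>x\<close> by a chain of steps of lengths below
  \<open>r, r/(2A), r/(2A)\<^sup>2, \<dots>\<close> form an open set, because a chain may always be prolonged by one more step; and as the
  step lengths decrease faster than the quasi-triangle constant accumulates, the chains stay within \<open>2 A r\<close>.\<close>

fun chain_set :: "'a \<Rightarrow> real \<Rightarrow> nat \<Rightarrow> 'a set" where
  "chain_set x r 0 = {x}"
| "chain_set x r (Suc n) = (\<Union>y\<in>Q x r. chain_set y (r / (2 * A)) n)"

lemma chain_set_subset: "x \<in> space M \<Longrightarrow> 0 < r \<Longrightarrow> chain_set x r n \<subseteq> Q x (2 * A * r)"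
proof (induction n arbitrary: x r)
  case 0
  then show ?case using A_ge_1 by (auto simp: Q_iff refl)
next
  case (Suc n)
  show ?case
  proof
    fix z assume "z \<in> chain_set x r (Suc n)"
    then obtain y where y: "y \<in> Q x r" "z \<in> chain_set y (r / (2 * A)) n" by auto
    have yX: "y \<in> space M" using y by (simp add: Q_iff)
    have "z \<in> Q y (2 * A * (r / (2 * A)))" using y yX Suc A_ge_1 by (intro subsetD[OF Suc.IH]) auto
    then have z: "z \<in> space M" "d y z < r" using A_ge_1 by (auto simp: Q_iff)
    have "d x z \<le> A * (d x y + d y z)" using Suc.prems yX z by (intro quasi)
    also have "\<dots> < A * (r + r)" using y z A_ge_1 by (intro mult_strict_left_mono) (auto simp: Q_iff)
    finally show "z \<in> Q x (2 * A * r)" using z by (simp add: Q_iff)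
  qed
qed

lemma ball_subset_chain_set:
  "z \<in> chain_set x r n \<Longrightarrow> Q z (r / (2 * A) ^ n) \<subseteq> chain_set x r (Suc n)"
proof (induction n arbitrary: x r)
  case (Suc n)
  then obtain y where y: "y \<in> Q x r" "z \<in> chain_set y (r / (2 * A)) n" by auto
  then have "Q z (r / (2 * A) / (2 * A) ^ n) \<subseteq> chain_set y (r / (2 * A)) (Suc n)" by (intro Suc.IH)
  then have "Q z (r / (2 * A) ^ Suc n) \<subseteq> chain_set y (r / (2 * A)) (Suc n)" by simp
  then show ?case using y(1) by (subst chain_set.simps(2)) blast
qed auto

definition open_hull :: "'a \<Rightarrow> real \<Rightarrow> 'a set" where
  "open_hull x r = (\<Union>n. chain_set x r n)"

lemma open_hull_subset: "x \<in> space M \<Longrightarrow> 0 < r \<Longrightarrow> open_hull x r \<subseteq> Q x (2 * A * r)"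
  unfolding open_hull_def using chain_set_subset by blast

lemma subset_open_hull: "Q x r \<subseteq> open_hull x r"
  unfolding open_hull_def using ball_subset_chain_set[of x x r 0] by (intro SUP_upper2[of 1]) auto

lemma openin_open_hull:
  assumes x: "x \<in> space M" "0 < r"
  shows "openin (qtopology (space M) d) (open_hull x r)"
  unfolding openin_qtopology
proof (intro conjI ballI)
  show "open_hull x r \<subseteq> space M" using open_hull_subset[OF x] Q_subset_space by blast
  fix z assume "z \<in> open_hull x r"
  then obtain n where "z \<in> chain_set x r n" by (auto simp: open_hull_def)
  from ball_subset_chain_set[OF this] have "Q z (r / (2 * A) ^ n) \<subseteq> open_hull x r"
    unfolding open_hull_def by blast
  moreover have "0 < r / (2 * A) ^ n" using x A_ge_1 by simp
  ultimately show "\<exists>s>0. Q z s \<subseteq> open_hull x r" by blast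
qed

text \<open>The engulfing property behind the Vitali covering. The larger ball has to contain the hull, not only the ball,
  since the hulls are what is covered.\<close>

lemma open_hull_subset_larger_ball:
  assumes x: "x \<in> space M" "0 < r" and y: "y \<in> space M" and rs: "r \<le> 2 * s"
    and meet: "Q x r \<inter> Q y s \<noteq> {}"
  shows "open_hull x r \<subseteq> Q y (7 * A ^ 3 * s)"
proof
  fix z assume "z \<in> open_hull x r"
  then have z: "z \<in> space M" "d x z < 2 * A * r" using open_hull_subset[OF x] by (auto simp: Q_iff)
  obtain u where u: "u \<in> space M" "d x u < r" "d y u < s" using meet by (auto simp: Q_iff)
  have s: "0 < s" using x rs by simp
  have "d u z \<le> A * (d u x + d x z)" using x u z by (intro quasi)
  also have "\<dots> \<le> A * (2 * s + 4 * A * s)"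
  proof (rule mult_left_mono)
    have "2 * A * r \<le> 2 * A * (2 * s)" using A_ge_1 rs by (intro mult_left_mono) auto
    then show "d u x + d x z \<le> 2 * s + 4 * A * s" using u z x rs sym[of u x] by simp
  qed (use A_ge_1 in simp)
  finally have uz: "d u z \<le> A * (2 * s + 4 * A * s)" .
  have "d y z \<le> A * (d y u + d u z)" using y u z by (intro quasi)
  also have "\<dots> < A * (s + A * (2 * s + 4 * A * s))"
    using u uz A_ge_1 by (intro mult_strict_left_mono) auto
  also have "\<dots> = (A + 2 * A ^ 2 + 4 * A ^ 3) * s" by (simp add: algebra_simps power2_eq_square power3_eq_cube)
  also have "\<dots> \<le> 7 * A ^ 3 * s"
  proof (rule mult_right_mono)
    have "A \<le> A ^ 3" "A ^ 2 \<le> A ^ 3" using A_ge_1 by (simp_all add: self_le_power power_increasing)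
    moreover have "0 \<le> A ^ 3" using A_ge_1 by simp
    ultimately show "A + 2 * A ^ 2 + 4 * A ^ 3 \<le> 7 * A ^ 3" by linarith
  qed (use s in simp)
  finally show "z \<in> Q y (7 * A ^ 3 * s)" using z by (simp add: Q_iff)
qed

section \<open>Log-Hoelder exponents and the distance to a base point\<close>

text \<open>The dilation factor of the Vitali covering.\<close>

definition \<theta> :: real where "\<theta> = 7 * A ^ 3"

lemma theta_ge_1: "1 \<le> \<theta>"
  unfolding \<theta>_def using one_le_power[OF A_ge_1, of 3] by linarith

text \<open>For a far ball even the dilate by \<open>\<theta>\<close> keeps a distance from \<open>x0\<close> comparable to that of its centre, so the decay
  condition on an exponent controls its oscillation there.\<close>

definition far :: "'a \<Rightarrow> 'a \<Rightarrow> real \<Rightarrow> bool" where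
  "far x0 x r \<longleftrightarrow> 2 * A * \<theta> * r \<le> d x x0"

text \<open>The oscillation of a log-Hoelder exponent on a far ball is \<open>O(1 / ln (1 / \<rho>))\<close>: the radius enters through the
  local condition and the distance through the condition at infinity.\<close>

definition \<rho> :: "'a \<Rightarrow> 'a \<Rightarrow> real \<Rightarrow> real" where
  "\<rho> x0 x r = min r (1 / (exp 1 + d x x0))"

context
  fixes x0 x :: 'a and r :: real
  assumes x0: "x0 \<in> space M" and x: "x \<in> space M" and r: "0 < r"
begin

lemma distance_to_x0_nonneg: "0 \<le> d x x0" using nonneg x x0 by simp

lemma rho_pos: "0 < \<rho> x0 x r"
  using r distance_to_x0_nonneg by (simp add: \<rho>_def add_pos_nonneg)

lemma rho_le: "\<rho> x0 x r \<le> r" "\<rho> x0 x r \<le> 1 / (exp 1 + d x x0)"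
  by (simp_all add: \<rho>_def)

lemma rho_le_exp: "\<rho> x0 x r \<le> exp (- 1)"
proof -
  have "1 / (exp 1 + d x x0) \<le> 1 / exp 1" using distance_to_x0_nonneg by (intro divide_left_mono) (auto simp: add_pos_nonneg)
  with rho_le(2) show ?thesis by (simp add: exp_minus inverse_eq_divide)
qed

lemma rho_le_1: "\<rho> x0 x r \<le> 1"
  using rho_le_exp by (rule order_trans) simp

lemma ln_rho: "1 \<le> ln (1 / \<rho> x0 x r)"
proof -
  have "exp 1 \<le> 1 / \<rho> x0 x r"
    using le_imp_inverse_le[OF rho_le_exp rho_pos] by (simp add: exp_minus inverse_eq_divide)
  then show ?thesis using rho_pos by (simp add: ln_ge_iff)
qed

lemma far_distance:
  assumes far: "far x0 x r" and y: "y \<in> Q x (\<theta> * r)"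
  shows "d x x0 \<le> 2 * A * d y x0" "d y x0 \<le> 2 * A * d x x0"
proof -
  have yX: "y \<in> space M" "d x y < \<theta> * r" using y by (auto simp: Q_iff)
  have A\<theta>: "2 * (A * (\<theta> * r)) \<le> d x x0" using far by (simp add: far_def mult.assoc)
  have "A * d x y \<le> A * (\<theta> * r)" using yX A_ge_1 by (intro mult_left_mono) auto
  moreover have "d x x0 \<le> A * (d x y + d y x0)" using x x0 yX by (intro quasi)
  then have "d x x0 \<le> A * d x y + A * d y x0" by (simp add: algebra_simps)
  ultimately show "d x x0 \<le> 2 * A * d y x0" using A\<theta> by linarith
  have "d y x0 \<le> A * (d y x + d x x0)" using x x0 yX by (intro quasi)
  then have "d y x0 \<le> A * d x y + A * d x x0" using sym[of x y] x yX by (simp add: algebra_simps)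
  moreover have "d x x0 \<le> A * d x x0" using A_ge_1 distance_to_x0_nonneg by (simp add: mult_le_cancel_right1)
  ultimately show "d y x0 \<le> 2 * A * d x x0"
    using A\<theta> \<open>A * d x y \<le> A * (\<theta> * r)\<close> distance_to_x0_nonneg by linarith
qed

text \<open>The unit ball around \<open>x0\<close> lies in a dilate of \<open>Q x r\<close> by a factor of order \<open>\<rho>\<^sup>-\<^sup>2\<close>.\<close>

lemma measure_ge_rho:
  "(\<rho> x0 x r ^ 2 / (2 * A)) ^ D * measure M (Q x0 1) \<le> measure M (Q x r)"
proof -
  let ?\<rho> = "\<rho> x0 x r" and ?s = "A / \<rho> x0 x r ^ 2"
  have "?\<rho> ^ 2 \<le> 1" using rho_pos rho_le_1 by (simp add: power_le_one)
  then have s: "1 \<le> ?s" using A_ge_1 rho_pos by (simp add: field_simps)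
  have "?\<rho> * (exp 1 + d x x0) \<le> 1" using rho_le(2) distance_to_x0_nonneg by (simp add: field_simps add_pos_nonneg)
  moreover have "?\<rho> * (1 + d x x0) \<le> ?\<rho> * (exp 1 + d x x0)"
    using rho_pos by (intro mult_left_mono) (auto simp: one_le_exp_iff)
  ultimately have "?\<rho> * (1 + d x x0) \<le> 1" by simp
  then have "1 + d x x0 \<le> 1 / ?\<rho>" using rho_pos by (simp add: field_simps)
  also have "\<dots> \<le> 1 / ?\<rho> ^ 2 * r"
    using rho_pos rho_le(1) by (simp add: field_simps power2_eq_square)
  finally have "A * (1 + d x x0) \<le> A * (1 / ?\<rho> ^ 2 * r)" using A_ge_1 by (intro mult_left_mono) auto
  then have *: "A * (1 + d x x0) \<le> ?s * r" by simp
  have sub: "Q x0 1 \<subseteq> Q x (?s * r)"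
  proof
    fix y assume "y \<in> Q x0 1"
    then have y: "y \<in> space M" "d x0 y < 1" by (auto simp: Q_iff)
    have "d x y \<le> A * (d x x0 + d x0 y)" using x x0 y by (intro quasi)
    also have "\<dots> < A * (1 + d x x0)" using y A_ge_1 by (intro mult_strict_left_mono) auto
    also note *
    finally show "y \<in> Q x (?s * r)" using y by (simp add: Q_iff)
  qed
  have "measure M (Q x0 1) \<le> measure M (Q x (?s * r))"
    using s r by (intro measure_Q_mono sub x x0 mult_pos_pos) auto
  also have "\<dots> \<le> (2 * ?s) ^ D * measure M (Q x r)" by (rule measure_Q_dilate[OF x r s])
  finally have "(?\<rho> ^ 2 / (2 * A)) ^ D * measure M (Q x0 1)
      \<le> (?\<rho> ^ 2 / (2 * A)) ^ D * ((2 * ?s) ^ D * measure M (Q x r))"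
    using A_ge_1 rho_pos by (intro mult_left_mono) auto
  also have "\<dots> = (?\<rho> ^ 2 / (2 * A) * (2 * ?s)) ^ D * measure M (Q x r)"
    by (simp only: power_mult_distrib mult.assoc)
  also have "?\<rho> ^ 2 / (2 * A) * (2 * ?s) = 1" using A_ge_1 rho_pos by simp
  finally show ?thesis by simp
qed

end

text \<open>An integrable function comparable to \<open>(1 + d y x0)\<^sup>-\<^sup>D\<^sup>-\<^sup>1\<close>; written as a series of indicators of
  balls, it is integrated term by term with the doubling property.\<close>

definition decay :: "'a \<Rightarrow> 'a \<Rightarrow> ennreal" where
  "decay x0 y = (\<Sum>k. ennreal ((1 / 2 ^ k) ^ (D + 1)) * indicator (Q x0 (2 ^ k)) y)"

lemma decay_measurable [measurable]: "x0 \<in> space M \<Longrightarrow> decay x0 \<in> borel_measurable M"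
  unfolding decay_def[abs_def] by measurable

lemma decay_integrable:
  assumes x0: "x0 \<in> space M"
  shows "(\<integral>\<^sup>+y. decay x0 y \<partial>M) < \<infinity>"
proof -
  have "(\<integral>\<^sup>+y. decay x0 y \<partial>M) = (\<Sum>k. \<integral>\<^sup>+y. ennreal ((1 / 2 ^ k) ^ (D + 1)) * indicator (Q x0 (2 ^ k)) y \<partial>M)"
    unfolding decay_def using x0 by (intro nn_integral_suminf) measurable
  also have "\<dots> = (\<Sum>k. ennreal ((1 / 2 ^ k) ^ (D + 1)) * emeasure M (Q x0 (2 ^ k)))"
    using x0 by (intro suminf_cong nn_integral_cmult_indicator) simp
  also have "\<dots> \<le> (\<Sum>k. ennreal ((1 / 2) ^ k * measure M (Q x0 1)))"
  proof (intro suminf_le summableI)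
    fix k :: nat
    have "measure M (Q x0 (2 ^ k)) \<le> (2 ^ k) ^ D * measure M (Q x0 1)"
      using measure_Q_dilate_pow[OF x0, of 1 k] by simp
    then have "(1 / 2 ^ k) ^ (D + 1) * measure M (Q x0 (2 ^ k))
        \<le> (1 / 2 ^ k) ^ (D + 1) * ((2 ^ k) ^ D * measure M (Q x0 1))"
      by (intro mult_left_mono) auto
    also have "\<dots> = (1 / 2) ^ k * measure M (Q x0 1)" by (simp add: power_divide)
    finally show "ennreal ((1 / 2 ^ k) ^ (D + 1)) * emeasure M (Q x0 (2 ^ k))
        \<le> ennreal ((1 / 2) ^ k * measure M (Q x0 1))"
      using x0 by (simp add: emeasure_Q ennreal_leI flip: ennreal_mult)
  qed
  also have "\<dots> = ennreal (\<Sum>k. (1 / 2) ^ k * measure M (Q x0 1))"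
    by (intro suminf_ennreal2 summable_mult2) (auto simp: summable_geometric)
  also have "\<dots> < \<infinity>" by simp
  finally show ?thesis .
qed

lemma decay_ge:
  assumes "x0 \<in> space M" "y \<in> space M"
  shows "ennreal ((1 / (2 * (1 + d y x0))) ^ (D + 1)) \<le> decay x0 y"
proof -
  have nn: "0 \<le> d y x0" using assms nonneg by simp
  obtain k :: nat where k: "1 + d y x0 \<le> 2 ^ k" "2 ^ k \<le> 2 * (1 + d y x0)"
    using power_of_two_between[of "1 + d y x0"] nn by auto
  have "ennreal ((1 / (2 * (1 + d y x0))) ^ (D + 1)) \<le> ennreal ((1 / 2 ^ k) ^ (D + 1))"
    using k nn by (intro ennreal_leI power_mono divide_left_mono) auto
  also have "\<dots> = ennreal ((1 / 2 ^ k) ^ (D + 1)) * indicator (Q x0 (2 ^ k)) y"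
    using k assms sym[of x0 y] by (simp add: Q_iff)
  also have "\<dots> \<le> decay x0 y"
  proof -
    have "f k \<le> (\<Sum>k. f k)" for f :: "nat \<Rightarrow> ennreal"
      using sum_le_suminf[of f "{k}"] by (simp add: summableI)
    then show ?thesis unfolding decay_def .
  qed
  finally show ?thesis .
qed

text \<open>Makes the powers \<open>\<rho>\<^sup>3\<^sup>D\<^sup>+\<^sup>1\<close> summable over disjoint far balls: \<open>\<rho>\<^sup>2\<^sup>D\<close> is absorbed by the measure of the ball and \<open>\<rho>\<^sup>D\<^sup>+\<^sup>1\<close>
  by the size of \<open>decay x0\<close> on it.\<close>

lemma rho_power_le_decay:
  assumes x0: "x0 \<in> space M"
  obtains c where "0 < c"
    "\<And>x r. x \<in> space M \<Longrightarrow> 0 < r \<Longrightarrow> far x0 x r \<Longrightarrow>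
      ennreal (\<rho> x0 x r ^ (3 * D + 1)) \<le> ennreal c * (\<integral>\<^sup>+y\<in>Q x r. decay x0 y \<partial>M)"
proof -
  define b where "b = (1 / (4 * A)) ^ (D + 1) * (1 / (2 * A)) ^ D * measure M (Q x0 1)"
  have b: "0 < b" unfolding b_def using A_ge_1 measure_Q_pos[OF x0, of 1] by simp
  show ?thesis
  proof (rule that[of "1 / b"])
    show "0 < 1 / b" using b by simp
    fix x r assume x: "x \<in> space M" and r: "0 < r" and far: "far x0 x r"
    let ?\<rho> = "\<rho> x0 x r"
    have rho: "0 < ?\<rho>" "?\<rho> \<le> 1 / (exp 1 + d x x0)" using rho_pos rho_le x0 x r by blast+
    have nn: "0 \<le> d x x0" using x x0 nonneg by simp
    have pt: "ennreal ((?\<rho> / (4 * A)) ^ (D + 1)) \<le> decay x0 y" if y: "y \<in> Q x r" for y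
    proof -
      have "y \<in> Q x (\<theta> * r)" using y Q_mono[of r "\<theta> * r"] theta_ge_1 r by auto
      then have dy: "d y x0 \<le> 2 * A * d x x0" by (rule far_distance(2)[OF x0 x r far])
      have yX: "y \<in> space M" using y by (simp add: Q_iff)
      have "1 + d y x0 \<le> 2 * A * (1 + d x x0)" using dy A_ge_1 by (simp add: algebra_simps)
      also have "\<dots> \<le> 2 * A * (exp 1 + d x x0)" using A_ge_1 by (intro mult_left_mono) (auto simp: one_le_exp_iff)
      also have "\<dots> \<le> 2 * A * (1 / ?\<rho>)"
        using rho nn A_ge_1 by (intro mult_left_mono) (auto simp: field_simps add_pos_nonneg)
      finally have "1 + d y x0 \<le> 2 * A * (1 / ?\<rho>)" .
      then have "?\<rho> / (4 * A) \<le> 1 / (2 * (1 + d y x0))"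
        using rho A_ge_1 nonneg[OF yX x0] by (simp add: field_simps)
      then have "ennreal ((?\<rho> / (4 * A)) ^ (D + 1)) \<le> ennreal ((1 / (2 * (1 + d y x0))) ^ (D + 1))"
        using rho A_ge_1 by (intro ennreal_leI power_mono) auto
      also have "\<dots> \<le> decay x0 y" by (rule decay_ge[OF x0 yX])
      finally show ?thesis .
    qed
    have "b * ?\<rho> ^ (3 * D + 1) = (?\<rho> / (4 * A)) ^ (D + 1) * ((?\<rho> ^ 2 / (2 * A)) ^ D * measure M (Q x0 1))"
    proof -
      have "?\<rho> ^ (3 * D + 1) = ?\<rho> ^ (D + 1) * (?\<rho> ^ 2) ^ D" by (simp flip: power_mult power_add)
      then show ?thesis by (simp add: b_def power_divide)
    qed
    also have "\<dots> \<le> (?\<rho> / (4 * A)) ^ (D + 1) * measure M (Q x r)"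
      using rho A_ge_1 by (intro mult_left_mono measure_ge_rho x0 x r) auto
    finally have "ennreal (b * ?\<rho> ^ (3 * D + 1)) \<le> ennreal ((?\<rho> / (4 * A)) ^ (D + 1)) * emeasure M (Q x r)"
      using rho A_ge_1 by (simp add: emeasure_Q[OF x r] ennreal_leI flip: ennreal_mult)
    also have "\<dots> = (\<integral>\<^sup>+y. ennreal ((?\<rho> / (4 * A)) ^ (D + 1)) * indicator (Q x r) y \<partial>M)"
      using x r by (simp add: nn_integral_cmult_indicator)
    also have "\<dots> \<le> (\<integral>\<^sup>+y\<in>Q x r. decay x0 y \<partial>M)"
      using pt by (intro nn_integral_mono) (auto split: split_indicator)
    finally have "ennreal (1 / b) * ennreal (b * ?\<rho> ^ (3 * D + 1)) \<le> ennreal (1 / b) * (\<integral>\<^sup>+y\<in>Q x r. decay x0 y \<partial>M)"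
      by (rule mult_left_mono) simp
    then show "ennreal (?\<rho> ^ (3 * D + 1)) \<le> ennreal (1 / b) * (\<integral>\<^sup>+y\<in>Q x r. decay x0 y \<partial>M)"
      using b rho by (simp flip: ennreal_mult)
  qed
qed

text \<open>If the distance term decides \<open>\<rho>\<close>, both values are compared with the number \<open>p_inf\<close>. If the radius does,
  the local condition applies once the dilated ball has diameter below \<open>1/2\<close>; otherwise \<open>ln (1 / \<rho>)\<close> is bounded and
  boundedness of the exponent is enough.\<close>

lemma LH_oscillation:
  assumes p: "p \<in> LH (space M) d x0" and x0: "x0 \<in> space M"
  obtains C where "0 \<le> C"
    "\<And>x r y z. x \<in> space M \<Longrightarrow> 0 < r \<Longrightarrow> far x0 x r \<Longrightarrow> y \<in> Q x (\<theta> * r) \<Longrightarrow> z \<in> Q x (\<theta> * r) \<Longrightarrow>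
      \<bar>p y - p z\<bar> * ln (1 / \<rho> x0 x r) \<le> C"
    "\<And>x. x \<in> space M \<Longrightarrow> \<bar>p x\<bar> \<le> C"
proof -
  obtain C p_inf where loc: "\<And>x y. x \<in> space M \<Longrightarrow> y \<in> space M \<Longrightarrow> d x y < 1 / 2 \<Longrightarrow>
        \<bar>p x - p y\<bar> \<le> (if d x y = 0 then 0 else C / ln (exp 1 + 1 / d x y))"
    and glob: "\<And>x. x \<in> space M \<Longrightarrow> \<bar>p x - p_inf\<bar> \<le> C / ln (exp 1 + d x x0)"
    using p unfolding LH_def by blast
  have lnpos: "1 \<le> ln (exp 1 + d x x0)" if "x \<in> space M" for x
    using nonneg[OF that x0] by (rule ln_exp1_ge_1)
  have C0: "0 \<le> C"
  proof -
    have "0 \<le> C / ln (exp 1 + d x0 x0)" using glob[OF x0] by linarith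
    then show ?thesis using lnpos[OF x0] by (simp add: zero_le_divide_iff)
  qed
  have bound: "\<bar>p x - p_inf\<bar> \<le> C" if "x \<in> space M" for x
  proof -
    have "C / ln (exp 1 + d x x0) \<le> C / 1" using C0 lnpos[OF that] by (intro divide_left_mono) auto
    then show ?thesis using glob[OF that] by simp
  qed
  define \<kappa> where "\<kappa> = 2 * A * \<theta>"
  have kappa: "2 \<le> \<kappa>" "1 \<le> \<kappa>" using mult_mono[OF A_ge_1 theta_ge_1] A_ge_1 by (auto simp: \<kappa>_def)
  define C' where "C' = 4 * A * C + \<kappa> * C + 2 * C * ln (2 * \<kappa>) + \<bar>p_inf\<bar> + C"
  have parts: "0 \<le> 4 * A * C" "0 \<le> \<kappa> * C" "0 \<le> 2 * C * ln (2 * \<kappa>)" using A_ge_1 C0 kappa by auto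
  show ?thesis
  proof (rule that[of C'])
    show "0 \<le> C'" using parts C0 by (simp add: C'_def)
    show "\<bar>p x\<bar> \<le> C'" if "x \<in> space M" for x
      using bound[OF that] parts by (simp add: C'_def)
  next
    fix x r y z
    assume x: "x \<in> space M" and r: "0 < r" and far: "far x0 x r"
      and y: "y \<in> Q x (\<theta> * r)" and z: "z \<in> Q x (\<theta> * r)"
    let ?\<rho> = "\<rho> x0 x r"
    have nn: "0 \<le> d x x0" using x x0 nonneg by simp
    have yz: "y \<in> space M" "z \<in> space M" using y z by (auto simp: Q_iff)
    have osc2: "\<bar>p y - p z\<bar> \<le> 2 * C" using bound[OF yz(1)] bound[OF yz(2)] by linarith
    have L1: "1 \<le> ln (1 / ?\<rho>)" by (rule ln_rho[OF x0 x r])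
    consider (large) "?\<rho> = 1 / (exp 1 + d x x0)" | (medium) "?\<rho> = r" "1 / (2 * \<kappa>) \<le> r"
      | (small) "?\<rho> = r" "r < 1 / (2 * \<kappa>)"
      unfolding \<rho>_def by linarith
    then show "\<bar>p y - p z\<bar> * ln (1 / ?\<rho>) \<le> C'"
    proof cases
      case large
      have L: "ln (1 / ?\<rho>) = ln (exp 1 + d x x0)" unfolding large by simp
      have half: "\<bar>p u - p_inf\<bar> * ln (1 / ?\<rho>) \<le> 2 * A * C" if u: "u \<in> Q x (\<theta> * r)" for u
      proof -
        have uX: "u \<in> space M" using u by (simp add: Q_iff)
        have "ln (1 / ?\<rho>) \<le> 2 * A * ln (exp 1 + d x x0 / (2 * A))"
          unfolding L using nn A_ge_1 by (intro ln_shrink) auto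
        also have "\<dots> \<le> 2 * A * ln (exp 1 + d u x0)"
        proof -
          have "d x x0 / (2 * A) \<le> d u x0"
            using far_distance(1)[OF x0 x r far u] A_ge_1 by (simp add: field_simps)
          moreover have "0 < exp 1 + d x x0 / (2 * A)" using nn A_ge_1 by (simp add: add_pos_nonneg)
          ultimately have "ln (exp 1 + d x x0 / (2 * A)) \<le> ln (exp 1 + d u x0)"
            by (subst ln_le_cancel_iff) linarith+
          then show ?thesis using A_ge_1 by (intro mult_left_mono) auto
        qed
        finally have "\<bar>p u - p_inf\<bar> * ln (1 / ?\<rho>) \<le> \<bar>p u - p_inf\<bar> * (2 * A * ln (exp 1 + d u x0))"
          by (intro mult_left_mono) auto
        also have "\<dots> \<le> C / ln (exp 1 + d u x0) * (2 * A * ln (exp 1 + d u x0))"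
          using glob[OF uX] lnpos[OF uX] A_ge_1 by (intro mult_right_mono) auto
        also have "\<dots> = 2 * A * C" using lnpos[OF uX] by simp
        finally show ?thesis .
      qed
      have "\<bar>p y - p z\<bar> * ln (1 / ?\<rho>) \<le> (\<bar>p y - p_inf\<bar> + \<bar>p z - p_inf\<bar>) * ln (1 / ?\<rho>)"
        using L1 by (intro mult_right_mono) auto
      also have "\<dots> \<le> 4 * A * C" using half[OF y] half[OF z] by (simp add: distrib_right)
      finally show ?thesis using parts C0 by (simp add: C'_def)
    next
      case medium
      have "1 / r \<le> 2 * \<kappa>" using medium r kappa by (simp add: field_simps)
      then have "ln (1 / ?\<rho>) \<le> ln (2 * \<kappa>)" unfolding medium(1) using r kappa by (subst ln_le_cancel_iff) auto
      then have "\<bar>p y - p z\<bar> * ln (1 / ?\<rho>) \<le> 2 * C * ln (2 * \<kappa>)" using osc2 C0 L1 by (intro mult_mono) auto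
      then show ?thesis using parts C0 by (simp add: C'_def)
    next
      case small
      have "d y z \<le> A * (d y x + d x z)" using yz x by (intro quasi)
      also have "\<dots> < A * (\<theta> * r + \<theta> * r)"
        using y z yz x sym[of y x] A_ge_1 by (intro mult_strict_left_mono add_strict_mono) (auto simp: Q_iff)
      finally have dyz: "d y z < \<kappa> * r" by (simp add: \<kappa>_def algebra_simps)
      have "\<kappa> * r < 1 / 2" using small kappa by (simp add: field_simps)
      then have "d y z < 1 / 2" using dyz by simp
      note * = loc[OF yz this]
      show ?thesis
      proof (cases "d y z = 0")
        case True
        then show ?thesis using * parts C0 by (simp add: C'_def)
      next
        case False
        then have dpos: "0 < d y z" using nonneg[OF yz] by simp
        let ?l = "ln (exp 1 + 1 / d y z)"
        have l: "1 \<le> ?l" using dpos by (intro ln_exp1_ge_1) auto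
        have "ln (1 / ?\<rho>) \<le> ln (exp 1 + 1 / r)"
          unfolding small(1) using r by (subst ln_le_cancel_iff) (auto simp: add_pos_pos)
        also have "\<dots> \<le> \<kappa> * ln (exp 1 + 1 / r / \<kappa>)" using r kappa by (intro ln_shrink) auto
        also have "\<dots> \<le> \<kappa> * ?l"
        proof -
          have "1 / r / \<kappa> \<le> 1 / d y z" using dyz dpos r kappa by (simp add: field_simps)
          moreover have "0 < 1 / r / \<kappa>" using kappa r by simp
          ultimately have "ln (exp 1 + 1 / r / \<kappa>) \<le> ?l"
            using exp_gt_zero[of "1::real"] by (subst ln_le_cancel_iff) linarith+
          then show ?thesis using kappa by (intro mult_left_mono) auto
        qed
        finally have "\<bar>p y - p z\<bar> * ln (1 / ?\<rho>) \<le> C / ?l * (\<kappa> * ?l)"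
          using * False L1 l C0 by (intro mult_mono) auto
        also have "\<dots> = \<kappa> * C" using l by simp
        finally show ?thesis using parts C0 by (simp add: C'_def)
      qed
    qed
  qed
qed

end

section \<open>Estimates on a single ball\<close>

text \<open>Since \<open>a \<le> 1\<close> and \<open>p \<le> s\<close> on \<open>B\<close>, dividing by \<open>a\<^sup>1\<^sup>/\<^sup>s\<close> divides the modular by at most \<open>a\<close>. This replaces the norm of \<open>W F\<close>
  on \<open>B\<close> by a power of its modular with a single exponent, and \<open>a\<close> may be any upper bound of the modular.\<close>

lemma Hoelder_on_ball:
  assumes [measurable]: "W \<in> borel_measurable M" "F \<in> borel_measurable M" "p \<in> borel_measurable M"
      "B \<in> sets M" "B' \<in> sets M"
    and BB': "B \<subseteq> B'"
    and p: "AE y in M. 1 < p y" and W: "AE y in M. 0 < W y \<and> W y < \<infinity>"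
    and a: "0 < a" "a \<le> 1" "(\<integral>\<^sup>+y\<in>B. ennpowr (W y * F y) (p y) \<partial>M) \<le> ennreal a"
    and s: "0 < s" "\<And>y. y \<in> B \<Longrightarrow> p y \<le> s"
    and \<nu>: "0 < \<nu>" "Lp_norm M (conj_exp p) (\<lambda>y. inverse (W y) * indicator B' y) \<le> ennreal \<nu>"
  shows "(\<integral>\<^sup>+y\<in>B. F y \<partial>M) \<le> ennreal (4 * a powr (1 / s) * \<nu>)"
proof -
  define b where "b = a powr (1 / s)"
  have b: "0 < b" using a by (simp add: b_def)
  define f where "f y = ennreal (1 / b) * (W y * F y * indicator B y)" for y
  define g where "g y = inverse (W y) * indicator B' y / ennreal (2 * \<nu>)" for y
  have [measurable]: "f \<in> borel_measurable M" "g \<in> borel_measurable M"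
    unfolding f_def[abs_def] g_def[abs_def] by measurable
  have "(\<integral>\<^sup>+y. ennpowr (f y) (p y) \<partial>M) \<le> (\<integral>\<^sup>+y. ennreal (1 / a) * (ennpowr (W y * F y) (p y) * indicator B y) \<partial>M)"
  proof (rule nn_integral_mono)
    fix y
    show "ennpowr (f y) (p y) \<le> ennreal (1 / a) * (ennpowr (W y * F y) (p y) * indicator B y)"
    proof (cases "y \<in> B")
      case True
      have "(1 / b) powr p y = (1 / a) powr (p y / s)"
        using a by (simp add: b_def powr_divide powr_powr)
      also have "\<dots> \<le> (1 / a) powr 1"
        using a s True by (intro powr_mono) auto
      finally have "(1 / b) powr p y \<le> 1 / a" using a by simp
      then show ?thesis
        using True b unfolding f_def
        by (subst ennpowr_mult_real) (auto intro!: mult_right_mono ennreal_leI)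
    qed (simp add: f_def)
  qed
  also have "\<dots> \<le> ennreal (1 / a) * ennreal a"
    using a(3) by (subst nn_integral_cmult) (auto intro!: mult_left_mono)
  also have "\<dots> = 1" using a by (simp flip: ennreal_mult)
  finally have f: "(\<integral>\<^sup>+y. ennpowr (f y) (p y) \<partial>M) \<le> 1" .
  have g: "(\<integral>\<^sup>+y. ennpowr (g y) (conj_exp p y) \<partial>M) \<le> 1"
    unfolding g_def
  proof (rule modular_le_1)
    show "AE y in M. 0 \<le> conj_exp p y" using p by eventually_elim (simp add: conj_exp_def)
    have "ennreal \<nu> < ennreal (2 * \<nu>)" using \<nu> by (simp add: ennreal_less_iff)
    with \<nu>(2) show "Lp_norm M (conj_exp p) (\<lambda>y. inverse (W y) * indicator B' y) < ennreal (2 * \<nu>)"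
      by order
  qed (use \<nu> in simp)
  have "(\<integral>\<^sup>+y\<in>B. F y \<partial>M) = (\<integral>\<^sup>+y. ennreal (2 * b * \<nu>) * (f y * g y) \<partial>M)"
  proof (rule nn_integral_cong_AE)
    show "AE y in M. F y * indicator B y = ennreal (2 * b * \<nu>) * (f y * g y)"
      using W
    proof eventually_elim
      case (elim y)
      show ?case
      proof (cases "y \<in> B")
        case True
        obtain v where v: "W y = ennreal v" "0 < v" using elim by (cases "W y") auto
        have "ennreal (2 * b * \<nu>) * (f y * g y)
            = ennreal (2 * b * \<nu>) * (ennreal (1 / b) * ennreal v * (ennreal (1 / v) * ennreal (1 / (2 * \<nu>)))) * F y"
          using True BB' v b \<nu>
          by (auto simp: f_def g_def divide_ennreal_def inverse_ennreal ac_simps inverse_eq_divide)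
        also have "ennreal (2 * b * \<nu>) * (ennreal (1 / b) * ennreal v * (ennreal (1 / v) * ennreal (1 / (2 * \<nu>)))) = 1"
          using b \<nu> v by (simp flip: ennreal_mult)
        finally show ?thesis using True by simp
      qed (simp add: f_def)
    qed
  qed
  also have "\<dots> = ennreal (2 * b * \<nu>) * (\<integral>\<^sup>+y. f y * g y \<partial>M)" by (rule nn_integral_cmult) measurable
  also have "\<dots> \<le> ennreal (2 * b * \<nu>) * 2"
    using p f g by (intro mult_left_mono Hoelder_modular) auto
  also have "\<dots> = ennreal (4 * b * \<nu>)"
  proof -
    have "ennreal (2 * b * \<nu>) * ennreal 2 = ennreal (2 * b * \<nu> * 2)"
      using b \<nu> by (subst ennreal_mult) auto
    then show ?thesis by (simp add: ac_simps)
  qed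
  finally show ?thesis by (simp add: b_def)
qed

lemma prod_powr_le_sum:
  fixes a s :: "'i \<Rightarrow> real"
  assumes I: "finite I" "I \<noteq> {}" and a: "\<And>i. i \<in> I \<Longrightarrow> 0 < a i \<and> a i \<le> 1"
    and s: "\<And>i. i \<in> I \<Longrightarrow> 0 \<le> s i" "1 \<le> (\<Sum>i\<in>I. s i)"
  shows "(\<Prod>i\<in>I. a i powr s i) \<le> (\<Sum>i\<in>I. a i)"
proof -
  define b where "b = Max (a ` I)"
  have "b \<in> a ` I" unfolding b_def using I by (intro Max_in) auto
  then obtain j where j: "j \<in> I" "b = a j" by auto
  have le: "a i \<le> b" if "i \<in> I" for i unfolding b_def using I that by (intro Max_ge) auto
  have "(\<Prod>i\<in>I. a i powr s i) \<le> (\<Prod>i\<in>I. b powr s i)"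
  proof (intro prod_mono conjI powr_mono2)
    fix i assume i: "i \<in> I"
    show "0 \<le> a i" using a[OF i] by simp
  qed (use s le in auto)
  also have "\<dots> = b powr (\<Sum>i\<in>I. s i)"
    using I a[OF j(1)] j(2) by (subst powr_sum) auto
  also have "\<dots> \<le> b powr 1" using a[OF j(1)] j s by (intro powr_mono') auto
  also have "\<dots> \<le> (\<Sum>i\<in>I. a i)"
  proof -
    have "a j \<le> (\<Sum>i\<in>I. a i)"
    proof (rule member_le_sum)
      show "0 \<le> a i" if "i \<in> I - {j}" for i using a[of i] that by simp
    qed (use I j in auto)
    then show ?thesis using a[OF j(1)] j(2) by simp
  qed
  finally show ?thesis .
qed

text \<open>The data of the sufficiency part, with all bounds in the form in which they are used: \<open>C\<^sub>P\<close> bounds the exponents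
  \<open>P i\<close> and their log-Hoelder oscillation. The assumption \<open>q_P\<close> is the relation \<open>\<Sum> q / P i = 1 + \<eta> q\<close> weakened to an
  inequality.\<close>

locale weighted_setting = homogeneous_type_constants M d A D
  for M :: "'a measure" and d A D +
  fixes x0 :: 'a and m :: nat and \<eta> :: real and P :: "nat \<Rightarrow> 'a \<Rightarrow> real" and q :: "'a \<Rightarrow> real"
    and W :: "nat \<Rightarrow> 'a \<Rightarrow> ennreal" and w :: "'a \<Rightarrow> ennreal"
    and C\<^sub>P q\<^sub>0 q\<^sub>1 :: real
  assumes x0: "x0 \<in> space M" and m: "1 \<le> m" and \<eta>: "0 \<le> \<eta>" "\<eta> < real m"
    and P_meas [measurable]: "\<And>i. i \<in> {1..m} \<Longrightarrow> P i \<in> borel_measurable M"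
    and P_ge_1: "\<And>i x. i \<in> {1..m} \<Longrightarrow> x \<in> space M \<Longrightarrow> 1 \<le> P i x"
    and P_gt_1: "\<And>i. i \<in> {1..m} \<Longrightarrow> AE x in M. 1 < P i x"
    and P_le: "\<And>i x. i \<in> {1..m} \<Longrightarrow> x \<in> space M \<Longrightarrow> P i x \<le> C\<^sub>P"
    and P_osc: "\<And>i x r y z. i \<in> {1..m} \<Longrightarrow> x \<in> space M \<Longrightarrow> 0 < r \<Longrightarrow> far x0 x r \<Longrightarrow>
      y \<in> Q x (\<theta> * r) \<Longrightarrow> z \<in> Q x (\<theta> * r) \<Longrightarrow> \<bar>P i y - P i z\<bar> * ln (1 / \<rho> x0 x r) \<le> C\<^sub>P"
    and q_meas [measurable]: "q \<in> borel_measurable M"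
    and q0: "0 < q\<^sub>0" and q_bounds: "AE x in M. q\<^sub>0 \<le> q x \<and> q x \<le> q\<^sub>1"
    and q_P: "\<And>x. x \<in> space M \<Longrightarrow> 1 \<le> (\<Sum>i=1..m. q x / P i x)"
    and W_weight: "\<And>i. i \<in> {1..m} \<Longrightarrow> weight M d (W i)" and w_weight: "weight M d w"
    and A_finite: "A_const M d m \<eta> P q W w < \<infinity>"
begin

lemma W_meas [measurable]: "i \<in> {1..m} \<Longrightarrow> W i \<in> borel_measurable M"
  and W_AE: "i \<in> {1..m} \<Longrightarrow> AE x in M. 0 < W i x \<and> W i x < \<infinity>"
  using W_weight by (auto simp: weight_def)

lemma w_meas [measurable]: "w \<in> borel_measurable M"
  and w_AE: "AE x in M. 0 < w x \<and> w x < \<infinity>"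
  using w_weight by (auto simp: weight_def)

lemma conj_exp_meas [measurable]: "i \<in> {1..m} \<Longrightarrow> conj_exp (P i) \<in> borel_measurable M"
  unfolding conj_exp_def[abs_def] by measurable

text \<open>Since no factor vanishes, finiteness of the product of the norms gives finiteness of each of them.\<close>

lemma A_const_ball:
  assumes x: "x \<in> space M" and r: "0 < r"
  obtains u \<nu> where "0 < u" "Lp_norm M q (\<lambda>y. w y * indicator (Q x r) y) = ennreal u"
    "\<And>i. i \<in> {1..m} \<Longrightarrow> 0 < \<nu> i"
    "\<And>i. i \<in> {1..m} \<Longrightarrow>
      Lp_norm M (conj_exp (P i)) (\<lambda>y. inverse (W i y) * indicator (Q x r) y) = ennreal (\<nu> i)"
    "measure M (Q x r) powr (\<eta> - m) * u * (\<Prod>i=1..m. \<nu> i) \<le> enn2real (A_const M d m \<eta> P q W w)"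
proof -
  let ?B = "Q x r"
  have [measurable]: "?B \<in> sets M" using x r by measurable
  define U where "U = Lp_norm M q (\<lambda>y. w y * indicator ?B y)"
  define V where "V i = Lp_norm M (conj_exp (P i)) (\<lambda>y. inverse (W i y) * indicator ?B y)" for i
  have U: "0 < U"
    unfolding U_def
  proof (rule Lp_norm_pos)
    show "AE y in M. 0 < q y" using q_bounds q0 by (auto elim!: eventually_mono)
    show "AE y\<in>?B in M. 0 < w y * indicator ?B y" using w_AE by eventually_elim simp
    show "0 < emeasure M ?B" using x r by (rule Q_pos)
  qed measurable
  have V: "0 < V i" if i: "i \<in> {1..m}" for i
    unfolding V_def
  proof (rule Lp_norm_pos)
    show "AE y in M. 0 < conj_exp (P i) y"
      using P_gt_1[OF i] by eventually_elim (simp add: conj_exp_def)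
    show "AE y\<in>?B in M. 0 < inverse (W i y) * indicator ?B y"
      using W_AE[OF i] by eventually_elim (auto simp: zero_less_iff_neq_zero ennreal_inverse_eq_0_iff)
    show "0 < emeasure M ?B" using x r by (rule Q_pos)
  qed (use i in measurable)
  let ?c = "measure M ?B powr (\<eta> - m)"
  have c: "0 < ?c" using measure_Q_pos[OF x r] by simp
  have le: "ennreal ?c * U * (\<Prod>i=1..m. V i) \<le> A_const M d m \<eta> P q W w"
    unfolding A_const_def U_def V_def by (intro SUP_upper) (use x r in \<open>auto simp: qballs_def\<close>)
  then have fin: "ennreal ?c * U * (\<Prod>i=1..m. V i) < \<infinity>" using A_finite by order
  have Vprod: "0 < (\<Prod>i=1..m. V i)" using V by (simp add: zero_less_iff_neq_zero)
  have Ufin: "U < \<infinity>" using fin c Vprod by (auto simp: ennreal_mult_less_top zero_less_iff_neq_zero)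
  have "(\<Prod>i=1..m. V i) < \<infinity>" using fin c U V by (auto simp: ennreal_mult_less_top zero_less_iff_neq_zero)
  then have Vfin: "V i < \<infinity>" if "i \<in> {1..m}" for i
  proof -
    have "(\<Prod>i=1..m. V i) = V i * (\<Prod>j\<in>{1..m} - {i}. V j)" using that by (simp add: prod.remove)
    moreover have "(\<Prod>j\<in>{1..m} - {i}. V j) \<noteq> 0" using V by (simp add: zero_less_iff_neq_zero)
    ultimately show ?thesis using \<open>(\<Prod>i=1..m. V i) < \<infinity>\<close> by (auto simp: ennreal_mult_less_top)
  qed
  show ?thesis
  proof (rule that[of "enn2real U" "\<lambda>i. enn2real (V i)"])
    show "0 < enn2real U" using U Ufin by (simp add: enn2real_positive_iff)
    show Ue: "Lp_norm M q (\<lambda>y. w y * indicator ?B y) = ennreal (enn2real U)" using Ufin by (simp add: U_def)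
    show "0 < enn2real (V i)" if "i \<in> {1..m}" for i using V[OF that] Vfin[OF that] by (simp add: enn2real_positive_iff)
    show Ve: "Lp_norm M (conj_exp (P i)) (\<lambda>y. inverse (W i y) * indicator ?B y) = ennreal (enn2real (V i))"
      if "i \<in> {1..m}" for i using Vfin[OF that] by (simp add: V_def)
    have "ennreal (?c * enn2real U * (\<Prod>i=1..m. enn2real (V i))) = ennreal ?c * U * (\<Prod>i=1..m. V i)"
      using Ufin Vfin c by (simp add: ennreal_mult prod_nonneg flip: prod_ennreal)
    also note le
    also have "A_const M d m \<eta> P q W w = ennreal (enn2real (A_const M d m \<eta> P q W w))"
      using A_finite by simp
    finally show "?c * enn2real U * (\<Prod>i=1..m. enn2real (V i)) \<le> enn2real (A_const M d m \<eta> P q W w)"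
      by (subst (asm) ennreal_le_iff) auto
  qed
qed

definition average_exceeds :: "(nat \<Rightarrow> 'a \<Rightarrow> ennreal) \<Rightarrow> real \<Rightarrow> 'a \<Rightarrow> real \<Rightarrow> bool" where
  "average_exceeds F t x r \<longleftrightarrow> ennreal t < ennreal (measure M (Q x r) powr \<eta>) *
     (\<Prod>i=1..m. (\<integral>\<^sup>+y\<in>Q x r. F i y \<partial>M) / emeasure M (Q x r))"

text \<open>The power of \<open>4\<close> comes from the Hoelder inequality and the power of \<open>2 s\<close> from doubling; the summand one makes a
  later inequality strict.\<close>

definition ball_const :: "real \<Rightarrow> real" where
  "ball_const s = 4 ^ m * ((2 * s) ^ D) powr (m - \<eta>) * enn2real (A_const M d m \<eta> P q W w) + 1"

lemma ball_const_pos: "0 < ball_const s"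
  unfolding ball_const_def by (intro add_nonneg_pos mult_nonneg_nonneg) auto

text \<open>The average condition bounds \<open>t\<close> by integrals over the ball, the Hoelder inequality bounds these by powers of
  the modulars and the norms of \<open>1 / W i\<close> on the dilate, and the weight condition cancels those norms against the norm of
  \<open>w\<close> on the same dilate. Passing from the measure of the ball to that of the dilate uses \<open>\<eta> < m\<close>.\<close>

lemma modular_on_dilated_ball:
  assumes s: "1 \<le> s" and x: "x \<in> space M" and r: "0 < r" and t: "0 < t"
    and ex: "average_exceeds F t x r"
    and F: "\<And>i. i \<in> {1..m} \<Longrightarrow> F i \<in> borel_measurable M"
    and a: "\<And>i. i \<in> {1..m} \<Longrightarrow> 0 < a i" "\<And>i. i \<in> {1..m} \<Longrightarrow> a i \<le> 1"
      "\<And>i. i \<in> {1..m} \<Longrightarrow> (\<integral>\<^sup>+y\<in>Q x r. ennpowr (W i y * F i y) (P i y) \<partial>M) \<le> ennreal (a i)"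
    and b: "\<And>i. i \<in> {1..m} \<Longrightarrow> 0 < b i" "\<And>i y. i \<in> {1..m} \<Longrightarrow> y \<in> Q x r \<Longrightarrow> P i y \<le> b i"
  shows "(\<integral>\<^sup>+y\<in>Q x (s * r).
    ennpowr (ennreal (t / (ball_const s * (\<Prod>i=1..m. a i powr (1 / b i)))) * w y) (q y) \<partial>M) \<le> 1"
proof -
  define L where "L = (2 * s) ^ D"
  have L: "0 < L" using s by (simp add: L_def)
  define K where "K = ball_const s"
  have K: "0 < K" unfolding K_def by (rule ball_const_pos)
    have sr: "0 < s * r" using s r by simp
    have [measurable]: "Q x r \<in> sets M" "Q x (s * r) \<in> sets M" using x r sr by measurable
    obtain u \<nu> where u: "0 < u" "Lp_norm M q (\<lambda>y. w y * indicator (Q x (s * r)) y) = ennreal u"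
      and \<nu>: "\<And>i. i \<in> {1..m} \<Longrightarrow> 0 < \<nu> i"
      "\<And>i. i \<in> {1..m} \<Longrightarrow>
        Lp_norm M (conj_exp (P i)) (\<lambda>y. inverse (W i y) * indicator (Q x (s * r)) y) = ennreal (\<nu> i)"
      and A: "measure M (Q x (s * r)) powr (\<eta> - m) * u * (\<Prod>i=1..m. \<nu> i) \<le> enn2real (A_const M d m \<eta> P q W w)"
      using A_const_ball[OF x sr] by blast
    let ?\<mu> = "measure M (Q x r)" and ?\<mu>' = "measure M (Q x (s * r))"
    have \<mu>: "0 < ?\<mu>" "0 < ?\<mu>'" using measure_Q_pos x r sr by auto
    define \<Lambda> where "\<Lambda> = (\<Prod>i=1..m. a i powr (1 / b i))"
    have \<Lambda>: "0 < \<Lambda>"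
      unfolding \<Lambda>_def
    proof (rule prod_pos)
      fix i assume "i \<in> {1..m}"
      from a(1)[OF this] show "0 < a i powr (1 / b i)" by simp
    qed
    have I: "(\<integral>\<^sup>+y\<in>Q x r. F i y \<partial>M) \<le> ennreal (4 * a i powr (1 / b i) * \<nu> i)" if i: "i \<in> {1..m}" for i
      using F[OF i] a[OF i] b(1)[OF i] b(2)[OF i] \<nu>[OF i] i s r
      by (intro Q_mono Hoelder_on_ball[where B' = "Q x (s * r)",
            OF W_meas[OF i] _ P_meas[OF i] _ _ _ P_gt_1[OF i] W_AE[OF i]]) auto
    have "ennreal t < ennreal (?\<mu> powr \<eta>) * (\<Prod>i=1..m. (\<integral>\<^sup>+y\<in>Q x r. F i y \<partial>M) / emeasure M (Q x r))"
      using ex by (simp add: average_exceeds_def)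
    also have "\<dots> \<le> ennreal (?\<mu> powr \<eta>) * (\<Prod>i=1..m. ennreal (4 * a i powr (1 / b i) * \<nu> i / ?\<mu>))"
    proof (intro mult_left_mono prod_mono_ennreal)
      fix i assume i: "i \<in> {1..m}"
      have "(\<integral>\<^sup>+y\<in>Q x r. F i y \<partial>M) / emeasure M (Q x r) \<le> ennreal (4 * a i powr (1 / b i) * \<nu> i) / ennreal ?\<mu>"
        unfolding emeasure_Q[OF x r] by (intro ennreal_divide_le_mono I i \<mu>) auto
      then show "(\<integral>\<^sup>+y\<in>Q x r. F i y \<partial>M) / emeasure M (Q x r) \<le> ennreal (4 * a i powr (1 / b i) * \<nu> i / ?\<mu>)"
        using \<mu> \<nu>[OF i] by (simp add: divide_ennreal)
    qed auto
    also have "\<dots> = ennreal (?\<mu> powr \<eta> * (\<Prod>i=1..m. 4 * a i powr (1 / b i) * \<nu> i / ?\<mu>))"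
      using \<nu> \<mu> by (subst prod_ennreal) (auto simp: less_imp_le ennreal_mult')
    finally have "t < ?\<mu> powr \<eta> * (\<Prod>i=1..m. 4 * a i powr (1 / b i) * \<nu> i / ?\<mu>)"
      using t by (simp add: ennreal_less_iff)
    also have "\<dots> = ?\<mu> powr (\<eta> - m) * (4 ^ m * \<Lambda> * (\<Prod>i=1..m. \<nu> i))"
      using \<mu> by (simp add: \<Lambda>_def prod.distrib prod_dividef powr_diff powr_realpow)
    also have "\<dots> \<le> (L powr (m - \<eta>) * ?\<mu>' powr (\<eta> - m)) * (4 ^ m * \<Lambda> * (\<Prod>i=1..m. \<nu> i))"
    proof (rule mult_right_mono)
      have "?\<mu>' / L \<le> ?\<mu>" using measure_Q_dilate[OF x r s] L by (simp add: L_def field_simps)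
      then have "?\<mu> powr (\<eta> - m) \<le> (?\<mu>' / L) powr (\<eta> - m)"
        using \<mu> L \<eta> by (intro powr_mono2') auto
      also have "\<dots> = L powr (m - \<eta>) * ?\<mu>' powr (\<eta> - m)"
      proof -
        have "L powr (m - \<eta>) = 1 / L powr (\<eta> - m)" using powr_minus_divide[of L "\<eta> - m"] by simp
        then show ?thesis using L \<mu> by (simp add: powr_divide)
      qed
      finally show "?\<mu> powr (\<eta> - m) \<le> L powr (m - \<eta>) * ?\<mu>' powr (\<eta> - m)" .
      have "0 \<le> (\<Prod>i=1..m. \<nu> i)" using \<nu>(1) by (intro prod_nonneg) (auto simp: less_imp_le)
      then show "0 \<le> 4 ^ m * \<Lambda> * (\<Prod>i=1..m. \<nu> i)" using \<Lambda> by simp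
    qed
    finally have "t * u < (L powr (m - \<eta>) * ?\<mu>' powr (\<eta> - m)) * (4 ^ m * \<Lambda> * (\<Prod>i=1..m. \<nu> i)) * u"
      using u by (intro mult_strict_right_mono)
    also have "\<dots> = 4 ^ m * L powr (m - \<eta>) * (?\<mu>' powr (\<eta> - m) * u * (\<Prod>i=1..m. \<nu> i)) * \<Lambda>"
      by (simp add: ac_simps)
    also have "\<dots> \<le> 4 ^ m * L powr (m - \<eta>) * enn2real (A_const M d m \<eta> P q W w) * \<Lambda>"
      using A \<Lambda> by (intro mult_right_mono mult_left_mono) auto
    also have "\<dots> \<le> K * \<Lambda>" using \<Lambda> by (intro mult_right_mono) (auto simp: K_def L_def ball_const_def)
    finally have "u < K * \<Lambda> / t" using t by (simp add: field_simps)
    then have lt: "Lp_norm M q (\<lambda>y. w y * indicator (Q x (s * r)) y) < ennreal (K * \<Lambda> / t)"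
      unfolding u(2) using u(1) by (simp add: ennreal_less_iff)
    have "(\<integral>\<^sup>+y. ennpowr (w y * indicator (Q x (s * r)) y / ennreal (K * \<Lambda> / t)) (q y) \<partial>M) \<le> 1"
    proof (rule modular_le_1[OF _ _ lt])
      show "AE y in M. 0 \<le> q y" using q_bounds q0 by (auto elim!: eventually_mono)
      show "0 < K * \<Lambda> / t" using K \<Lambda> t by simp
    qed
    also have "(\<lambda>y. ennpowr (w y * indicator (Q x (s * r)) y / ennreal (K * \<Lambda> / t)) (q y))
        = (\<lambda>y. ennpowr (ennreal (t / (K * \<Lambda>)) * w y) (q y) * indicator (Q x (s * r)) y)"
      using K \<Lambda> t
      by (auto simp: fun_eq_iff divide_ennreal_def inverse_ennreal mult.commute split: split_indicator)
    finally show ?thesis by (simp add: \<Lambda>_def K_def)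
qed

definition modular_density :: "(nat \<Rightarrow> 'a \<Rightarrow> ennreal) \<Rightarrow> nat \<Rightarrow> 'a \<Rightarrow> ennreal" where
  "modular_density F i y = ennpowr (W i y * F i y) (P i y)"

lemma modular_density_meas [measurable]:
  "i \<in> {1..m} \<Longrightarrow> F i \<in> borel_measurable M \<Longrightarrow> modular_density F i \<in> borel_measurable M"
proof -
  assume i: "i \<in> {1..m}" and [measurable]: "F i \<in> borel_measurable M"
  have [measurable]: "W i \<in> borel_measurable M" "P i \<in> borel_measurable M"
    using W_meas P_meas i by auto
  show ?thesis unfolding modular_density_def[abs_def] by measurable
qed

text \<open>Normalized inputs: the weighted modulars stand for norms at most one.\<close>

definition admissible :: "(nat \<Rightarrow> 'a \<Rightarrow> ennreal) \<Rightarrow> bool" where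
  "admissible F \<longleftrightarrow> (\<forall>i\<in>{1..m}. F i \<in> borel_measurable M \<and> (\<integral>\<^sup>+y. modular_density F i y \<partial>M) \<le> 1)"

lemma admissible_on:
  assumes "admissible F" "i \<in> {1..m}"
  shows "F i \<in> borel_measurable M" "(\<integral>\<^sup>+y\<in>B. modular_density F i y \<partial>M) \<le> 1"
proof -
  show "F i \<in> borel_measurable M" using assms by (simp add: admissible_def)
  have "(\<integral>\<^sup>+y\<in>B. modular_density F i y \<partial>M) \<le> (\<integral>\<^sup>+y. modular_density F i y \<partial>M)"
    by (intro nn_integral_mono) (auto split: split_indicator)
  also have "\<dots> \<le> 1" using assms by (simp add: admissible_def)
  finally show "(\<integral>\<^sup>+y\<in>B. modular_density F i y \<partial>M) \<le> 1" .
qed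

lemma C_P_ge_1: "1 \<le> C\<^sub>P"
  using P_ge_1[OF _ x0, of 1] P_le[OF _ x0, of 1] m by simp

text \<open>The trivial choice \<open>a i = 1\<close>; good for one ball, but not summable over many.\<close>

lemma modular_on_dilated_ball_le_1:
  assumes s: "1 \<le> s" and "x \<in> space M" "0 < r" "0 < t"
    and F: "admissible F" and "average_exceeds F t x r"
  shows "(\<integral>\<^sup>+y\<in>Q x (s * r). ennpowr (ennreal (t / ball_const s) * w y) (q y) \<partial>M) \<le> 1"
proof -
  have "(\<integral>\<^sup>+y\<in>Q x (s * r). ennpowr
      (ennreal (t / (ball_const s * (\<Prod>i=1..m. 1 powr (1 / C\<^sub>P)))) * w y) (q y) \<partial>M) \<le> 1"
    using assms admissible_on[OF F] C_P_ge_1 P_le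
    by (intro modular_on_dilated_ball[where F = F and a = "\<lambda>_. 1" and b = "\<lambda>_. C\<^sub>P"])
      (auto simp: Q_iff modular_density_def)
  then show ?thesis by simp
qed

text \<open>The summable estimate. Let \<open>\<alpha> i\<close> be the modular of \<open>W i * F i\<close> on the ball, and use \<open>modular_on_dilated_ball\<close> with \<open>a i\<close>
  the maximum of \<open>\<alpha> i\<close> and \<open>\<rho>\<^sup>N\<close>. The product \<open>\<Lambda>\<close> of the powers of the \<open>a i\<close> enters as \<open>\<Lambda>\<^sup>q\<close>, whose exponents \<open>q / b i\<close> differ from
  \<open>q / P i\<close> by a multiple of the oscillation \<open>\<delta>\<close>. As \<open>a i \<ge> \<rho>\<^sup>N\<close> and \<open>\<delta> ln (1 / \<rho>)\<close> is constant, this changes \<open>\<Lambda>\<^sup>q\<close> by a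
  bounded factor; as the \<open>q / P i\<close> add up to at least one, what remains is at most \<open>\<Sum> a i\<close>. The terms \<open>\<rho>\<^sup>N\<close> are
  paid for by \<open>decay x0\<close>.\<close>

lemma modular_on_far_ball:
  obtains E where "0 < E"
    "\<And>F t x r. x \<in> space M \<Longrightarrow> 0 < r \<Longrightarrow> 0 < t \<Longrightarrow> admissible F \<Longrightarrow> average_exceeds F t x r \<Longrightarrow>
      far x0 x r \<Longrightarrow>
      (\<integral>\<^sup>+y\<in>Q x (\<theta> * r). ennpowr (ennreal (t / ball_const \<theta>) * w y) (q y) \<partial>M)
        \<le> ennreal E * (\<integral>\<^sup>+y\<in>Q x r. (\<Sum>i=1..m. modular_density F i y) + decay x0 y \<partial>M)"
proof -
  define K where "K = ball_const \<theta>"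
  have K: "0 < K" unfolding K_def by (rule ball_const_pos)
  obtain c where c: "0 < c" "\<And>x r. x \<in> space M \<Longrightarrow> 0 < r \<Longrightarrow> far x0 x r \<Longrightarrow>
      ennreal (\<rho> x0 x r ^ (3 * D + 1)) \<le> ennreal c * (\<integral>\<^sup>+y\<in>Q x r. decay x0 y \<partial>M)"
    using rho_power_le_decay[OF x0] by blast
  define N where "N = 3 * D + 1"
  define e where "e = exp (2 * real N * q\<^sub>1 * C\<^sub>P)"
  have e: "0 < e" by (simp add: e_def)
  define E where "E = e ^ m * max 1 (m * c)"
  have E: "0 < E" using e by (simp add: E_def)
  show ?thesis
  proof (rule that[OF E])
    fix F t x r
    assume x: "x \<in> space M" and r: "0 < r" and t: "0 < t" and F: "admissible F"
      and ex: "average_exceeds F t x r" and far: "far x0 x r"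
    have \<theta>r: "0 < \<theta> * r" using r theta_ge_1 by simp
    have [measurable]: "Q x r \<in> sets M" "Q x (\<theta> * r) \<in> sets M" using x r \<theta>r by measurable
    have sub: "Q x r \<subseteq> Q x (\<theta> * r)" using r theta_ge_1 by (intro Q_mono) simp
    have xin: "x \<in> Q x (\<theta> * r)" using x \<theta>r by (rule centre_in_Q)
    let ?\<rho> = "\<rho> x0 x r"
    have rho: "0 < ?\<rho>" "?\<rho> \<le> 1" "1 \<le> ln (1 / ?\<rho>)"
      using rho_pos[OF x0 x r] rho_le_1[OF x0 x r] ln_rho[OF x0 x r] by auto
    have lnp: "0 < ln (1 / ?\<rho>)" using rho by linarith
    define \<delta> where "\<delta> = C\<^sub>P / ln (1 / ?\<rho>)"
    have \<delta>: "0 \<le> \<delta>" "\<delta> * ln (1 / ?\<rho>) = C\<^sub>P" using C_P_ge_1 rho by (auto simp: \<delta>_def)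
    have osc: "\<bar>P i y - P i x\<bar> \<le> \<delta>" if "i \<in> {1..m}" "y \<in> Q x (\<theta> * r)" for i y
      unfolding \<delta>_def using P_osc[OF that(1) x r far that(2) xin] lnp by (subst pos_le_divide_eq) auto
    define \<alpha> where "\<alpha> i = enn2real (\<integral>\<^sup>+y\<in>Q x r. modular_density F i y \<partial>M)" for i
    have \<alpha>: "(\<integral>\<^sup>+y\<in>Q x r. modular_density F i y \<partial>M) = ennreal (\<alpha> i)" "0 \<le> \<alpha> i" "\<alpha> i \<le> 1" if "i \<in> {1..m}" for i
    proof -
      have le: "(\<integral>\<^sup>+y\<in>Q x r. modular_density F i y \<partial>M) \<le> 1" by (rule admissible_on(2)[OF F that])
      then have "(\<integral>\<^sup>+y\<in>Q x r. modular_density F i y \<partial>M) < \<infinity>" by (rule order_le_less_trans) simp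
      then show *: "(\<integral>\<^sup>+y\<in>Q x r. modular_density F i y \<partial>M) = ennreal (\<alpha> i)" by (simp add: \<alpha>_def)
      show "0 \<le> \<alpha> i" by (simp add: \<alpha>_def)
      show "\<alpha> i \<le> 1" using le unfolding * by simp
    qed
    define a where "a i = max (\<alpha> i) (?\<rho> ^ N)" for i
    \<comment> \<open>An upper bound for \<open>P i\<close> on the ball that exceeds its values there and on the dilate by at most \<open>2 \<delta>\<close>.\<close>
    define b where "b i = P i x + \<delta>" for i
    have a: "0 < a i" "a i \<le> 1" if "i \<in> {1..m}" for i
      using \<alpha>[OF that] rho by (auto simp: a_def less_max_iff_disj power_le_one)
    have b: "1 \<le> b i" if "i \<in> {1..m}" for i using P_ge_1[OF that x] \<delta> by (simp add: b_def)
    define \<Lambda> where "\<Lambda> = (\<Prod>i=1..m. a i powr (1 / b i))"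
    have \<Lambda>: "0 < \<Lambda>"
      unfolding \<Lambda>_def
    proof (rule prod_pos)
      fix i assume "i \<in> {1..m}"
      from a[OF this] show "0 < a i powr (1 / b i)" by simp
    qed
    have int: "(\<integral>\<^sup>+y\<in>Q x (\<theta> * r). ennpowr (ennreal (t / (K * \<Lambda>)) * w y) (q y) \<partial>M) \<le> 1"
      unfolding \<Lambda>_def K_def
    proof (rule modular_on_dilated_ball[where F = F, OF theta_ge_1 x r t ex])
      fix i assume i: "i \<in> {1..m}"
      show "F i \<in> borel_measurable M" by (rule admissible_on(1)[OF F i])
      show "0 < a i" "a i \<le> 1" using a[OF i] by auto
      show "0 < b i" using b[OF i] by simp
      show "(\<integral>\<^sup>+y\<in>Q x r. ennpowr (W i y * F i y) (P i y) \<partial>M) \<le> ennreal (a i)"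
        using \<alpha>(1)[OF i] unfolding modular_density_def by (simp add: a_def ennreal_leI)
      show "P i y \<le> b i" if "y \<in> Q x r" for y
        using osc[OF i subsetD[OF sub that]] by (simp add: b_def)
    qed
    have pt: "\<Lambda> powr q y \<le> e ^ m * (\<Sum>i=1..m. a i)"
      if y: "y \<in> Q x (\<theta> * r)" and qy: "0 < q y" "q y \<le> q\<^sub>1" for y
    proof -
      have yX: "y \<in> space M" using y by (simp add: Q_iff)
      have one: "(a i powr (1 / b i)) powr q y \<le> e * a i powr (q y / P i y)" if i: "i \<in> {1..m}" for i
      proof -
        have Py: "1 \<le> P i y" by (rule P_ge_1[OF i yX])
        have bP: "b i \<le> P i y + 2 * \<delta>" using osc[OF i y] by (simp add: b_def)
        have "q y / P i y - q y / b i = q y * (b i - P i y) / (P i y * b i)"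
          using Py b[OF i] by (simp add: field_simps)
        also have "\<dots> \<le> q y * (2 * \<delta>) / (P i y * b i)"
          using bP qy Py b[OF i] by (intro divide_right_mono mult_left_mono) auto
        also have "\<dots> \<le> q y * (2 * \<delta>) / 1"
          using mult_mono[OF Py b[OF i]] qy \<delta> Py by (intro divide_left_mono) auto
        also have "\<dots> \<le> 2 * q\<^sub>1 * \<delta>" using mult_right_mono[OF qy(2) \<delta>(1)] by simp
        finally have ge: "q y / P i y + - (2 * q\<^sub>1 * \<delta>) \<le> q y / b i" by simp
        have "(a i powr (1 / b i)) powr q y = a i powr (q y / b i)" by (simp add: powr_powr)
        also have "\<dots> \<le> a i powr (q y / P i y + - (2 * q\<^sub>1 * \<delta>))"
          using a[OF i] by (intro powr_mono' ge) auto
        also have "\<dots> = a i powr (q y / P i y) * a i powr - (2 * q\<^sub>1 * \<delta>)" by (rule powr_add)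
        also have "\<dots> \<le> a i powr (q y / P i y) * (?\<rho> ^ N) powr - (2 * q\<^sub>1 * \<delta>)"
          using rho qy \<delta> by (intro mult_left_mono powr_mono2') (auto simp: a_def)
        also have "(?\<rho> ^ N) powr - (2 * q\<^sub>1 * \<delta>) = exp (2 * q\<^sub>1 * N * (\<delta> * ln (1 / ?\<rho>)))"
          using rho by (simp add: powr_def ln_realpow ln_div)
        also have "\<dots> = e" unfolding \<delta>(2) by (simp add: e_def ac_simps)
        finally show ?thesis by (simp add: mult.commute)
      qed
      have "\<Lambda> powr q y = (\<Prod>i=1..m. (a i powr (1 / b i)) powr q y)"
        unfolding \<Lambda>_def by (rule prod_powr_distrib)
      also have "\<dots> \<le> (\<Prod>i=1..m. e * a i powr (q y / P i y))"
        using one by (intro prod_mono) auto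
      also have "\<dots> = e ^ m * (\<Prod>i=1..m. a i powr (q y / P i y))" by (simp add: prod.distrib)
      also have "\<dots> \<le> e ^ m * (\<Sum>i=1..m. a i)"
      proof (intro mult_left_mono prod_powr_le_sum)
        show "1 \<le> (\<Sum>i=1..m. q y / P i y)" by (rule q_P[OF yX])
        show "0 \<le> q y / P i y" if "i \<in> {1..m}" for i using P_ge_1[OF that yX] qy by simp
      qed (use a m e in auto)
      finally show ?thesis .
    qed
    have nn: "0 \<le> (\<Sum>i=1..m. a i)" using a by (intro sum_nonneg) (auto intro: less_imp_le)
    have "(\<integral>\<^sup>+y\<in>Q x (\<theta> * r). ennpowr (ennreal (t / K) * w y) (q y) \<partial>M)
      \<le> (\<integral>\<^sup>+y. ennreal (e ^ m * (\<Sum>i=1..m. a i)) *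
          (ennpowr (ennreal (t / (K * \<Lambda>)) * w y) (q y) * indicator (Q x (\<theta> * r)) y) \<partial>M)"
    proof (rule nn_integral_mono_AE)
      show "AE y in M. ennpowr (ennreal (t / K) * w y) (q y) * indicator (Q x (\<theta> * r)) y
        \<le> ennreal (e ^ m * (\<Sum>i=1..m. a i)) *
          (ennpowr (ennreal (t / (K * \<Lambda>)) * w y) (q y) * indicator (Q x (\<theta> * r)) y)"
        using q_bounds
      proof eventually_elim
        case (elim y)
        show ?case
        proof (cases "y \<in> Q x (\<theta> * r)")
          case True
          have "ennreal (t / K) * w y = ennreal \<Lambda> * (ennreal (t / (K * \<Lambda>)) * w y)"
            using \<Lambda> K t by (simp add: mult.assoc[symmetric] flip: ennreal_mult)
          then have "ennpowr (ennreal (t / K) * w y) (q y)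
              = ennreal (\<Lambda> powr q y) * ennpowr (ennreal (t / (K * \<Lambda>)) * w y) (q y)"
            by (simp only: ennpowr_mult_real[OF \<Lambda>])
          also have "\<dots> \<le> ennreal (e ^ m * (\<Sum>i=1..m. a i)) * ennpowr (ennreal (t / (K * \<Lambda>)) * w y) (q y)"
            using pt[OF True] elim q0 by (intro mult_right_mono ennreal_leI) auto
          finally show ?thesis using True by simp
        qed simp
      qed
    qed
    also have "\<dots> = ennreal (e ^ m * (\<Sum>i=1..m. a i)) *
        (\<integral>\<^sup>+y\<in>Q x (\<theta> * r). ennpowr (ennreal (t / (K * \<Lambda>)) * w y) (q y) \<partial>M)"
      by (rule nn_integral_cmult) measurable
    also have "\<dots> \<le> ennreal (e ^ m * (\<Sum>i=1..m. a i)) * 1" by (rule mult_left_mono[OF int]) simp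
    also have "\<dots> = ennreal (e ^ m) * ennreal (\<Sum>i=1..m. a i)" using e nn by (simp add: ennreal_mult)
    also have "ennreal (\<Sum>i=1..m. a i) \<le> ennreal ((\<Sum>i=1..m. \<alpha> i) + m * ?\<rho> ^ N)"
    proof (rule ennreal_leI)
      have "(\<Sum>i=1..m. a i) \<le> (\<Sum>i=1..m. \<alpha> i + ?\<rho> ^ N)"
        using \<alpha> rho by (intro sum_mono) (auto simp: a_def)
      then show "(\<Sum>i=1..m. a i) \<le> (\<Sum>i=1..m. \<alpha> i) + m * ?\<rho> ^ N" by (simp add: sum.distrib)
    qed
    also have "ennreal ((\<Sum>i=1..m. \<alpha> i) + m * ?\<rho> ^ N) = (\<Sum>i=1..m. ennreal (\<alpha> i)) + ennreal m * ennreal (?\<rho> ^ N)"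
    proof -
      have "(\<Sum>i=1..m. ennreal (\<alpha> i)) = ennreal (\<Sum>i=1..m. \<alpha> i)" using \<alpha>(2) by (intro sum_ennreal)
      moreover have "0 \<le> (\<Sum>i=1..m. \<alpha> i)" using \<alpha>(2) by (rule sum_nonneg)
      ultimately show ?thesis using rho by (simp flip: ennreal_plus ennreal_mult)
    qed
    also have "\<dots> \<le> (\<Sum>i=1..m. ennreal (\<alpha> i)) + ennreal m * (ennreal c * (\<integral>\<^sup>+y\<in>Q x r. decay x0 y \<partial>M))"
      unfolding N_def by (intro add_left_mono mult_left_mono c(2)[OF x r far]) simp
    also have "\<dots> = (\<Sum>i=1..m. ennreal (\<alpha> i)) + ennreal (m * c) * (\<integral>\<^sup>+y\<in>Q x r. decay x0 y \<partial>M)"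
      using c by (simp add: ennreal_mult mult.assoc)
    also have "\<dots> \<le> ennreal (max 1 (m * c)) * (\<Sum>i=1..m. ennreal (\<alpha> i)) + ennreal (max 1 (m * c)) * (\<integral>\<^sup>+y\<in>Q x r. decay x0 y \<partial>M)"
    proof (intro add_mono mult_right_mono ennreal_leI)
      have "1 * (\<Sum>i=1..m. ennreal (\<alpha> i)) \<le> ennreal (max 1 (m * c)) * (\<Sum>i=1..m. ennreal (\<alpha> i))"
        by (intro mult_right_mono) (simp_all add: ennreal_1[symmetric] ennreal_leI del: ennreal_1)
      then show "(\<Sum>i=1..m. ennreal (\<alpha> i)) \<le> ennreal (max 1 (m * c)) * (\<Sum>i=1..m. ennreal (\<alpha> i))" by simp
    qed auto
    also have "\<dots> = ennreal (max 1 (m * c)) * ((\<Sum>i=1..m. \<integral>\<^sup>+y\<in>Q x r. modular_density F i y \<partial>M) + (\<integral>\<^sup>+y\<in>Q x r. decay x0 y \<partial>M))"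
      using \<alpha>(1) by (simp add: distrib_left)
    also have "(\<Sum>i=1..m. \<integral>\<^sup>+y\<in>Q x r. modular_density F i y \<partial>M) + (\<integral>\<^sup>+y\<in>Q x r. decay x0 y \<partial>M)
      = (\<integral>\<^sup>+y\<in>Q x r. (\<Sum>i=1..m. modular_density F i y) + decay x0 y \<partial>M)"
    proof -
      have md: "modular_density F i \<in> borel_measurable M" if "i \<in> {1..m}" for i
        using that admissible_on(1)[OF F that] by (rule modular_density_meas)
      have dm: "decay x0 \<in> borel_measurable M" by (rule decay_measurable[OF x0])
      have "(\<integral>\<^sup>+y\<in>Q x r. (\<Sum>i=1..m. modular_density F i y) + decay x0 y \<partial>M)
        = (\<integral>\<^sup>+y. (\<Sum>i=1..m. modular_density F i y * indicator (Q x r) y) + decay x0 y * indicator (Q x r) y \<partial>M)"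
        by (simp add: distrib_right sum_distrib_right)
      also have "\<dots> = (\<integral>\<^sup>+y. (\<Sum>i=1..m. modular_density F i y * indicator (Q x r) y) \<partial>M) + (\<integral>\<^sup>+y\<in>Q x r. decay x0 y \<partial>M)"
        using md dm by (intro nn_integral_add borel_measurable_sum borel_measurable_times_ennreal borel_measurable_indicator) auto
      also have "(\<integral>\<^sup>+y. (\<Sum>i=1..m. modular_density F i y * indicator (Q x r) y) \<partial>M) = (\<Sum>i=1..m. \<integral>\<^sup>+y\<in>Q x r. modular_density F i y \<partial>M)"
        using md by (intro nn_integral_sum borel_measurable_times_ennreal borel_measurable_indicator) auto
      finally show ?thesis by simp
    qed
    finally show "(\<integral>\<^sup>+y\<in>Q x (\<theta> * r). ennpowr (ennreal (t / ball_const \<theta>) * w y) (q y) \<partial>M)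
        \<le> ennreal E * (\<integral>\<^sup>+y\<in>Q x r. (\<Sum>i=1..m. modular_density F i y) + decay x0 y \<partial>M)"
      using e by (simp add: E_def K_def ennreal_mult mult.assoc mult_left_mono)
  qed
qed

section \<open>Covering the level sets\<close>

definition exceeding :: "(nat \<Rightarrow> 'a \<Rightarrow> ennreal) \<Rightarrow> real \<Rightarrow> real \<Rightarrow> ('a \<times> real) set" where
  "exceeding F t R = {(x, r). x \<in> space M \<and> 0 < r \<and> r \<le> R \<and> average_exceeds F t x r}"

text \<open>Dilating a near ball by this factor engulfs the hulls of all near balls of at most twice its radius.\<close>

definition near_dilation :: real where
  "near_dilation = A * (2 * A * \<theta> + A * (4 * A * \<theta> + 4 * A))"

lemma near_dilation_ge_1: "1 \<le> near_dilation"
proof -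
  have "1 \<le> A * \<theta>" using mult_mono[OF A_ge_1 theta_ge_1] A_ge_1 by simp
  moreover have "0 \<le> A * (4 * A * \<theta> + 4 * A)" using A_ge_1 theta_ge_1 by simp
  ultimately have "1 \<le> 2 * A * \<theta> + A * (4 * A * \<theta> + 4 * A)" by linarith
  then show ?thesis unfolding near_dilation_def using mult_mono[OF A_ge_1, of 1] A_ge_1 by fastforce
qed

lemma near_hull_subset:
  assumes x: "x \<in> space M" "0 < r" "\<not> far x0 x r" and x': "x' \<in> space M" "\<not> far x0 x' r'" and rr': "r \<le> 2 * r'"
  shows "open_hull x r \<subseteq> Q x' (near_dilation * r')"
proof
  fix z assume "z \<in> open_hull x r"
  then have z: "z \<in> space M" "d x z < 2 * A * r" using open_hull_subset[OF x(1,2)] by (auto simp: Q_iff)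
  let ?k = "2 * A * \<theta>"
  have k: "0 < ?k" using A_ge_1 theta_ge_1 by simp
  have dx: "d x x0 < ?k * r" "d x' x0 < ?k * r'" using x x' by (auto simp: far_def)
  have "d x0 z \<le> A * (d x0 x + d x z)" using x0 x z by (intro quasi)
  also have "\<dots> \<le> A * (?k * r + 2 * A * r)"
    using dx z A_ge_1 sym[OF x0 x(1)] by (intro mult_left_mono) auto
  also have "\<dots> \<le> A * (?k * (2 * r') + 2 * A * (2 * r'))"
    using rr' A_ge_1 k by (intro mult_left_mono add_mono) auto
  finally have 1: "d x0 z \<le> A * (?k * (2 * r') + 2 * A * (2 * r'))" .
  have "d x' z \<le> A * (d x' x0 + d x0 z)" using x0 x' z by (intro quasi)
  also have "\<dots> < A * (?k * r' + A * (?k * (2 * r') + 2 * A * (2 * r')))"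
    using A_ge_1 dx 1 by (intro mult_strict_left_mono) auto
  also have "\<dots> = near_dilation * r'" by (simp add: near_dilation_def algebra_simps)
  finally show "z \<in> Q x' (near_dilation * r')" using z by (simp add: Q_iff)
qed

definition K\<^sub>0 :: real where "K\<^sub>0 = max (ball_const \<theta>) (ball_const near_dilation)"

lemma K0_pos: "0 < K\<^sub>0"
  unfolding K\<^sub>0_def using ball_const_pos by (simp add: less_max_iff_disj)

text \<open>The hulls of all near balls lie in a fixed dilate of one near ball of almost largest radius, where the trivial estimate
  applies. The far balls are covered by dilates of disjoint ones, over which the summable estimate is added up. The
  bound \<open>R\<close> on the radii makes both choices possible and does not enter the constant.\<close>

lemma modular_on_union_of_hulls:
  obtains C where "1 \<le> C"
    "\<And>F t R. 0 < t \<Longrightarrow> admissible F \<Longrightarrow>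
      (\<integral>\<^sup>+y\<in>(\<Union>(x, r)\<in>exceeding F t R. open_hull x r). ennpowr (ennreal (t / K\<^sub>0) * w y) (q y) \<partial>M) \<le> ennreal C"
proof -
  obtain E where E: "0 < E" "\<And>F t x r. x \<in> space M \<Longrightarrow> 0 < r \<Longrightarrow> 0 < t \<Longrightarrow> admissible F \<Longrightarrow> average_exceeds F t x r \<Longrightarrow>
      far x0 x r \<Longrightarrow>
      (\<integral>\<^sup>+y\<in>Q x (\<theta> * r). ennpowr (ennreal (t / ball_const \<theta>) * w y) (q y) \<partial>M)
        \<le> ennreal E * (\<integral>\<^sup>+y\<in>Q x r. (\<Sum>i=1..m. modular_density F i y) + decay x0 y \<partial>M)"
    using modular_on_far_ball by blast
  have [measurable]: "decay x0 \<in> borel_measurable M" by (rule decay_measurable[OF x0])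
  define I where "I = enn2real (\<integral>\<^sup>+y. decay x0 y \<partial>M)"
  have I: "(\<integral>\<^sup>+y. decay x0 y \<partial>M) = ennreal I" "0 \<le> I" using decay_integrable[OF x0] by (auto simp: I_def)
  define C where "C = 1 + E * (m + I)"
  have C: "1 \<le> C" using E I by (simp add: C_def)
  show ?thesis
  proof (rule that[OF C])
    fix F and t R :: real assume t: "0 < t" and F: "admissible F"
    define \<Phi> where "\<Phi> y = ennpowr (ennreal (t / K\<^sub>0) * w y) (q y)" for y
    have [measurable]: "\<Phi> \<in> borel_measurable M" unfolding \<Phi>_def[abs_def] by measurable
    define \<Psi> where "\<Psi> y = ennreal E * ((\<Sum>i=1..m. modular_density F i y) + decay x0 y)" for y
    have md: "modular_density F i \<in> borel_measurable M" if "i \<in> {1..m}" for i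
      using that admissible_on(1)[OF F] by (intro modular_density_meas)
    have sum_meas [measurable]: "(\<lambda>y. \<Sum>i=1..m. modular_density F i y) \<in> borel_measurable M"
      using md by (rule borel_measurable_sum)
    have [measurable]: "\<Psi> \<in> borel_measurable M" unfolding \<Psi>_def[abs_def] by measurable
    have \<Phi>_le: "(\<integral>\<^sup>+y\<in>B. \<Phi> y \<partial>M) \<le> (\<integral>\<^sup>+y\<in>B. ennpowr (ennreal (t / K) * w y) (q y) \<partial>M)"
      if K: "0 < K" "K \<le> K\<^sub>0" for K B
    proof (rule nn_integral_mono_AE)
      have "t / K\<^sub>0 \<le> t / K" using K t by (intro divide_left_mono) auto
      then show "AE y in M. \<Phi> y * indicator B y \<le> ennpowr (ennreal (t / K) * w y) (q y) * indicator B y"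
        using q_bounds
        by (auto elim!: eventually_mono simp: \<Phi>_def intro!: mult_right_mono ennpowr_mono ennreal_leI
            order_trans[OF less_imp_le[OF q0]])
    qed
    define Near where "Near = {(x, r) \<in> exceeding F t R. \<not> far x0 x r}"
    define Far where "Far = {(x, r) \<in> exceeding F t R. far x0 x r}"
    have Near: "x \<in> space M" "0 < r" "r \<le> R" "average_exceeds F t x r" "\<not> far x0 x r" if "(x, r) \<in> Near" for x r
      using that by (auto simp: Near_def exceeding_def)
    have Far: "x \<in> space M" "0 < r" "r \<le> R" "average_exceeds F t x r" "far x0 x r" if "(x, r) \<in> Far" for x r
      using that by (auto simp: Far_def exceeding_def)
    have near: "\<exists>U\<in>sets M. (\<Union>(x, r)\<in>Near. open_hull x r) \<subseteq> U \<and> (\<integral>\<^sup>+y\<in>U. \<Phi> y \<partial>M) \<le> 1"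
    proof (cases "Near = {}")
      case False
      have bdd: "bdd_above (snd ` Near)" using Near by (auto intro!: bdd_aboveI[of _ R])
      define S where "S = Sup (snd ` Near)"
      obtain xr where xr: "xr \<in> Near" using False by blast
      have "snd xr \<le> S" unfolding S_def using xr bdd by (intro cSup_upper) auto
      then have "0 < S" using Near[of "fst xr" "snd xr"] xr by simp
      then have "S / 2 < Sup (snd ` Near)" by (simp add: S_def)
      then obtain x' r' where x'r': "(x', r') \<in> Near" "S / 2 < r'"
        using less_cSup_iff[of "snd ` Near" "S / 2"] False bdd by auto
      note B' = Near[OF x'r'(1)]
      show ?thesis
      proof (intro bexI conjI)
        show "(\<Union>(x, r)\<in>Near. open_hull x r) \<subseteq> Q x' (near_dilation * r')"
        proof (rule UN_least, clarify)
          fix x r z assume xr: "(x, r) \<in> Near" and z: "z \<in> open_hull x r"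
          have "r \<le> S" unfolding S_def using bdd imageI[OF xr, of snd] by (intro cSup_upper) auto
          then have "r \<le> 2 * r'" using x'r' by simp
          from subsetD[OF near_hull_subset[OF Near(1,2,5)[OF xr] B'(1,5) this] z]
          show "z \<in> Q x' (near_dilation * r')" .
        qed
        show "Q x' (near_dilation * r') \<in> sets M"
          using B' near_dilation_ge_1 by (intro Q_sets) auto
        have "(\<integral>\<^sup>+y\<in>Q x' (near_dilation * r'). \<Phi> y \<partial>M)
          \<le> (\<integral>\<^sup>+y\<in>Q x' (near_dilation * r'). ennpowr (ennreal (t / ball_const near_dilation) * w y) (q y) \<partial>M)"
          by (rule \<Phi>_le) (auto simp: ball_const_pos K\<^sub>0_def)
        also have "\<dots> \<le> 1" using B' t F by (intro modular_on_dilated_ball_le_1 near_dilation_ge_1)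
        finally show "(\<integral>\<^sup>+y\<in>Q x' (near_dilation * r'). \<Phi> y \<partial>M) \<le> 1" .
      qed
    qed (auto intro!: bexI[of _ "{}"])
    then obtain U where U: "U \<in> sets M" "(\<Union>(x, r)\<in>Near. open_hull x r) \<subseteq> U" "(\<integral>\<^sup>+y\<in>U. \<Phi> y \<partial>M) \<le> 1" by blast
    define V where "V = (\<lambda>(x, r). Q x r)"
    define V' where "V' = (\<lambda>(x, r). Q x (\<theta> * r))"
    obtain S where S: "S \<subseteq> Far" "disjoint_family_on V S"
      "\<And>i. i \<in> Far \<Longrightarrow> \<exists>j\<in>S. V i \<inter> V j \<noteq> {} \<and> snd i \<le> 2 * snd j"
    proof (rule Vitali_selection[of Far snd R V])
      show "0 < snd i \<and> snd i \<le> R" if "i \<in> Far" for i using Far[of "fst i" "snd i"] that by simp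
      show "V i \<noteq> {}" if "i \<in> Far" for i
        using Far[of "fst i" "snd i"] that centre_in_Q[of "fst i" "snd i"] by (auto simp: V_def split_beta)
    qed blast
    have V_sets: "V i \<in> sets M" "V' i \<in> sets M" if "i \<in> S" for i
      using that S(1) Far[of "fst i" "snd i"] theta_ge_1 by (auto simp: V_def V'_def split_beta intro!: Q_sets)
    have "countable S"
    proof (rule countable_disjoint_positive[where N = "density M (decay x0)" and V = V])
      show "emeasure (density M (decay x0)) (space (density M (decay x0))) < \<infinity>"
        using I by (simp add: emeasure_density cong: nn_integral_cong)
      show "V i \<in> sets (density M (decay x0))" if "i \<in> S" for i using V_sets[OF that] by simp
      show "0 < emeasure (density M (decay x0)) (V i)" if i: "i \<in> S" for i
      proof -
        obtain x r where xr: "i = (x, r)" by force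
        then have *: "x \<in> space M" "0 < r" "far x0 x r" using S(1) i Far[of x r] by auto
        obtain c where c: "0 < c" "ennreal (\<rho> x0 x r ^ (3 * D + 1)) \<le> ennreal c * (\<integral>\<^sup>+y\<in>Q x r. decay x0 y \<partial>M)"
          using rho_power_le_decay[OF x0] * by metis
        have "0 < \<rho> x0 x r ^ (3 * D + 1)" using rho_pos[OF x0 *(1,2)] by simp
        then have "0 < ennreal (\<rho> x0 x r ^ (3 * D + 1))" unfolding ennreal_less_zero_iff .
        then have "0 < ennreal c * (\<integral>\<^sup>+y\<in>Q x r. decay x0 y \<partial>M)" using c(2) by (rule order_less_le_trans)
        then show ?thesis using V_sets[OF i] xr by (auto simp: emeasure_density V_def zero_less_iff_neq_zero)
      qed
    qed (rule S(2))
    have "emeasure (density M \<Phi>) (\<Union>i\<in>S. V' i) \<le> emeasure (density M \<Psi>) (space (density M \<Psi>))"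
    proof (rule emeasure_UN_le_disjoint[OF \<open>countable S\<close>])
      show "disjoint_family_on V S" by (rule S(2))
      fix i assume i: "i \<in> S"
      show "V i \<in> sets (density M \<Psi>)" "V' i \<in> sets (density M \<Phi>)" using V_sets[OF i] by auto
      obtain x r where xr: "i = (x, r)" by force
      then have *: "x \<in> space M" "0 < r" "average_exceeds F t x r" "far x0 x r" using S(1) i Far[of x r] by auto
      have "(\<integral>\<^sup>+y\<in>Q x (\<theta> * r). \<Phi> y \<partial>M) \<le> (\<integral>\<^sup>+y\<in>Q x (\<theta> * r). ennpowr (ennreal (t / ball_const \<theta>) * w y) (q y) \<partial>M)"
        by (rule \<Phi>_le) (auto simp: ball_const_pos K\<^sub>0_def)
      also have "\<dots> \<le> ennreal E * (\<integral>\<^sup>+y\<in>Q x r. (\<Sum>i=1..m. modular_density F i y) + decay x0 y \<partial>M)"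
        by (rule E(2)[OF *(1,2) t F *(3,4)])
      also have "\<dots> = (\<integral>\<^sup>+y\<in>Q x r. \<Psi> y \<partial>M)"
      proof -
        have [measurable]: "Q x r \<in> sets M" using * by (intro Q_sets)
        have "(\<lambda>y. ((\<Sum>i=1..m. modular_density F i y) + decay x0 y) * indicator (Q x r) y) \<in> borel_measurable M"
          by measurable
        then show ?thesis unfolding \<Psi>_def mult.assoc by (rule nn_integral_cmult[symmetric])
      qed
      finally show "emeasure (density M \<Phi>) (V' i) \<le> emeasure (density M \<Psi>) (V i)"
        using V_sets[OF i] xr by (simp add: emeasure_density V_def V'_def)
    qed
    also have "\<dots> = (\<integral>\<^sup>+y. \<Psi> y \<partial>M)" by (simp add: emeasure_density cong: nn_integral_cong)
    also have "\<dots> = ennreal E * ((\<Sum>i=1..m. \<integral>\<^sup>+y. modular_density F i y \<partial>M) + (\<integral>\<^sup>+y. decay x0 y \<partial>M))"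
    proof -
      have "(\<integral>\<^sup>+y. (\<Sum>i=1..m. modular_density F i y) \<partial>M) = (\<Sum>i=1..m. \<integral>\<^sup>+y. modular_density F i y \<partial>M)"
        using md by (rule nn_integral_sum)
      moreover have "(\<integral>\<^sup>+y. \<Psi> y \<partial>M) = ennreal E * (\<integral>\<^sup>+y. (\<Sum>i=1..m. modular_density F i y) + decay x0 y \<partial>M)"
        unfolding \<Psi>_def by (rule nn_integral_cmult) measurable
      moreover have "(\<integral>\<^sup>+y. (\<Sum>i=1..m. modular_density F i y) + decay x0 y \<partial>M)
          = (\<integral>\<^sup>+y. (\<Sum>i=1..m. modular_density F i y) \<partial>M) + (\<integral>\<^sup>+y. decay x0 y \<partial>M)"
        by (rule nn_integral_add) measurable
      ultimately show ?thesis by simp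
    qed
    also have "\<dots> \<le> ennreal E * (ennreal m + ennreal I)"
    proof (intro mult_left_mono add_mono)
      have "(\<Sum>i=1..m. \<integral>\<^sup>+y. modular_density F i y \<partial>M) \<le> (\<Sum>i=1..m. 1)"
        using F by (intro sum_mono) (auto simp: admissible_def)
      then show "(\<Sum>i=1..m. \<integral>\<^sup>+y. modular_density F i y \<partial>M) \<le> ennreal m"
        by (simp add: ennreal_of_nat_eq_real_of_nat)
    qed (use I in auto)
    also have "\<dots> = ennreal (E * (m + I))" using E I by (simp add: ennreal_mult)
    finally have far: "emeasure (density M \<Phi>) (\<Union>i\<in>S. V' i) \<le> ennreal (E * (m + I))" .
    have UN_sets: "(\<Union>i\<in>S. V' i) \<in> sets M" using \<open>countable S\<close> V_sets by (intro sets.countable_UN') auto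
    have cover: "(\<Union>(x, r)\<in>exceeding F t R. open_hull x r) \<subseteq> U \<union> (\<Union>i\<in>S. V' i)"
    proof (rule UN_least, clarify)
      fix x r z assume xr: "(x, r) \<in> exceeding F t R" and z: "z \<in> open_hull x r" and no: "z \<notin> (\<Union>i\<in>S. V' i)"
      show "z \<in> U"
      proof (cases "far x0 x r")
        case False
        then show ?thesis using xr z U(2) by (auto simp: Near_def)
      next
        case True
        then have xrF: "(x, r) \<in> Far" using xr by (auto simp: Far_def)
        obtain y s where ys: "(y, s) \<in> S" "Q x r \<inter> Q y s \<noteq> {}" "r \<le> 2 * s"
        proof -
          obtain j where "j \<in> S" "V (x, r) \<inter> V j \<noteq> {}" "snd (x, r) \<le> 2 * snd j" using S(3)[OF xrF] by blast
          then show ?thesis using that[of "fst j" "snd j"] by (simp add: V_def split_beta)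
        qed
        have "y \<in> space M" using ys S(1) Far by blast
        then have "open_hull x r \<subseteq> Q y (7 * A ^ 3 * s)"
          using Far[OF xrF] ys by (intro open_hull_subset_larger_ball)
        then have "z \<in> V' (y, s)" using z by (auto simp: V'_def \<theta>_def)
        with ys no show ?thesis by blast
      qed
    qed
    have "(\<integral>\<^sup>+y\<in>(\<Union>(x, r)\<in>exceeding F t R. open_hull x r). \<Phi> y \<partial>M)
      \<le> (\<integral>\<^sup>+y. \<Phi> y * indicator U y + \<Phi> y * indicator (\<Union>i\<in>S. V' i) y \<partial>M)"
      using cover by (intro nn_integral_mono) (auto split: split_indicator)
    also have "\<dots> = (\<integral>\<^sup>+y\<in>U. \<Phi> y \<partial>M) + (\<integral>\<^sup>+y\<in>(\<Union>i\<in>S. V' i). \<Phi> y \<partial>M)"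
      using U UN_sets by (intro nn_integral_add) auto
    also have "\<dots> \<le> 1 + ennreal (E * (m + I))"
      using U(3) far UN_sets by (intro add_mono) (auto simp: emeasure_density)
    also have "\<dots> = ennreal C" using E I by (simp add: C_def flip: ennreal_1 ennreal_plus)
    finally show "(\<integral>\<^sup>+y\<in>(\<Union>(x, r)\<in>exceeding F t R. open_hull x r). ennpowr (ennreal (t / K\<^sub>0) * w y) (q y) \<partial>M) \<le> ennreal C"
      by (simp add: \<Phi>_def)
  qed
qed

text \<open>Monotone convergence in the bound on the radii. A level set \<open>E\<close> of the maximal function enters
  only through the measurable union of the open hulls that contains it. Enlarging the constant by
  \<open>C\<^sup>1\<^sup>/\<^sup>q\<^sup>0\<close> turns the bound \<open>C\<close> on the modular into one.\<close>

lemma weak_type_modular: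
  obtains K where "0 < K"
    "\<And>F t E. 0 < t \<Longrightarrow> admissible F \<Longrightarrow>
      (\<And>y. y \<in> E \<Longrightarrow> \<exists>x r. x \<in> space M \<and> 0 < r \<and> y \<in> Q x r \<and> average_exceeds F t x r) \<Longrightarrow>
      (\<integral>\<^sup>+y. ennpowr (ennreal (t / K) * w y * indicator E y) (q y) \<partial>M) \<le> 1"
proof -
  obtain C where C: "1 \<le> C" "\<And>F t R. 0 < t \<Longrightarrow> admissible F \<Longrightarrow>
      (\<integral>\<^sup>+y\<in>(\<Union>(x, r)\<in>exceeding F t R. open_hull x r). ennpowr (ennreal (t / K\<^sub>0) * w y) (q y) \<partial>M) \<le> ennreal C"
    using modular_on_union_of_hulls by blast
  define s where "s = C powr (1 / q\<^sub>0)"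
  have s: "1 \<le> s" unfolding s_def using C q0 by (intro ge_one_powr_ge_zero) auto
  show ?thesis
  proof (rule that[of "K\<^sub>0 * s"])
    show "0 < K\<^sub>0 * s" using K0_pos s by simp
    fix F t E
    assume t: "0 < t" and F: "admissible F"
      and E: "\<And>y. y \<in> E \<Longrightarrow> \<exists>x r. x \<in> space M \<and> 0 < r \<and> y \<in> Q x r \<and> average_exceeds F t x r"
    define \<Phi> where "\<Phi> y = ennpowr (ennreal (t / K\<^sub>0) * w y) (q y)" for y
    have [measurable]: "\<Phi> \<in> borel_measurable M" unfolding \<Phi>_def[abs_def] by measurable
    define G where "G n = (\<Union>(x, r)\<in>exceeding F t (real n). open_hull x r)" for n :: nat
    have G_sets [measurable]: "G n \<in> sets M" for n
      unfolding G_def by (intro openin_sets openin_Union) (auto simp: exceeding_def openin_open_hull)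
    have "(\<integral>\<^sup>+y\<in>(\<Union>n. G n). \<Phi> y \<partial>M) = (\<integral>\<^sup>+y. (SUP n. \<Phi> y * indicator (G n) y) \<partial>M)"
    proof (rule nn_integral_cong)
      fix y
      show "\<Phi> y * indicator (\<Union>n. G n) y = (SUP n. \<Phi> y * indicator (G n) y)"
      proof (rule antisym)
        show "\<Phi> y * indicator (\<Union>n. G n) y \<le> (SUP n. \<Phi> y * indicator (G n) y)"
        proof (cases "y \<in> (\<Union>n. G n)")
          case True
          then obtain n where "y \<in> G n" by blast
          then show ?thesis using True by (intro SUP_upper2[of n]) auto
        qed simp
        show "(SUP n. \<Phi> y * indicator (G n) y) \<le> \<Phi> y * indicator (\<Union>n. G n) y"
          by (intro SUP_least mult_left_mono) (auto split: split_indicator)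
      qed
    qed
    also have "\<dots> = (SUP n. \<integral>\<^sup>+y\<in>G n. \<Phi> y \<partial>M)"
    proof (rule nn_integral_monotone_convergence_SUP)
      have "G n \<subseteq> G (Suc n)" for n unfolding G_def exceeding_def by fastforce
      then show "incseq (\<lambda>n y. \<Phi> y * indicator (G n) y)"
        by (intro incseq_SucI le_funI mult_left_mono) (auto split: split_indicator)
    qed measurable
    also have "\<dots> \<le> ennreal C" unfolding G_def \<Phi>_def by (intro SUP_least C(2) t F)
    finally have G: "(\<integral>\<^sup>+y\<in>(\<Union>n. G n). \<Phi> y \<partial>M) \<le> ennreal C" .
    have EG: "E \<subseteq> (\<Union>n. G n)"
    proof
      fix y assume "y \<in> E"
      then obtain x r where xr: "x \<in> space M" "0 < r" "y \<in> Q x r" "average_exceeds F t x r" using E by blast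
      obtain n :: nat where "r \<le> real n" using real_arch_simple by blast
      then have "(x, r) \<in> exceeding F t n" using xr by (auto simp: exceeding_def)
      moreover have "y \<in> open_hull x r" using xr subset_open_hull by blast
      ultimately show "y \<in> (\<Union>n. G n)" unfolding G_def by blast
    qed
    have "(\<integral>\<^sup>+y. ennpowr (ennreal (t / (K\<^sub>0 * s)) * w y * indicator E y) (q y) \<partial>M)
      \<le> (\<integral>\<^sup>+y. ennreal (1 / C) * (\<Phi> y * indicator (\<Union>n. G n) y) \<partial>M)"
    proof (rule nn_integral_mono_AE)
      show "AE y in M. ennpowr (ennreal (t / (K\<^sub>0 * s)) * w y * indicator E y) (q y)
        \<le> ennreal (1 / C) * (\<Phi> y * indicator (\<Union>n. G n) y)"
        using q_bounds
      proof eventually_elim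
        case (elim y)
        show ?case
        proof (cases "y \<in> E")
          case True
          then have yG: "y \<in> (\<Union>n. G n)" using EG by blast
          have "ennreal (t / (K\<^sub>0 * s)) * w y = ennreal (1 / s) * (ennreal (t / K\<^sub>0) * w y)"
          proof -
            have "ennreal (t / (K\<^sub>0 * s)) = ennreal (1 / s * (t / K\<^sub>0))" by (simp add: mult.commute)
            also have "\<dots> = ennreal (1 / s) * ennreal (t / K\<^sub>0)"
              using s t K0_pos by (intro ennreal_mult) auto
            finally show ?thesis by (simp add: mult.assoc)
          qed
          then have "ennpowr (ennreal (t / (K\<^sub>0 * s)) * w y) (q y) = ennreal ((1 / s) powr q y) * \<Phi> y"
            using s by (simp add: ennpowr_mult_real \<Phi>_def)
          also have "(1 / s) powr q y \<le> (1 / s) powr q\<^sub>0" using s elim by (intro powr_mono') auto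
          also have "(1 / s) powr q\<^sub>0 = 1 / C"
            using C q0 by (simp add: s_def powr_divide powr_powr)
          finally have "ennpowr (ennreal (t / (K\<^sub>0 * s)) * w y) (q y) \<le> ennreal (1 / C) * \<Phi> y"
            by (simp add: mult_right_mono ennreal_leI)
          then show ?thesis using True yG by simp
        qed simp
      qed
    qed
    also have "\<dots> = ennreal (1 / C) * (\<integral>\<^sup>+y\<in>(\<Union>n. G n). \<Phi> y \<partial>M)" by (rule nn_integral_cmult) measurable
    also have "\<dots> \<le> ennreal (1 / C) * ennreal C" by (intro mult_left_mono G) simp
    also have "\<dots> = 1" using C by (simp flip: ennreal_mult)
    finally show "(\<integral>\<^sup>+y. ennpowr (ennreal (t / (K\<^sub>0 * s)) * w y * indicator E y) (q y) \<partial>M) \<le> 1" .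
  qed
qed

end

section \<open>Necessity of the weight condition\<close>

lemma ennreal_mult_le_of_approx:
  assumes "\<And>N. 0 < N \<Longrightarrow> ennreal N < v \<Longrightarrow> ennreal N * a \<le> C"
  shows "v * a \<le> C"
proof (cases "v = 0")
  case False
  define S where "S = {N. 0 < N \<and> ennreal N < v}"
  have approx: "\<exists>N\<in>S. y < ennreal N" if yv: "y < v" for y
  proof -
    obtain z where z: "y < z" "z < v" using dense[OF yv] by blast
    then obtain N where N: "z = ennreal N" "0 \<le> N" by (cases z) auto
    moreover have "N \<noteq> 0" using z(1) N by auto
    ultimately show ?thesis using z by (intro bexI[of _ N]) (auto simp: S_def)
  qed
  have "S \<noteq> {}" using approx[of 0] False by (auto simp: zero_less_iff_neq_zero)
  have "v = (SUP N\<in>S. ennreal N)"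
  proof (rule antisym)
    show "v \<le> (SUP N\<in>S. ennreal N)"
    proof (rule dense_le)
      fix y assume "y < v"
      then obtain N where "N \<in> S" "y < ennreal N" using approx by blast
      then show "y \<le> (SUP N\<in>S. ennreal N)" by (intro SUP_upper2[of N]) auto
    qed
    show "(SUP N\<in>S. ennreal N) \<le> v" by (rule SUP_least) (auto simp: S_def)
  qed
  then have "v * a = (SUP N\<in>S. ennreal N * a)" using \<open>S \<noteq> {}\<close> by (simp add: SUP_mult_right_ennreal)
  also have "\<dots> \<le> C" using assms by (intro SUP_least) (auto simp: S_def)
  finally show ?thesis .
qed simp

lemma ennreal_prod_le_of_approx:
  assumes "finite J"
    and "\<And>N. (\<And>i. i \<in> J \<Longrightarrow> 0 < N i \<and> ennreal (N i) < V i) \<Longrightarrow> a * (\<Prod>i\<in>J. ennreal (N i)) \<le> C"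
  shows "a * (\<Prod>i\<in>J. V i) \<le> C"
  using assms
proof (induction J arbitrary: a)
  case (insert j J)
  have "V j * (a * (\<Prod>i\<in>J. V i)) \<le> C"
  proof (rule ennreal_mult_le_of_approx)
    fix n assume n: "0 < n" "ennreal n < V j"
    have "(ennreal n * a) * (\<Prod>i\<in>J. V i) \<le> C"
    proof (rule insert.IH)
      fix N assume N: "\<And>i. i \<in> J \<Longrightarrow> 0 < N i \<and> ennreal (N i) < V i"
      have "a * (\<Prod>i\<in>insert j J. ennreal ((N(j := n)) i)) \<le> C"
        using insert.hyps N n by (intro insert.prems) auto
      moreover have "(\<Prod>i\<in>insert j J. ennreal ((N(j := n)) i)) = ennreal n * (\<Prod>i\<in>J. ennreal (N i))"
        using insert.hyps by (subst prod.insert) (auto intro!: arg_cong2[where f = "(*)"] prod.cong)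
      ultimately show "(ennreal n * a) * (\<Prod>i\<in>J. ennreal (N i)) \<le> C" by (simp add: ac_simps)
    qed
    then show "ennreal n * (a * (\<Prod>i\<in>J. V i)) \<le> C" by (simp add: mult.assoc)
  qed
  then show ?case using insert.hyps by (simp add: ac_simps)
qed simp

context homogeneous_type_constants
begin

text \<open>Testing on the dual extremizers of a ball \<open>B\<close>: the maximal function is at least
  \<open>T = \<mu>(B)\<^sup>\<eta>\<^sup>-\<^sup>m \<Prod> N i\<close> on all of \<open>B\<close>, so \<open>B\<close> lies in the level sets below \<open>T\<close>. The bounds \<open>N i\<close> and the levels then
  increase to their suprema.\<close>

lemma A_const_le_weak_bound:
  assumes P: "\<And>i. i \<in> {1..m} \<Longrightarrow> P i \<in> borel_measurable M"
    and P1: "\<And>i. i \<in> {1..m} \<Longrightarrow> \<exists>c>1. AE x in M. c \<le> P i x"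
    and q: "AE x in M. 0 \<le> q x"
    and W: "\<And>i. i \<in> {1..m} \<Longrightarrow> weight M d (W i)"
    and bound: "weak_type_bound M d m \<eta> P q W w C"
  shows "A_const M d m \<eta> P q W w \<le> C"
  unfolding A_const_def
proof (rule SUP_least)
  fix B assume "B \<in> qballs (space M) d"
  then obtain x r where x: "x \<in> space M" "0 < r" and B: "B = Q x r" by (auto simp: qballs_def)
  define \<mu> where "\<mu> = measure M B"
  have \<mu>: "0 < \<mu>" "emeasure M B = ennreal \<mu>"
    unfolding \<mu>_def B using measure_Q_pos[OF x] emeasure_Q[OF x] by auto
  have Bs: "B \<in> sets M" "B \<subseteq> space M" unfolding B using x Q_sets Q_subset_space by auto
  define U where "U = Lp_norm M q (\<lambda>x. w x * indicator B x)"
  show "ennreal (measure M B powr (\<eta> - real m)) * Lp_norm M q (\<lambda>x. w x * indicator B x) *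
      (\<Prod>i=1..m. Lp_norm M (conj_exp (P i)) (\<lambda>x. inverse (W i x) * indicator B x)) \<le> C"
  proof (rule ennreal_prod_le_of_approx)
    fix N assume N: "\<And>i. i \<in> {1..m} \<Longrightarrow> 0 < N i \<and>
      ennreal (N i) < Lp_norm M (conj_exp (P i)) (\<lambda>x. inverse (W i x) * indicator B x)"
    define good where "good i f \<longleftrightarrow> f \<in> borel_measurable M \<and> (\<forall>x. 0 \<le> f x) \<and>
        (\<integral>\<^sup>+x. ennpowr (W i x * ennreal (f x)) (P i x) \<partial>M) \<le> 1 \<and>
        ennreal (N i) \<le> (\<integral>\<^sup>+x\<in>B. ennreal (f x) \<partial>M)" for i and f :: "'a \<Rightarrow> real"
    have "\<exists>f. good i f" if i: "i \<in> {1..m}" for i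
    proof -
      obtain c where c: "1 < c" "AE x in M. c \<le> P i x" using P1[OF i] by blast
      have Wi: "W i \<in> borel_measurable M" "AE x in M. 0 < W i x \<and> W i x < \<infinity>"
        using W[OF i] by (auto simp: weight_def)
      have fin: "emeasure M B < \<infinity>" using \<mu>(2) by simp
      note Ni = conjunct1[OF N[OF i]] conjunct2[OF N[OF i]]
      show ?thesis
        by (rule dual_extremizer[OF Wi(1) P[OF i] Bs(1) fin c Wi(2) Ni]) (auto simp: good_def)
    qed
    then have "\<forall>i\<in>{1..m}. \<exists>f. good i f" by blast
    from bchoice[OF this] obtain f where f': "\<forall>i\<in>{1..m}. good i (f i)" by blast
    have f: "f i \<in> borel_measurable M" "\<And>x. 0 \<le> f i x"
      "(\<integral>\<^sup>+x. ennpowr (W i x * ennreal (f i x)) (P i x) \<partial>M) \<le> 1"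
      "ennreal (N i) \<le> (\<integral>\<^sup>+x\<in>B. ennreal (f i x) \<partial>M)" if "i \<in> {1..m}" for i
      using bspec[OF f' that] by (simp_all add: good_def)
    have norm: "Lp_wnorm M (P i) (W i) (\<lambda>x. ennreal \<bar>f i x\<bar>) \<le> 1" if i: "i \<in> {1..m}" for i
      using Lp_norm_le[of 1 M "\<lambda>x. W i x * ennreal (f i x)" "P i"] f(2,3)[OF i]
      by (simp add: Lp_wnorm_def divide_ennreal_def)
    have "f i \<in> Lp_space M (P i) (W i)" if i: "i \<in> {1..m}" for i
      using f(1)[OF i] norm[OF i] by (auto simp: Lp_space_def intro: order_le_less_trans)
    then have "WL_wnorm M q w (frac_max M d m \<eta> f) \<le> C * (\<Prod>i=1..m. Lp_wnorm M (P i) (W i) (\<lambda>x. ennreal \<bar>f i x\<bar>))"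
      using bound by (auto simp: weak_type_bound_def)
    also have "\<dots> \<le> C * (\<Prod>i=1..m. 1)" using norm by (intro mult_left_mono prod_mono_ennreal) auto
    finally have WL: "WL_wnorm M q w (frac_max M d m \<eta> f) \<le> C" by simp
    define T where "T = \<mu> powr (\<eta> - m) * (\<Prod>i=1..m. N i)"
    have "0 < (\<Prod>i=1..m. N i)" using N by (intro prod_pos) auto
    then have T: "ennreal T = ennreal (\<mu> powr (\<eta> - m)) * (\<Prod>i=1..m. ennreal (N i))"
      using N unfolding T_def by (subst prod_ennreal) (auto simp: ennreal_mult' less_imp_le)
    have large: "ennreal T \<le> frac_max M d m \<eta> f y" if y: "y \<in> B" for y
    proof -
      have "T = \<mu> powr \<eta> * (\<Prod>i=1..m. N i / \<mu>)"
        using \<mu> by (simp add: T_def prod_dividef powr_diff powr_realpow)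
      moreover have "(\<Prod>i=1..m. ennreal (N i / \<mu>)) = ennreal (\<Prod>i=1..m. N i / \<mu>)"
        using N \<mu> by (intro prod_ennreal) (simp add: less_imp_le)
      ultimately have "ennreal T = ennreal (\<mu> powr \<eta>) * (\<Prod>i=1..m. ennreal (N i / \<mu>))"
        by (simp add: ennreal_mult')
      also have "\<dots> \<le> ennreal (\<mu> powr \<eta>) * (\<Prod>i=1..m. (\<integral>\<^sup>+y\<in>B. ennreal \<bar>f i y\<bar> \<partial>M) / emeasure M B)"
      proof (intro mult_left_mono prod_mono_ennreal)
        fix i assume i: "i \<in> {1..m}"
        have "ennreal (N i / \<mu>) = ennreal (N i) / ennreal \<mu>" using N[OF i] \<mu> by (simp add: divide_ennreal)
        also have "\<dots> \<le> (\<integral>\<^sup>+y\<in>B. ennreal \<bar>f i y\<bar> \<partial>M) / ennreal \<mu>"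
          using f(2,4)[OF i] \<mu> by (intro ennreal_divide_le_mono) auto
        finally show "ennreal (N i / \<mu>) \<le> (\<integral>\<^sup>+y\<in>B. ennreal \<bar>f i y\<bar> \<partial>M) / emeasure M B" using \<mu> by simp
      qed simp
      also have "\<dots> = ennreal (measure M B powr \<eta>) * (\<Prod>i=1..m. (\<integral>\<^sup>+y\<in>B. ennreal \<bar>f i y\<bar> \<partial>M) / emeasure M B) * indicator B y"
        using y by (simp add: \<mu>_def)
      also have "\<dots> \<le> frac_max M d m \<eta> f y"
        unfolding frac_max_def using x by (intro SUP_upper) (auto simp: B qballs_def)
      finally show ?thesis .
    qed
    have "ennreal T * U \<le> C"
    proof (rule ennreal_mult_le_of_approx)
      fix t assume t: "0 < t" "ennreal t < ennreal T"
      have "ennreal t * U \<le> Lp_norm M q (\<lambda>x. ennreal t * (w x * indicator B x))"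
        unfolding U_def by (rule Lp_norm_cmult_le[OF t(1)])
      also have "\<dots> \<le> Lp_norm M q (\<lambda>x. ennreal t * w x * indicator {y \<in> space M. ennreal t < frac_max M d m \<eta> f y} x)"
      proof (rule Lp_norm_mono[OF q], rule AE_I2)
        fix y
        show "ennreal t * (w y * indicator B y) \<le> ennreal t * w y * indicator {y \<in> space M. ennreal t < frac_max M d m \<eta> f y} y"
        proof (cases "y \<in> B")
          case True
          then have "ennreal t < frac_max M d m \<eta> f y" using large[OF True] t(2) by order
          then show ?thesis using True Bs by (auto simp: mult.assoc)
        qed simp
      qed
      also have "\<dots> \<le> WL_wnorm M q w (frac_max M d m \<eta> f)"
        unfolding WL_wnorm_def using t by (intro SUP_upper) auto
      also note WL
      finally show "ennreal t * U \<le> C" .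
    qed
    then show "ennreal (measure M B powr (\<eta> - real m)) * Lp_norm M q (\<lambda>x. w x * indicator B x) * (\<Prod>i=1..m. ennreal (N i)) \<le> C"
      unfolding T by (simp add: U_def \<mu>_def ac_simps)
  qed simp
qed

end

section \<open>The characterization\<close>

context weighted_setting
begin

text \<open>Dividing each \<open>f i\<close> by a number \<open>L i\<close> strictly above its norm gives an admissible tuple at the level
  \<open>t / \<Prod> L i\<close>. Letting \<open>L i\<close> decrease to the norm also covers functions of norm zero.\<close>

lemma weak_type_bound_of_A_class: "\<exists>K>0. weak_type_bound M d m \<eta> P q W w (ennreal K)"
proof -
  obtain K where K: "0 < K" "\<And>F t E. 0 < t \<Longrightarrow> admissible F \<Longrightarrow>
      (\<And>y. y \<in> E \<Longrightarrow> \<exists>x r. x \<in> space M \<and> 0 < r \<and> y \<in> Q x r \<and> average_exceeds F t x r) \<Longrightarrow>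
      (\<integral>\<^sup>+y. ennpowr (ennreal (t / K) * w y * indicator E y) (q y) \<partial>M) \<le> 1"
    using weak_type_modular by blast
  have "weak_type_bound M d m \<eta> P q W w (ennreal K)"
    unfolding weak_type_bound_def
  proof (intro allI impI)
    fix f assume f: "\<forall>i\<in>{1..m}. f i \<in> Lp_space M (P i) (W i)"
    have f_meas [measurable]: "f i \<in> borel_measurable M" if "i \<in> {1..m}" for i
      using f that by (simp add: Lp_space_def)
    define n where "n i = enn2real (Lp_wnorm M (P i) (W i) (\<lambda>x. ennreal \<bar>f i x\<bar>))" for i
    have n: "Lp_wnorm M (P i) (W i) (\<lambda>x. ennreal \<bar>f i x\<bar>) = ennreal (n i)" "0 \<le> n i" if "i \<in> {1..m}" for i
      using f that by (auto simp: n_def Lp_space_def)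
    have main: "WL_wnorm M q w (frac_max M d m \<eta> f) \<le> ennreal (K * (\<Prod>i=1..m. L i))"
      if L: "\<And>i. i \<in> {1..m} \<Longrightarrow> n i < L i" for L
      unfolding WL_wnorm_def
    proof (rule SUP_least)
      fix t :: real assume "t \<in> {0<..}"
      then have t: "0 < t" by simp
      have L_pos: "0 < L i" if "i \<in> {1..m}" for i using n(2)[OF that] L[OF that] by simp
      define \<Lambda> where "\<Lambda> = (\<Prod>i=1..m. L i)"
      have \<Lambda>: "0 < \<Lambda>" unfolding \<Lambda>_def using L_pos by (rule prod_pos)
      define F where "F i y = ennreal (1 / L i) * ennreal \<bar>f i y\<bar>" for i y
      have F_meas: "F i \<in> borel_measurable M" if "i \<in> {1..m}" for i
        unfolding F_def[abs_def] using f_meas[OF that] by measurable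
      have "admissible F"
        unfolding admissible_def
      proof (intro ballI conjI F_meas)
        fix i assume i: "i \<in> {1..m}"
        have "(\<integral>\<^sup>+x. ennpowr (W i x * ennreal \<bar>f i x\<bar> / ennreal (L i)) (P i x) \<partial>M) \<le> 1"
        proof (rule modular_le_1)
          show "AE x in M. 0 \<le> P i x" using P_ge_1[OF i] by (intro AE_I2) force
          show "Lp_norm M (P i) (\<lambda>x. W i x * ennreal \<bar>f i x\<bar>) < ennreal (L i)"
            using n[OF i] L[OF i] by (simp add: Lp_wnorm_def ennreal_less_iff)
        qed (rule L_pos[OF i])
        then show "(\<integral>\<^sup>+y. modular_density F i y \<partial>M) \<le> 1"
          using L_pos[OF i]
          by (simp add: modular_density_def F_def divide_ennreal_def inverse_ennreal inverse_eq_divide ac_simps)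
      qed
      have avg: "(\<integral>\<^sup>+y\<in>B. F i y \<partial>M) = ennreal (1 / L i) * (\<integral>\<^sup>+y\<in>B. ennreal \<bar>f i y\<bar> \<partial>M)"
        if "i \<in> {1..m}" and [measurable]: "B \<in> sets M" for i B
      proof -
        have [measurable]: "f i \<in> borel_measurable M" by (rule f_meas[OF that(1)])
        show ?thesis unfolding F_def mult.assoc by (rule nn_integral_cmult) measurable
      qed
      let ?E = "{y \<in> space M. ennreal t < frac_max M d m \<eta> f y}"
      have "\<exists>x r. x \<in> space M \<and> 0 < r \<and> y \<in> Q x r \<and> average_exceeds F (t / \<Lambda>) x r" if y: "y \<in> ?E" for y
      proof -
        obtain B where B: "B \<in> qballs (space M) d"
          "ennreal t < ennreal (measure M B powr \<eta>) * (\<Prod>i=1..m. (\<integral>\<^sup>+y\<in>B. ennreal \<bar>f i y\<bar> \<partial>M) / emeasure M B) * indicator B y"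
        proof -
          have "ennreal t < frac_max M d m \<eta> f y" using y by simp
          then show ?thesis unfolding frac_max_def less_SUP_iff using that by blast
        qed
        then obtain x r where xr: "x \<in> space M" "0 < r" "B = Q x r" by (auto simp: qballs_def)
        have yB: "y \<in> B" using B(2) by (auto split: split_indicator_asm)
        have Bs: "B \<in> sets M" using xr by (simp add: Q_sets)
        have "ennreal (t / \<Lambda>) = ennreal (1 / \<Lambda>) * ennreal t" using t \<Lambda> by (simp flip: ennreal_mult)
        also have "\<dots> < ennreal (1 / \<Lambda>) * (ennreal (measure M B powr \<eta>) * (\<Prod>i=1..m. (\<integral>\<^sup>+y\<in>B. ennreal \<bar>f i y\<bar> \<partial>M) / emeasure M B))"
          using B(2) yB \<Lambda> by (intro ennreal_mult_strict_left_mono) auto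
        also have "ennreal (1 / \<Lambda>) = (\<Prod>i=1..m. ennreal (1 / L i))"
          using L_pos by (subst prod_ennreal) (auto simp: \<Lambda>_def prod_dividef less_imp_le)
        also have "\<dots> * (ennreal (measure M B powr \<eta>) * (\<Prod>i=1..m. (\<integral>\<^sup>+y\<in>B. ennreal \<bar>f i y\<bar> \<partial>M) / emeasure M B))
          = ennreal (measure M B powr \<eta>) * (\<Prod>i=1..m. ennreal (1 / L i) * ((\<integral>\<^sup>+y\<in>B. ennreal \<bar>f i y\<bar> \<partial>M) / emeasure M B))"
          by (simp add: prod.distrib ac_simps)
        also have "(\<Prod>i=1..m. ennreal (1 / L i) * ((\<integral>\<^sup>+y\<in>B. ennreal \<bar>f i y\<bar> \<partial>M) / emeasure M B))
          = (\<Prod>i=1..m. (\<integral>\<^sup>+y\<in>B. F i y \<partial>M) / emeasure M B)"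
          using avg[OF _ Bs] by (intro prod.cong) (simp_all add: ennreal_times_divide)
        finally have "average_exceeds F (t / \<Lambda>) x r" by (simp add: average_exceeds_def xr)
        with xr yB show ?thesis by blast
      qed
      then have "(\<integral>\<^sup>+y. ennpowr (ennreal (t / \<Lambda> / K) * w y * indicator ?E y) (q y) \<partial>M) \<le> 1"
        using t \<Lambda> \<open>admissible F\<close> by (intro K(2)) auto
      moreover have "ennreal (t / \<Lambda> / K) = ennreal t / ennreal (K * \<Lambda>)"
        using t \<Lambda> K by (simp add: divide_ennreal mult.commute)
      ultimately have "(\<integral>\<^sup>+y. ennpowr (ennreal t * w y * indicator ?E y / ennreal (K * \<Lambda>)) (q y) \<partial>M) \<le> 1"
        by (simp add: divide_ennreal_def ac_simps)
      then show "Lp_norm M q (\<lambda>x. ennreal t * w x * indicator ?E x) \<le> ennreal (K * (\<Prod>i=1..m. L i))"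
        using K \<Lambda> unfolding \<Lambda>_def[symmetric] by (intro Lp_norm_le) auto
    qed
    have "(\<lambda>k. ennreal (K * (\<Prod>i=1..m. n i + 1 / Suc k))) \<longlonglongrightarrow> ennreal (K * (\<Prod>i=1..m. n i + 0))"
      by (intro tendsto_ennrealI tendsto_mult tendsto_const tendsto_prod tendsto_add LIMSEQ_Suc lim_1_over_n)
    then have "WL_wnorm M q w (frac_max M d m \<eta> f) \<le> ennreal (K * (\<Prod>i=1..m. n i + 0))"
      by (rule LIMSEQ_le_const) (intro exI allI impI main, simp)
    also have "\<dots> = ennreal K * (\<Prod>i=1..m. Lp_wnorm M (P i) (W i) (\<lambda>x. ennreal \<bar>f i x\<bar>))"
    proof -
      have "(\<Prod>i=1..m. ennreal (n i)) = ennreal (\<Prod>i=1..m. n i)" using n(2) by (rule prod_ennreal)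
      then show ?thesis using n(1) K(1) by (simp add: ennreal_mult')
    qed
    finally show "WL_wnorm M q w (frac_max M d m \<eta> f)
      \<le> ennreal K * (\<Prod>i=1..m. Lp_wnorm M (P i) (W i) (\<lambda>x. ennreal \<bar>f i x\<bar>))" .
  qed
  with K(1) show ?thesis by blast
qed

end

lemma (in homogeneous_type) constants_exist: "\<exists>A D. homogeneous_type_constants M d A D"
proof -
  obtain A where A: "1 \<le> A" "\<forall>x\<in>space M. \<forall>y\<in>space M. \<forall>z\<in>space M. d x y \<le> A * (d x z + d z y)"
    using quasi_triangle by blast
  obtain C :: real where C: "\<And>x r. x \<in> space M \<Longrightarrow> 0 < r \<Longrightarrow>
      0 < emeasure M (qball (space M) d x (2 * r)) \<and>
      emeasure M (qball (space M) d x (2 * r)) \<le> ennreal C * emeasure M (qball (space M) d x r) \<and>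
      ennreal C * emeasure M (qball (space M) d x r) < \<infinity>"
    using doubling by blast
  obtain D :: nat where D: "C \<le> 2 ^ D" using real_arch_pow[of 2 C] by (auto intro: less_imp_le)
  have "measure M (qball (space M) d x (2 * r)) \<le> 2 ^ D * measure M (qball (space M) d x r)"
    if xr: "x \<in> space M" "0 < r" for x r
  proof -
    note * = C[OF xr]
    have "0 < C"
    proof (rule ccontr)
      assume "\<not> 0 < C"
      then have "ennreal C = 0" by (simp add: ennreal_neg)
      with * show False by auto
    qed
    moreover have fin: "emeasure M (qball (space M) d x r) < \<infinity>"
      using * \<open>0 < C\<close> by (auto simp: ennreal_mult_less_top)
    moreover have "emeasure M (qball (space M) d x (2 * r)) < \<infinity>"
      using * by (blast intro: order_le_less_trans)
    ultimately have "measure M (qball (space M) d x (2 * r)) \<le> C * measure M (qball (space M) d x r)"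
      using * by (simp add: emeasure_eq_ennreal_measure flip: ennreal_mult)
    also have "\<dots> \<le> 2 ^ D * measure M (qball (space M) d x r)" using D by (intro mult_right_mono) auto
    finally show ?thesis .
  qed
  then have "homogeneous_type_constants M d A D" using A by unfold_locales auto
  then show ?thesis by blast
qed

text \<open>The bound is strict, which later keeps the conjugate exponents essentially bounded.\<close>

lemma AE_lower_bound_exponent:
  assumes "ereal c < exp_minus M p"
  shows "\<exists>c'>c. AE x in M. c' \<le> p x"
proof -
  obtain c' where c': "ereal c < ereal c'" "ereal c' < exp_minus M p"
    using ereal_dense2[OF assms] by blast
  have "AE x in M. - ereal (p x) \<le> esssup M (\<lambda>x. - ereal (p x))" by (rule esssup_AE)
  then have "AE x in M. c' \<le> p x"
  proof eventually_elim
    case (elim x)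
    then have "exp_minus M p \<le> ereal (p x)" unfolding exp_minus_def by (metis ereal_minus_le_minus ereal_uminus_uminus)
    with c'(2) have "ereal c' \<le> ereal (p x)" by order
    then show ?case by simp
  qed
  with c'(1) show ?thesis by auto
qed

lemma AE_upper_bound_exponent:
  assumes "exp_plus M p < \<infinity>"
  shows "\<exists>c. AE x in M. p x \<le> c"
proof -
  obtain c where c: "exp_plus M p < ereal c" using ereal_dense2[OF assms] by blast
  have "AE x in M. ereal (p x) \<le> esssup M (\<lambda>x. ereal (p x))" by (rule esssup_AE)
  then have "AE x in M. p x \<le> c"
  proof eventually_elim
    case (elim x)
    then have "ereal (p x) \<le> ereal c" using c unfolding exp_plus_def by order
    then show ?case by simp
  qed
  then show ?thesis by blast
qed

theorem theorem1p16:
  fixes M :: "'a measure" and d :: "'a \<Rightarrow> 'a \<Rightarrow> real" and x0 :: 'a and m :: nat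
    and P :: "nat \<Rightarrow> 'a \<Rightarrow> real" and p q :: "'a \<Rightarrow> real" and \<eta> :: real
  assumes "homogeneous_type M d"
    and "x0 \<in> space M"
    and "1 \<le> m"
    and "\<And>i. i \<in> {1..m} \<Longrightarrow> P i \<in> LH (space M) d x0 \<inter> exponents M"
    and "\<And>x. x \<in> space M \<Longrightarrow> 1 / p x = (\<Sum>i=1..m. 1 / P i x)"
    and "q \<in> exponents0 M"
    and "0 \<le> \<eta>" and "\<eta> < real m"
    and "\<And>x. x \<in> space M \<Longrightarrow> 1 / p x - 1 / q x = \<eta>"
  shows "\<exists>C::real. 0 < C \<and>
    (\<forall>(W :: nat \<Rightarrow> 'a \<Rightarrow> ennreal) (w :: 'a \<Rightarrow> ennreal).
      multiple_weight M d m W w \<and> (AE x in M. w x = (\<Prod>i=1..m. W i x)) \<longrightarrow>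
        (weak_type_bounded M d m \<eta> P q W w \<longleftrightarrow> A_class M d m \<eta> P q W w) \<and>
        ennreal (inverse C) * A_const M d m \<eta> P q W w \<le> weak_op_norm M d m \<eta> P q W w \<and>
        (A_class M d m \<eta> P q W w \<longrightarrow>
          (\<exists>K::real. weak_op_norm M d m \<eta> P q W w \<le> ennreal K)))"
proof -
  note x0 = assms(2) and m = assms(3) and PLH = assms(4) and sum_P = assms(5) and \<eta> = assms(7,8) and pq = assms(9)
  interpret homogeneous_type M d by (rule assms(1))
  obtain A D where "homogeneous_type_constants M d A D" using constants_exist by blast
  then interpret homogeneous_type_constants M d A D .
  have P_meas: "P i \<in> borel_measurable M" and P_ge_1: "\<And>x. x \<in> space M \<Longrightarrow> 1 \<le> P i x"
    and P_minus: "1 < exp_minus M (P i)" if "i \<in> {1..m}" for i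
    using PLH[OF that] by (auto simp: exponents_def)
  have P_lower: "\<exists>c>1. AE x in M. c \<le> P i x" if "i \<in> {1..m}" for i
    using P_minus[OF that] AE_lower_bound_exponent[of 1 M "P i"] by (simp add: one_ereal_def)
  have q_meas: "q \<in> borel_measurable M" and q_pos: "\<And>x. x \<in> space M \<Longrightarrow> 0 < q x"
    and q_ess: "0 < exp_minus M q" "exp_plus M q < \<infinity>"
    using assms(6) by (auto simp: exponents0_def)
  obtain q\<^sub>0 where q0: "0 < q\<^sub>0" "AE x in M. q\<^sub>0 \<le> q x"
    using AE_lower_bound_exponent[of 0 M q] q_ess by (auto simp: zero_ereal_def)
  obtain q\<^sub>1 where q1: "AE x in M. q x \<le> q\<^sub>1" using AE_upper_bound_exponent[OF q_ess(2)] by blast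
  have "\<exists>C\<ge>0. (\<forall>x r y z. x \<in> space M \<longrightarrow> 0 < r \<longrightarrow> far x0 x r \<longrightarrow> y \<in> Q x (\<theta> * r) \<longrightarrow> z \<in> Q x (\<theta> * r) \<longrightarrow>
      \<bar>P i y - P i z\<bar> * ln (1 / \<rho> x0 x r) \<le> C) \<and> (\<forall>x\<in>space M. \<bar>P i x\<bar> \<le> C)" if i: "i \<in> {1..m}" for i
    using LH_oscillation[of "P i" x0] PLH[OF i] x0 by (metis IntD1)
  then obtain C where C: "\<And>i. i \<in> {1..m} \<Longrightarrow> 0 \<le> C i"
    "\<And>i x r y z. i \<in> {1..m} \<Longrightarrow> x \<in> space M \<Longrightarrow> 0 < r \<Longrightarrow> far x0 x r \<Longrightarrow> y \<in> Q x (\<theta> * r) \<Longrightarrow> z \<in> Q x (\<theta> * r) \<Longrightarrow>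
      \<bar>P i y - P i z\<bar> * ln (1 / \<rho> x0 x r) \<le> C i"
    "\<And>i x. i \<in> {1..m} \<Longrightarrow> x \<in> space M \<Longrightarrow> \<bar>P i x\<bar> \<le> C i"
    by metis
  define C\<^sub>P where "C\<^sub>P = (\<Sum>i=1..m. C i)"
  have C_le: "C i \<le> C\<^sub>P" if "i \<in> {1..m}" for i
    unfolding C\<^sub>P_def using that C(1) by (intro member_le_sum) auto
  have q_P: "1 \<le> (\<Sum>i=1..m. q x / P i x)" if x: "x \<in> space M" for x
  proof -
    have "(\<Sum>i=1..m. 1 / P i x) = \<eta> + 1 / q x" using sum_P[OF x] pq[OF x] by linarith
    then have "q x * (\<Sum>i=1..m. 1 / P i x) = q x * \<eta> + 1" using q_pos[OF x] by (simp add: distrib_left)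
    moreover have "(\<Sum>i=1..m. q x / P i x) = q x * (\<Sum>i=1..m. 1 / P i x)" by (simp add: sum_distrib_left)
    ultimately show ?thesis using q_pos[OF x] \<eta> by simp
  qed
  have lower: "A_const M d m \<eta> P q W w \<le> C'"
    if "multiple_weight M d m W w" "weak_type_bound M d m \<eta> P q W w C'" for W w C'
    using that P_meas P_lower q_pos
    by (intro A_const_le_weak_bound) (auto simp: multiple_weight_def less_imp_le)
  have upper: "\<exists>K>0. weak_type_bound M d m \<eta> P q W w (ennreal K)"
    if mw: "multiple_weight M d m W w" and A: "A_class M d m \<eta> P q W w" for W w
  proof -
    interpret weighted_setting M d A D x0 m \<eta> P q W w C\<^sub>P q\<^sub>0 q\<^sub>1
    proof unfold_locales
      fix i x assume i: "i \<in> {1..m}" and x: "x \<in> space M"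
      show "P i x \<le> C\<^sub>P" using C(3)[OF i x] C_le[OF i] by linarith
      show "1 \<le> P i x" by (rule P_ge_1[OF i x])
      fix r y z assume "0 < r" "far x0 x r" "y \<in> Q x (\<theta> * r)" "z \<in> Q x (\<theta> * r)"
      from C(2)[OF i x this] C_le[OF i] show "\<bar>P i y - P i z\<bar> * ln (1 / \<rho> x0 x r) \<le> C\<^sub>P" by linarith
    next
      show "AE x in M. 1 < P i x" if i: "i \<in> {1..m}" for i
        using P_lower[OF i] by (auto elim!: eventually_mono)
      show "AE x in M. q\<^sub>0 \<le> q x \<and> q x \<le> q\<^sub>1" using q0(2) q1 by eventually_elim simp
      show "A_const M d m \<eta> P q W w < \<infinity>" using A by (simp add: A_class_def)
    qed (use x0 m \<eta> P_meas q_meas q0 q_P mw in \<open>auto simp: multiple_weight_def\<close>)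
    show ?thesis by (rule weak_type_bound_of_A_class)
  qed
  show ?thesis
  proof (rule exI[of _ 1], intro conjI allI impI)
    fix W :: "nat \<Rightarrow> 'a \<Rightarrow> ennreal" and w :: "'a \<Rightarrow> ennreal"
    assume "multiple_weight M d m W w \<and> (AE x in M. w x = (\<Prod>i=1..m. W i x))"
    then have mw: "multiple_weight M d m W w" by simp
    show "weak_type_bounded M d m \<eta> P q W w \<longleftrightarrow> A_class M d m \<eta> P q W w"
    proof
      assume "weak_type_bounded M d m \<eta> P q W w"
      then obtain C' where "weak_type_bound M d m \<eta> P q W w (ennreal C')" by (auto simp: weak_type_bounded_def)
      from lower[OF mw this] show "A_class M d m \<eta> P q W w"
        unfolding A_class_def by (rule order_le_less_trans) simp
    next
      assume "A_class M d m \<eta> P q W w"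
      from upper[OF mw this] show "weak_type_bounded M d m \<eta> P q W w"
        by (auto simp: weak_type_bounded_def intro: less_imp_le)
    qed
    show "ennreal (inverse 1) * A_const M d m \<eta> P q W w \<le> weak_op_norm M d m \<eta> P q W w"
      unfolding weak_op_norm_def using lower[OF mw] by (intro Inf_greatest) simp
    show "\<exists>K::real. weak_op_norm M d m \<eta> P q W w \<le> ennreal K" if A: "A_class M d m \<eta> P q W w"
      using upper[OF mw A] unfolding weak_op_norm_def by (auto intro: Inf_lower)
  qed simp
qed

end
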